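(* Let $(M,[g])$ be a conformal manifold of even dimension $n\ge4$. For any vector bundle with connection $(\mathcal V,D)$ over $M$, any $g\in[g]$ and $\hat g=e^{2\omega}g$ with $\omega$ a smooth function, and any $\kappa\in\mathcal C^{n/2-1}(\mathcal V)$ (i.e. any $\mathcal V$-valued $(n/2-1)$-form with $d^D\kappa=0$), $$Q^{D,\hat g}_{n/2-1}\kappa=Q^{D,g}_{n/2-1}\kappa+2\,\delta^Dd^D(\omega\kappa).$$
   Context: $\mathcal E[w]$ is the bundle of conformal densities of weight $w$ (normalised so that $(-n)$-densities are integrable) and $\boldsymbol g\in S^2T^*M\otimes\mathcal E[2]$ is the conformal metric, used to raise indices and take traces. $\mathcal E^k(\mathcal V)$ denotes $\mathcal V$-valued $k$-forms, and $\mathcal E_k(\mathcal V)=\mathcal E^k(\mathcal V)\otimes\mathcal E[2k-n]$ (so $\mathcal E_{n/2-1}(\mathcal V)=\mathcal E^{n/2-1}(\mathcal V)\otimes\mathcal E[-2]$). $d^D$ is the exterior covariant derivative coupled to $D$, and $\delta^D$ the corresponding coderivative, the $D$-coupled version of the formal adjoint $\delta$ of $d$: in a scale $g$, $(\delta^D u)_{a_2\cdots a_k}=-\boldsymbol g^{ab}\nabla_au_{ba_2\cdots a_k}$ with $\nabla$ the Levi-Civita connection of $g$ coupled with $D$; as a map $\mathcal E_{k+1}(\mathcal V)\to\mathcal E_k(\mathcal V)$ it is conformally invariant. $\mathcal C^k(\mathcal V)=\{\kappa\in\mathcal E^k(\mathcal V)\mid d^D\kappa=0\}$. $\mathsf P_{ab}=\frac1{n-2}(\mathrm{Ric}_{ab}-\mathsf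 J g_{ab})$ is the Schouten tensor, $\mathsf J$ its trace. $\mathsf P$ is viewed as an endomorphism of the tangent bundle and $\mathsf P\sharp$ is its derivation action on forms, $(\mathsf P\sharp u)_{a_1\cdots a_k}=\sum_i\mathsf P_{a_i}{}^{b}u_{a_1\cdots b\cdots a_k}$ ($b$ in the $i$-th slot). The operator $Q^{D,g}_{n/2-1}:\mathcal E^{n/2-1}(\mathcal V)\to\mathcal E_{n/2-1}(\mathcal V)$ is defined, using the metric $g$, by $$Q^{D,g}_{n/2-1}=d^D\delta^D-4\,\mathsf P\sharp+2\,\mathsf J .$$ (In terms of ordinary forms, trivialising densities with the respective metrics, the asserted law reads $e^{2\omega}Q^{D,\hat g}_{n/2-1}\kappa=Q^{D,g}_{n/2-1}\kappa+2\delta_g^Dd^D(\omega\kappa)$.) *)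

theory Defs
  imports "HOL-Analysis.Analysis"
begin

section \<open>Smooth functions and manifolds\<close>

(* Meant for open S. *)
primrec Ck_on :: "nat \<Rightarrow> 'a::real_normed_vector set \<Rightarrow> ('a \<Rightarrow> 'b::real_normed_vector) \<Rightarrow> bool"
where
  "Ck_on 0 S f \<longleftrightarrow> continuous_on S f"
| "Ck_on (Suc k) S f \<longleftrightarrow>
     (\<forall>x\<in>S. f differentiable (at x)) \<and>
     (\<forall>v. Ck_on k S (\<lambda>x. frechet_derivative f (at x) v))"

definition smooth_on :: "'a::real_normed_vector set \<Rightarrow> ('a \<Rightarrow> 'b::real_normed_vector) \<Rightarrow> bool"
  where "smooth_on S f \<longleftrightarrow> (\<forall>k. Ck_on k S f)"

type_synonym ('m, 'n) chart = "'m set \<times> ('m \<Rightarrow> real ^ 'n)"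

definition chart_inv :: "('m, 'n) chart \<Rightarrow> real ^ 'n \<Rightarrow> 'm"
  where "chart_inv c = inv_into (fst c) (snd c)"

definition is_chart :: "('m::topological_space, 'n::finite) chart \<Rightarrow> bool"
  where "is_chart c \<longleftrightarrow> open (fst c) \<and> open (snd c ` fst c) \<and>
           homeomorphism (fst c) (snd c ` fst c) (snd c) (chart_inv c)"

(* The manifold is the whole type 'm, of dimension CARD('n); A is any smooth atlas of it,
   not necessarily maximal. *)
definition smooth_manifold ::
  "('m::{t2_space, second_countable_topology}, 'n::finite) chart set \<Rightarrow> bool"
  where "smooth_manifold A \<longleftrightarrow>
    (\<forall>c\<in>A. is_chart c) \<and> (\<Union>c\<in>A. fst c) = UNIV \<and>
    (\<forall>c\<in>A. \<forall>c'\<in>A. smooth_on (snd c ` (fst c \<inter> fst c')) (snd c' \<circ> chart_inv c))"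

definition smooth_fun ::
  "('m::topological_space, 'n::finite) chart set \<Rightarrow> 'm set \<Rightarrow> ('m \<Rightarrow> real) \<Rightarrow> bool"
  where "smooth_fun A W f \<longleftrightarrow> (\<forall>c\<in>A. smooth_on (snd c ` (W \<inter> fst c)) (f \<circ> chart_inv c))"

definition smooth_near ::
  "('m::topological_space, 'n::finite) chart set \<Rightarrow> 'm \<Rightarrow> ('m \<Rightarrow> real) \<Rightarrow> bool"
  where "smooth_near A p f \<longleftrightarrow> (\<exists>W. open W \<and> p \<in> W \<and> smooth_fun A W f)"


section \<open>Tangent vectors\<close>

(* A tangent vector at p is a derivation on the functions that are smooth near p.  It is given
   the value 0 on all other functions, so that equal derivations are equal as HOL functions. *)
type_synonym 'm tvec = "('m \<Rightarrow> real) \<Rightarrow> real"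

definition coord_vec ::
  "('m::topological_space, 'n::finite) chart set \<Rightarrow> ('m, 'n) chart \<Rightarrow> 'n \<Rightarrow> 'm \<Rightarrow> 'm tvec"
  where "coord_vec A c i p =
    (\<lambda>f. if smooth_near A p f
         then frechet_derivative (f \<circ> chart_inv c) (at (snd c p)) (axis i 1) else 0)"

definition tangent_space ::
  "('m::topological_space, 'n::finite) chart set \<Rightarrow> 'm \<Rightarrow> 'm tvec set"
  where "tangent_space A p =
    {v. \<exists>c\<in>A. p \<in> fst c \<and> (\<exists>a :: real ^ 'n. v = (\<lambda>f. \<Sum>i\<in>UNIV. a $ i * coord_vec A c i p f))}"


section \<open>Vector bundles and connections\<close>

(* A frame (W, r, e) consists of the sections e 0, ..., e (r - 1) over the open set W.
   The fibres of a bundle are subspaces V p of one real vector space 'v.  This is no restriction: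
   the direct sum of the fibres of an arbitrary bundle can serve as 'v, of which only the linear
   structure is used.  The topology and the smooth structure come from the frames in F. *)
type_synonym ('m, 'v) frame = "'m set \<times> nat \<times> (nat \<Rightarrow> 'm \<Rightarrow> 'v)"

definition frame_basis :: "nat \<Rightarrow> (nat \<Rightarrow> 'm \<Rightarrow> 'v) \<Rightarrow> 'm \<Rightarrow> 'v set"
  where "frame_basis r e p = (\<lambda>j. e j p) ` {..<r}"

definition smooth_section ::
  "('m::topological_space, 'n::finite) chart set \<Rightarrow> ('m \<Rightarrow> 'v::real_vector set) \<Rightarrow>
   ('m, 'v) frame set \<Rightarrow> 'm set \<Rightarrow> ('m \<Rightarrow> 'v) \<Rightarrow> bool"
  where "smooth_section A V F W s \<longleftrightarrow> (\<forall>p\<in>W. s p \<in> V p) \<and>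
    (\<forall>(U, r, e)\<in>F. \<forall>j<r.
       smooth_fun A (W \<inter> U) (\<lambda>p. representation (frame_basis r e p) (s p) (e j p)))"

definition vector_bundle ::
  "('m::topological_space, 'n::finite) chart set \<Rightarrow> ('m \<Rightarrow> 'v::real_vector set) \<Rightarrow>
   ('m, 'v) frame set \<Rightarrow> bool"
  where "vector_bundle A V F \<longleftrightarrow>
    (\<Union>(U, r, e)\<in>F. U) = UNIV \<and>
    (\<forall>(U, r, e)\<in>F. open U \<and>
       (\<forall>p\<in>U. inj_on (\<lambda>j. e j p) {..<r} \<and> independent (frame_basis r e p) \<and>
              span (frame_basis r e p) = V p) \<and>
       (\<forall>j<r. smooth_section A V F U (e j)))"

(* D s p v is the covariant derivative of the local section s at p along v.  A section over an
   open set W is a function on 'm of which only the values on W matter. *)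
type_synonym ('m, 'v) connection = "('m \<Rightarrow> 'v) \<Rightarrow> 'm \<Rightarrow> 'm tvec \<Rightarrow> 'v"

definition is_connection ::
  "('m::topological_space, 'n::finite) chart set \<Rightarrow> ('m \<Rightarrow> 'v::real_vector set) \<Rightarrow>
   ('m, 'v) frame set \<Rightarrow> ('m, 'v) connection \<Rightarrow> bool"
  where "is_connection A V F D \<longleftrightarrow>
    (\<forall>W s. open W \<and> smooth_section A V F W s \<longrightarrow>
       (\<forall>p\<in>W. \<forall>v\<in>tangent_space A p. D s p v \<in> V p) \<and>
       (\<forall>p\<in>W. \<forall>v\<in>tangent_space A p. \<forall>w\<in>tangent_space A p. \<forall>a b.
          D s p (\<lambda>f. a * v f + b * w f) = a *\<^sub>R D s p v + b *\<^sub>R D s p w) \<and>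
       (\<forall>c\<in>A. \<forall>i. smooth_section A V F (W \<inter> fst c) (\<lambda>q. D s q (coord_vec A c i q))) \<and>
       (\<forall>t. smooth_section A V F W t \<longrightarrow>
          (\<forall>p\<in>W. \<forall>v\<in>tangent_space A p. D (\<lambda>q. s q + t q) p v = D s p v + D t p v)) \<and>
       (\<forall>f. smooth_fun A W f \<longrightarrow>
          (\<forall>p\<in>W. \<forall>v\<in>tangent_space A p.
             D (\<lambda>q. f q *\<^sub>R s q) p v = v f *\<^sub>R s p + f p *\<^sub>R D s p v)))"


section \<open>Bundle-valued forms and metrics\<close>

type_synonym ('m, 'v) vform = "'m \<Rightarrow> 'm tvec list \<Rightarrow> 'v"

definition vforms ::
  "('m::topological_space, 'n::finite) chart set \<Rightarrow> ('m \<Rightarrow> 'v::real_vector set) \<Rightarrow>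
   ('m, 'v) frame set \<Rightarrow> nat \<Rightarrow> ('m, 'v) vform set"
  where "vforms A V F k = {u.
    (\<forall>p vs. length vs = k \<and> set vs \<subseteq> tangent_space A p \<longrightarrow>
       u p vs \<in> V p \<and>
       (\<forall>i<k. \<forall>v\<in>tangent_space A p. \<forall>w\<in>tangent_space A p. \<forall>a b.
          u p (vs[i := (\<lambda>f. a * v f + b * w f)]) = a *\<^sub>R u p (vs[i := v]) + b *\<^sub>R u p (vs[i := w])) \<and>
       (\<forall>i j. i < j \<and> j < k \<and> vs ! i = vs ! j \<longrightarrow> u p vs = 0)) \<and>
    (\<forall>c\<in>A. \<forall>I :: 'n list. length I = k \<longrightarrow>
       smooth_section A V F (fst c) (\<lambda>q. u q (map (\<lambda>i. coord_vec A c i q) I)))}"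

type_synonym 'm metric = "'m \<Rightarrow> 'm tvec \<Rightarrow> 'm tvec \<Rightarrow> real"

(* Pseudo-Riemannian metrics of arbitrary signature, Riemannian ones included. *)
definition is_metric ::
  "('m::topological_space, 'n::finite) chart set \<Rightarrow> 'm metric \<Rightarrow> bool"
  where "is_metric A g \<longleftrightarrow>
    (\<forall>p. \<forall>v\<in>tangent_space A p. \<forall>w\<in>tangent_space A p.
       g p v w = g p w v \<and>
       (\<forall>z\<in>tangent_space A p. \<forall>a b.
          g p (\<lambda>f. a * v f + b * w f) z = a * g p v z + b * g p w z)) \<and>
    (\<forall>p. \<forall>v\<in>tangent_space A p. (\<forall>w\<in>tangent_space A p. g p v w = 0) \<longrightarrow> v = (\<lambda>_. 0)) \<and>
    (\<forall>c\<in>A. \<forall>i j. smooth_fun A (fst c) (\<lambda>q. g q (coord_vec A c i q) (coord_vec A c j q)))"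

definition rescale :: "('m \<Rightarrow> real) \<Rightarrow> 'm metric \<Rightarrow> 'm metric"
  where "rescale \<omega> g = (\<lambda>p v w. exp (2 * \<omega> p) * g p v w)"

definition conformal_class ::
  "('m::topological_space, 'n::finite) chart set \<Rightarrow> 'm metric set \<Rightarrow> bool"
  where "conformal_class A C \<longleftrightarrow>
    (\<exists>g. is_metric A g \<and> C = {rescale \<omega> g |\<omega>. smooth_fun A UNIV \<omega>})"


section \<open>The Levi-Civita connection and its curvature in local coordinates\<close>

definition metric_mat ::
  "('m::topological_space, 'n::finite) chart set \<Rightarrow> 'm metric \<Rightarrow> ('m, 'n) chart \<Rightarrow> 'm \<Rightarrow> real ^ 'n ^ 'n"
  where "metric_mat A g c p = (\<chi> i j. g p (coord_vec A c i p) (coord_vec A c j p))"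

definition metric_inv ::
  "('m::topological_space, 'n::finite) chart set \<Rightarrow> 'm metric \<Rightarrow> ('m, 'n) chart \<Rightarrow> 'm \<Rightarrow> real ^ 'n ^ 'n"
  where "metric_inv A g c p = matrix_inv (metric_mat A g c p)"

(* christoffel A g c k i j is the function \<Gamma>^k_{ij} on the domain of c. *)
definition christoffel ::
  "('m::topological_space, 'n::finite) chart set \<Rightarrow> 'm metric \<Rightarrow> ('m, 'n) chart \<Rightarrow>
   'n \<Rightarrow> 'n \<Rightarrow> 'n \<Rightarrow> 'm \<Rightarrow> real"
  where "christoffel A g c k i j p =
    (\<Sum>l\<in>UNIV. metric_inv A g c p $ k $ l *
       (coord_vec A c i p (\<lambda>q. metric_mat A g c q $ j $ l)
        + coord_vec A c j p (\<lambda>q. metric_mat A g c q $ i $ l)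
        - coord_vec A c l p (\<lambda>q. metric_mat A g c q $ i $ j))) / 2"

(* R_{ab}{}^k{}_l, with the convention (\<nabla>_a \<nabla>_b - \<nabla>_b \<nabla>_a) X^k = R_{ab}{}^k{}_l X^l. *)
definition riemann ::
  "('m::topological_space, 'n::finite) chart set \<Rightarrow> 'm metric \<Rightarrow> ('m, 'n) chart \<Rightarrow> 'm \<Rightarrow>
   'n \<Rightarrow> 'n \<Rightarrow> 'n \<Rightarrow> 'n \<Rightarrow> real"
  where "riemann A g c p a b k l =
    coord_vec A c a p (christoffel A g c k b l) - coord_vec A c b p (christoffel A g c k a l)
    + (\<Sum>m\<in>UNIV. christoffel A g c k a m p * christoffel A g c m b l p
               - christoffel A g c k b m p * christoffel A g c m a l p)"

definition ricci ::
  "('m::topological_space, 'n::finite) chart set \<Rightarrow> 'm metric \<Rightarrow> ('m, 'n) chart \<Rightarrow> 'm \<Rightarrow>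
   'n \<Rightarrow> 'n \<Rightarrow> real"
  where "ricci A g c p a b = (\<Sum>k\<in>UNIV. riemann A g c p k a k b)"

definition scal ::
  "('m::topological_space, 'n::finite) chart set \<Rightarrow> 'm metric \<Rightarrow> ('m, 'n) chart \<Rightarrow> 'm \<Rightarrow> real"
  where "scal A g c p = (\<Sum>a\<in>UNIV. \<Sum>b\<in>UNIV. metric_inv A g c p $ a $ b * ricci A g c p a b)"

(* Taking traces in P = (Ric - J g) / (n - 2) with J the trace of P forces this value of J;
   see trace_schouten below. *)
definition schouten_J ::
  "('m::topological_space, 'n::finite) chart set \<Rightarrow> 'm metric \<Rightarrow> ('m, 'n) chart \<Rightarrow> 'm \<Rightarrow> real"
  where "schouten_J A g c p = scal A g c p / (2 * (real CARD('n) - 1))"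

definition schouten ::
  "('m::topological_space, 'n::finite) chart set \<Rightarrow> 'm metric \<Rightarrow> ('m, 'n) chart \<Rightarrow> 'm \<Rightarrow>
   'n \<Rightarrow> 'n \<Rightarrow> real"
  where "schouten A g c p a b =
    (ricci A g c p a b - schouten_J A g c p * metric_mat A g c p $ a $ b) / (real CARD('n) - 2)"


section \<open>Operators on bundle-valued forms\<close>

(* The operators act on forms given by their components in all charts: u c p [a1, ..., ak] is
   u(\<partial>_{a1}, ..., \<partial>_{ak}) at a point p of the domain of the chart c. *)
type_synonym ('m, 'n, 'v) comps = "('m, 'n) chart \<Rightarrow> 'm \<Rightarrow> 'n list \<Rightarrow> 'v"

definition components ::
  "('m::topological_space, 'n::finite) chart set \<Rightarrow> ('m, 'v) vform \<Rightarrow> ('m, 'n, 'v) comps"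
  where "components A u = (\<lambda>c p I. u p (map (\<lambda>i. coord_vec A c i p) I))"

(* (d^D u)_{a0...ak} = \<Sum>_j (-1)^j D_{aj} u_{a0...ak}, with aj omitted in the j-th term. *)
definition ext_cov ::
  "('m::topological_space, 'n::finite) chart set \<Rightarrow> ('m, 'v::real_vector) connection \<Rightarrow>
   ('m, 'n, 'v) comps \<Rightarrow> ('m, 'n, 'v) comps"
  where "ext_cov A D u = (\<lambda>c p I. \<Sum>j<length I.
    (-1) ^ j *\<^sub>R D (\<lambda>q. u c q (take j I @ drop (Suc j) I)) p (coord_vec A c (I ! j) p))"

(* \<nabla>_a u, the Levi-Civita connection of g coupled with D. *)
definition nabla ::
  "('m::topological_space, 'n::finite) chart set \<Rightarrow> ('m, 'v::real_vector) connection \<Rightarrow> 'm metric \<Rightarrow>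
   ('m, 'n, 'v) comps \<Rightarrow> 'n \<Rightarrow> ('m, 'n, 'v) comps"
  where "nabla A D g u a = (\<lambda>c p I. D (\<lambda>q. u c q I) p (coord_vec A c a p)
    - (\<Sum>j<length I. \<Sum>m\<in>UNIV. christoffel A g c m a (I ! j) p *\<^sub>R u c p (I[j := m])))"

definition codiff ::
  "('m::topological_space, 'n::finite) chart set \<Rightarrow> ('m, 'v::real_vector) connection \<Rightarrow> 'm metric \<Rightarrow>
   ('m, 'n, 'v) comps \<Rightarrow> ('m, 'n, 'v) comps"
  where "codiff A D g u = (\<lambda>c p I.
    - (\<Sum>a\<in>UNIV. \<Sum>b\<in>UNIV. metric_inv A g c p $ a $ b *\<^sub>R nabla A D g u a c p (b # I)))"

definition schouten_sharp ::
  "('m::topological_space, 'n::finite) chart set \<Rightarrow> 'm metric \<Rightarrow>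
   ('m, 'n, 'v::real_vector) comps \<Rightarrow> ('m, 'n, 'v) comps"
  where "schouten_sharp A g u = (\<lambda>c p I. \<Sum>j<length I. \<Sum>b\<in>UNIV.
    (\<Sum>a\<in>UNIV. schouten A g c p (I ! j) a * metric_inv A g c p $ a $ b) *\<^sub>R u c p (I[j := b]))"

definition closed_vforms ::
  "('m::topological_space, 'n::finite) chart set \<Rightarrow> ('m \<Rightarrow> 'v::real_vector set) \<Rightarrow>
   ('m, 'v) frame set \<Rightarrow> ('m, 'v) connection \<Rightarrow> nat \<Rightarrow> ('m, 'v) vform set"
  where "closed_vforms A V F D k = {u \<in> vforms A V F k.
    \<forall>c\<in>A. \<forall>p\<in>fst c. \<forall>I. length I = Suc k \<longrightarrow> ext_cov A D (components A u) c p I = 0}"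


section \<open>Densities and the operator Q\<close>

(* A conformal density of weight w is a function h \<mapsto> f_h of the metric h in the conformal class
   (its trivialisation by the scale h) with f_{exp(2 \<upsilon>) h} = exp(w \<upsilon>) f_h. *)
type_synonym ('m, 'n, 'v) density_comps = "'m metric \<Rightarrow> ('m, 'n, 'v) comps"

(* The \<upsilon> with h = exp(2 \<upsilon>) g. *)
definition log_factor :: "'m metric \<Rightarrow> 'm metric \<Rightarrow> 'm \<Rightarrow> real"
  where "log_factor g h = (SOME \<upsilon>. h = rescale \<upsilon> g)"

(* The density-valued form of weight w that is T in the scale g. *)
definition density_from_scale ::
  "real \<Rightarrow> 'm metric \<Rightarrow> ('m, 'n, 'v::real_vector) comps \<Rightarrow> ('m, 'n, 'v) density_comps"
  where "density_from_scale w g T = (\<lambda>h c p I. exp (w * log_factor g h p) *\<^sub>R T c p I)"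

definition weight_zero :: "('m, 'n, 'v) comps \<Rightarrow> ('m, 'n, 'v) density_comps"
  where "weight_zero T = (\<lambda>h. T)"

(* \<delta>^D from E_{k+1} = E^{k+1}[2(k+1) - n] to E_k = E^k[2k - n]. *)
definition codiff_density ::
  "('m::topological_space, 'n::finite) chart set \<Rightarrow> ('m, 'v::real_vector) connection \<Rightarrow>
   ('m, 'n, 'v) density_comps \<Rightarrow> ('m, 'n, 'v) density_comps"
  where "codiff_density A D U = (\<lambda>h. codiff A D h (U h))"

definition Q_in_scale ::
  "('m::topological_space, 'n::finite) chart set \<Rightarrow> ('m, 'v::real_vector) connection \<Rightarrow> 'm metric \<Rightarrow>
   ('m, 'n, 'v) comps \<Rightarrow> ('m, 'n, 'v) comps"
  where "Q_in_scale A D g u = (\<lambda>c p I. ext_cov A D (codiff A D g u) c p I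
    - 4 *\<^sub>R schouten_sharp A g u c p I + (2 * schouten_J A g c p) *\<^sub>R u c p I)"

(* On forms of degree k = n/2 - 1; the values lie in E_k, of weight 2k - n = -2. *)
definition Q_op ::
  "('m::topological_space, 'n::finite) chart set \<Rightarrow> ('m, 'v::real_vector) connection \<Rightarrow> 'm metric \<Rightarrow>
   ('m, 'n, 'v) comps \<Rightarrow> ('m, 'n, 'v) density_comps"
  where "Q_op A D g u = density_from_scale (-2) g (Q_in_scale A D g u)"


section \<open>Consistency of the conventions\<close>

lemma christoffel_commute:
  assumes "\<And>q i j. metric_mat A g c q $ i $ j = metric_mat A g c q $ j $ i"
  shows "christoffel A g c k i j p = christoffel A g c k j i p"
  unfolding christoffel_def using assms by (simp add: add.commute)

lemma metric_inv_left:
  assumes "invertible (metric_mat A g c p)"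
  shows "(\<Sum>l\<in>UNIV. metric_mat A g c p $ d $ l * metric_inv A g c p $ l $ b) = (if d = b then 1 else 0)"
proof -
  have "metric_mat A g c p ** metric_inv A g c p = mat 1"
    unfolding metric_inv_def matrix_inv_def
    using someI_ex[OF assms[unfolded invertible_def]] by blast
  then have "(metric_mat A g c p ** metric_inv A g c p) $ d $ b = mat 1 $ d $ b" by simp
  then show ?thesis by (simp add: matrix_matrix_mult_def mat_def)
qed

lemma christoffel_lower:
  assumes "invertible (metric_mat A g c p)"
  shows "(\<Sum>k\<in>UNIV. metric_mat A g c p $ d $ k * christoffel A g c k i j p) =
    (coord_vec A c i p (\<lambda>q. metric_mat A g c q $ j $ d)
     + coord_vec A c j p (\<lambda>q. metric_mat A g c q $ i $ d)
     - coord_vec A c d p (\<lambda>q. metric_mat A g c q $ i $ j)) / 2"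
    (is "_ = ?X d / 2")
proof -
  have "(\<Sum>k\<in>UNIV. metric_mat A g c p $ d $ k * christoffel A g c k i j p) =
    (\<Sum>k\<in>UNIV. \<Sum>l\<in>UNIV. metric_mat A g c p $ d $ k * metric_inv A g c p $ k $ l * ?X l) / 2"
    by (simp add: christoffel_def sum_distrib_left sum_divide_distrib mult.assoc)
  also have "\<dots> = (\<Sum>l\<in>UNIV. \<Sum>k\<in>UNIV. metric_mat A g c p $ d $ k * metric_inv A g c p $ k $ l * ?X l) / 2"
    by (subst sum.swap) simp
  also have "\<dots> = (\<Sum>l\<in>UNIV. (if d = l then 1 else 0) * ?X l) / 2"
    by (simp only: sum_distrib_right[symmetric] metric_inv_left[OF assms])
  also have "\<dots> = ?X d / 2" by (simp add: if_distrib[of "\<lambda>x. x * _"] cong: if_cong)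
  finally show ?thesis .
qed

lemma christoffel_metric_compatible:
  assumes "invertible (metric_mat A g c p)"
    and sym: "\<And>q i j. metric_mat A g c q $ i $ j = metric_mat A g c q $ j $ i"
  shows "coord_vec A c a p (\<lambda>q. metric_mat A g c q $ i $ j) =
    (\<Sum>k\<in>UNIV. christoffel A g c k a i p * metric_mat A g c p $ k $ j) +
    (\<Sum>k\<in>UNIV. christoffel A g c k a j p * metric_mat A g c p $ i $ k)"
proof -
  have "(\<Sum>k\<in>UNIV. christoffel A g c k a i p * metric_mat A g c p $ k $ j) =
        (\<Sum>k\<in>UNIV. metric_mat A g c p $ j $ k * christoffel A g c k a i p)"
    by (rule sum.cong) (use sym in \<open>simp_all add: mult.commute\<close>)
  moreover have "(\<Sum>k\<in>UNIV. christoffel A g c k a j p * metric_mat A g c p $ i $ k) =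
        (\<Sum>k\<in>UNIV. metric_mat A g c p $ i $ k * christoffel A g c k a j p)"
    by (rule sum.cong) (simp_all add: mult.commute)
  moreover have "(\<lambda>q. metric_mat A g c q $ j $ i) = (\<lambda>q. metric_mat A g c q $ i $ j)"
    using sym by (intro ext)
  moreover have "(\<lambda>q. metric_mat A g c q $ a $ j) = (\<lambda>q. metric_mat A g c q $ j $ a)"
    "(\<lambda>q. metric_mat A g c q $ a $ i) = (\<lambda>q. metric_mat A g c q $ i $ a)"
    using sym by (intro ext; blast)+
  ultimately show ?thesis
    unfolding christoffel_lower[OF assms(1)] by (simp add: christoffel_lower[OF assms(1)] field_simps)
qed

lemma trace_schouten:
  fixes A :: "('m::topological_space, 'n::finite) chart set"
  assumes "invertible (metric_mat A g c p)" and "CARD('n) \<ge> 3"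
    and sym: "\<And>i j. metric_mat A g c p $ i $ j = metric_mat A g c p $ j $ i"
  shows "(\<Sum>a\<in>UNIV. \<Sum>b\<in>UNIV. metric_inv A g c p $ a $ b * schouten A g c p a b) = schouten_J A g c p"
proof -
  let ?n = "real CARD('n)" and ?h = "metric_inv A g c p" and ?g = "metric_mat A g c p"
  let ?J = "schouten_J A g c p"
  have n: "(\<Sum>a\<in>UNIV. \<Sum>b\<in>UNIV. ?h $ a $ b * ?g $ a $ b) = ?n"
  proof -
    have "(\<Sum>a\<in>UNIV. \<Sum>b\<in>UNIV. ?h $ a $ b * ?g $ a $ b) = (\<Sum>b\<in>UNIV. \<Sum>a\<in>UNIV. ?g $ b $ a * ?h $ a $ b)"
      by (subst sum.swap) (intro sum.cong refl, metis mult.commute sym)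
    then show ?thesis by (simp add: metric_inv_left[OF assms(1)])
  qed
  have "(\<Sum>a\<in>UNIV. \<Sum>b\<in>UNIV. ?h $ a $ b * schouten A g c p a b) =
      (\<Sum>a\<in>UNIV. \<Sum>b\<in>UNIV. ?h $ a $ b * ricci A g c p a b - ?J * (?h $ a $ b * ?g $ a $ b)) / (?n - 2)"
    by (simp add: schouten_def sum_divide_distrib algebra_simps)
  also have "\<dots> = (scal A g c p - ?J * ?n) / (?n - 2)"
    by (simp only: sum_subtractf sum_distrib_left[symmetric] n scal_def)
  also have "\<dots> = ?J"
  proof -
    have "scal A g c p = ?J * (2 * (?n - 1))"
      using assms(2) by (simp add: schouten_J_def)
    moreover have "?J * (2 * (?n - 1)) - ?J * ?n = ?J * (?n - 2)"
      by (simp add: algebra_simps)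
    ultimately show ?thesis using assms(2) by simp
  qed
  finally show ?thesis .
qed

end

theory Submission
  imports Defs
begin

text \<open>
  Everything is computed in one chart. Let $\Upsilon = d\omega$, let $\iota$ be the contraction with
  the gradient of $\omega$ and let $u$ be the closed form of degree $k = n/2 - 1$. The conformal
  change of $\delta$ on $k$-forms has the factor $n - 2k = 2$:
  $\hat\delta u = e^{-2\omega}(\delta u - 2 \iota u)$, whence
  $e^{2\omega} d \hat\delta u = d \delta u - 2 d \iota u - 2 \Upsilon \wedge \delta u +
  4 \Upsilon \wedge \iota u$. As $du = 0$, Cartan's formula turns $d \iota u$ into the Lie
  derivative $\nabla_\Upsilon u + (\nabla\Upsilon)\sharp u$. The conformal change of the Schouten
  tensor and of its trace cancels $4 \Upsilon \wedge \iota u$ and the terms in $|\Upsilon|^2$, and what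
  remains is $2 \delta (\Upsilon \wedge u) = 2 \delta d (\omega u)$. The curvature of $D$ never
  enters. On forms of degree $n/2$ the factor of the conformal change of $\delta$ vanishes, so the
  result holds in every scale.
\<close>

section \<open>Smooth functions on open sets\<close>

text \<open>The constants of Q are what the cancellation dictates. The Hessian endomorphism occurs
  with coefficient -2 from the Lie derivative and +4 from the Schouten term; the sum +2 is its
  coefficient in twice the coderivative of d\<omega> wedge u. The trace part of the Schouten change
  acts on k slots and contributes +2k times the squared length of d\<omega>, while 2J contributes
  -2(n/2 - 1) times it; these cancel because k = n/2 - 1. Two encodings shape the calculation.
  Components refer to coordinate frames, so the exterior derivative and the Lie derivative contain
  no Christoffel symbols while the coderivative does; both sides are compared after splitting the
  covariant derivative of the gradient into a coordinate part and a \<Gamma> part. Moreover, a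
  connection acts on functions on the whole manifold type, and its locality is not an axiom. It has
  to be derived before a component identity, valid only on the chart domain, can be
  differentiated.\<close>

lemma has_derivative_frechet:
  assumes "(f has_derivative f') (at x)"
  shows "frechet_derivative f (at x) = f'"
  using frechet_derivative_at[OF assms] by simp

lemma frechet_derivative_cong_open:
  assumes "open S" "x \<in> S" "\<And>y. y \<in> S \<Longrightarrow> f y = g y"
  shows "frechet_derivative f (at x) = frechet_derivative g (at x)"
proof -
  have "(f has_derivative h) (at x) \<longleftrightarrow> (g has_derivative h) (at x)" for h
    using has_derivative_transform_within_open[of f h x UNIV S g]
      has_derivative_transform_within_open[of g h x UNIV S f] assms by auto
  then show ?thesis by (simp add: frechet_derivative_def)
qed

lemma differentiable_cong_open:
  assumes "open S" "x \<in> S" "\<And>y. y \<in> S \<Longrightarrow> f y = g y" "f differentiable (at x)"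
  shows "g differentiable (at x)"
  using assms has_derivative_transform_within_open[of f _ x UNIV S g]
  unfolding differentiable_def by blast

text \<open>Derivatives in \<open>Ck_on\<close> are taken in the whole space, so agreement on
  \<open>S\<close> passes to them because \<open>S\<close> is open.\<close>

lemma Ck_on_cong:
  assumes "open S" "\<And>x. x \<in> S \<Longrightarrow> f x = g x" "Ck_on k S f"
  shows "Ck_on k S g"
  using assms(2,3)
proof (induction k arbitrary: f g)
  case 0
  then show ?case using continuous_on_cong[of S S f g] by simp
next
  case (Suc k)
  have "Ck_on k S (\<lambda>x. frechet_derivative g (at x) v)" for v
  proof (rule Suc.IH)
    show "Ck_on k S (\<lambda>x. frechet_derivative f (at x) v)" using Suc.prems by simp
    show "frechet_derivative f (at x) v = frechet_derivative g (at x) v" if "x \<in> S" for x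
      using frechet_derivative_cong_open[OF assms(1) that, of f g] Suc.prems(1) by simp
  qed
  moreover have "g differentiable (at x)" if "x \<in> S" for x
    using differentiable_cong_open[OF assms(1) that, of f g] Suc.prems that by simp
  ultimately show ?case by simp
qed

lemma Ck_on_subset: "Ck_on k S f \<Longrightarrow> T \<subseteq> S \<Longrightarrow> Ck_on k T f"
  by (induction k arbitrary: f) (auto intro: continuous_on_subset)

lemma Ck_on_Suc_D: "Ck_on (Suc k) S f \<Longrightarrow> Ck_on k S f"
proof (induction k arbitrary: f)
  case 0
  then have "\<forall>x\<in>S. isCont f x" using differentiable_imp_continuous_within by auto
  then show ?case by (simp add: continuous_at_imp_continuous_on)
next
  case (Suc k)
  have "Ck_on k S (\<lambda>x. frechet_derivative f (at x) v)" for v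
    using Suc.prems by (intro Suc.IH) simp
  then show ?case using Suc.prems by simp
qed

lemma Ck_on_const: "Ck_on k S (\<lambda>x. c)"
  by (induction k arbitrary: c) simp_all

text \<open>Lets any formula for the derivative replace the canonical
  \<open>frechet_derivative\<close>. Most closure rules below combine this lemma with a
  differentiation rule.\<close>

lemma Ck_on_SucI:
  assumes "open S" "\<And>x. x \<in> S \<Longrightarrow> (f has_derivative f' x) (at x)" "\<And>v. Ck_on k S (\<lambda>x. f' x v)"
  shows "Ck_on (Suc k) S f"
proof -
  have "Ck_on k S (\<lambda>x. frechet_derivative f (at x) v)" for v
    using assms(1) _ assms(3)[of v]
    by (rule Ck_on_cong) (simp add: has_derivative_frechet[OF assms(2)])
  then show ?thesis using assms(2) by (auto simp: differentiable_def)
qed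

lemma Ck_on_Suc_has_derivative:
  assumes "Ck_on (Suc k) S f" "x \<in> S"
  shows "(f has_derivative frechet_derivative f (at x)) (at x)"
  using assms frechet_derivative_works by auto

lemma Ck_on_bounded_linear:
  assumes "open S" "bounded_linear L" shows "Ck_on k S L"
proof (cases k)
  case 0
  then show ?thesis using assms linear_continuous_on by auto
next
  case (Suc j)
  show ?thesis
    unfolding Suc by (rule Ck_on_SucI[OF assms(1) bounded_linear_imp_has_derivative[OF assms(2)] Ck_on_const])
qed

section \<open>Closure of the C^k classes under algebra, exponential and composition\<close>

lemma Ck_on_add:
  assumes "open S" shows "Ck_on k S f \<Longrightarrow> Ck_on k S g \<Longrightarrow> Ck_on k S (\<lambda>x. f x + g x)"
proof (induction k arbitrary: f g)
  case 0
  then show ?case by (simp add: continuous_on_add)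
next
  case (Suc k)
  show ?case
  proof (rule Ck_on_SucI[OF assms,
      where f' = "\<lambda>x v. frechet_derivative f (at x) v + frechet_derivative g (at x) v"])
    show "((\<lambda>x. f x + g x) has_derivative
        (\<lambda>v. frechet_derivative f (at x) v + frechet_derivative g (at x) v)) (at x)" if "x \<in> S" for x
      using Ck_on_Suc_has_derivative[OF Suc.prems(1) that] Ck_on_Suc_has_derivative[OF Suc.prems(2) that]
      by (rule has_derivative_add)
    show "Ck_on k S (\<lambda>x. frechet_derivative f (at x) v + frechet_derivative g (at x) v)" for v
      using Suc.prems by (intro Suc.IH) auto
  qed
qed

lemma Ck_on_mult:
  fixes f g :: "'a::real_normed_vector \<Rightarrow> real"
  assumes "open S" shows "Ck_on k S f \<Longrightarrow> Ck_on k S g \<Longrightarrow> Ck_on k S (\<lambda>x. f x * g x)"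
proof (induction k arbitrary: f g)
  case 0
  then show ?case by (simp add: continuous_on_mult)
next
  case (Suc k)
  \<comment> \<open>The product rule contains \<open>f\<close> and \<open>g\<close>
    undifferentiated, so they are needed at the lower order too.\<close>
  have lower: "Ck_on k S f" "Ck_on k S g" using Suc.prems Ck_on_Suc_D by blast+
  show ?case
  proof (rule Ck_on_SucI[OF assms,
      where f' = "\<lambda>x v. f x * frechet_derivative g (at x) v + frechet_derivative f (at x) v * g x"])
    show "((\<lambda>x. f x * g x) has_derivative
        (\<lambda>v. f x * frechet_derivative g (at x) v + frechet_derivative f (at x) v * g x)) (at x)"
      if "x \<in> S" for x
      using Ck_on_Suc_has_derivative[OF Suc.prems(1) that] Ck_on_Suc_has_derivative[OF Suc.prems(2) that]
      by (rule has_derivative_mult)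
    show "Ck_on k S (\<lambda>x. f x * frechet_derivative g (at x) v + frechet_derivative f (at x) v * g x)" for v
      using Suc.prems lower by (intro Ck_on_add[OF assms] Suc.IH) auto
  qed
qed

lemma Ck_on_exp:
  fixes f :: "'a::real_normed_vector \<Rightarrow> real"
  assumes "open S" shows "Ck_on k S f \<Longrightarrow> Ck_on k S (\<lambda>x. exp (f x))"
proof (induction k)
  case 0
  then show ?case by (simp add: continuous_on_exp)
next
  case (Suc k)
  show ?case
  proof (rule Ck_on_SucI[OF assms, where f' = "\<lambda>x v. exp (f x) * frechet_derivative f (at x) v"])
    show "((\<lambda>x. exp (f x)) has_derivative (\<lambda>v. exp (f x) * frechet_derivative f (at x) v)) (at x)"
      if "x \<in> S" for x
      by (rule derivative_eq_intros Ck_on_Suc_has_derivative[OF Suc.prems that] refl)+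
        (simp add: mult.commute)
    show "Ck_on k S (\<lambda>x. exp (f x) * frechet_derivative f (at x) v)" for v
      using Suc Ck_on_Suc_D by (intro Ck_on_mult[OF assms]) auto
  qed
qed

lemma Ck_on_inverse:
  fixes f :: "'a::real_normed_vector \<Rightarrow> real"
  assumes "open S" "\<And>x. x \<in> S \<Longrightarrow> f x \<noteq> 0"
  shows "Ck_on k S f \<Longrightarrow> Ck_on k S (\<lambda>x. inverse (f x))"
proof (induction k)
  case 0
  then show ?case using assms by (simp add: continuous_on_inverse)
next
  case (Suc k)
  have IH: "Ck_on k S (\<lambda>x. inverse (f x))" using Suc Ck_on_Suc_D by blast
  show ?case
  proof (rule Ck_on_SucI[OF assms(1),
      where f' = "\<lambda>x v. - 1 * ((inverse (f x) * inverse (f x)) * frechet_derivative f (at x) v)"])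
    show "((\<lambda>x. inverse (f x)) has_derivative
        (\<lambda>v. - 1 * ((inverse (f x) * inverse (f x)) * frechet_derivative f (at x) v))) (at x)"
      if "x \<in> S" for x
      by (rule derivative_eq_intros Ck_on_Suc_has_derivative[OF Suc.prems that] refl assms(2)[OF that])+
        (simp add: algebra_simps)
    show "Ck_on k S (\<lambda>x. - 1 * ((inverse (f x) * inverse (f x)) * frechet_derivative f (at x) v))" for v
      using Suc IH by (intro Ck_on_mult[OF assms(1)] Ck_on_const) auto
  qed
qed

lemma Ck_on_sum:
  assumes "open S" "\<And>i. i \<in> J \<Longrightarrow> Ck_on k S (f i)"
  shows "Ck_on k S (\<lambda>x. \<Sum>i\<in>J. f i x)"
  using assms(2) by (induction J rule: infinite_finite_induct)
    (auto intro: Ck_on_add[OF assms(1)] Ck_on_const)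

lemma frechet_derivative_axis_expand:
  fixes f :: "real ^ 'n::finite \<Rightarrow> real"
  assumes "f differentiable (at x)"
  shows "frechet_derivative f (at x) v = (\<Sum>i\<in>UNIV. frechet_derivative f (at x) (axis i 1) * v $ i)"
proof -
  have lin: "linear (frechet_derivative f (at x))" using linear_frechet_derivative[OF assms] .
  have "v = (\<Sum>i\<in>UNIV. v $ i *\<^sub>R axis i 1)"
    using basis_expansion[of v] by (simp add: scalar_mult_eq_scaleR)
  then have "frechet_derivative f (at x) v = frechet_derivative f (at x) (\<Sum>i\<in>UNIV. v $ i *\<^sub>R axis i 1)"
    by (rule arg_cong)
  also have "\<dots> = (\<Sum>i\<in>UNIV. v $ i *\<^sub>R frechet_derivative f (at x) (axis i 1))"
    by (simp add: linear_sum[OF lin] linear_scale[OF lin])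
  finally show ?thesis by (simp add: mult.commute)
qed

lemma Ck_on_component:
  fixes f :: "'a::real_normed_vector \<Rightarrow> real ^ 'n::finite"
  assumes "open S" shows "Ck_on k S f \<Longrightarrow> Ck_on k S (\<lambda>x. f x $ i)"
proof (induction k arbitrary: f)
  case 0
  then show ?case by (simp add: continuous_on_component)
next
  case (Suc k)
  show ?case
  proof (rule Ck_on_SucI[OF assms, where f' = "\<lambda>x v. frechet_derivative f (at x) v $ i"])
    show "((\<lambda>x. f x $ i) has_derivative (\<lambda>v. frechet_derivative f (at x) v $ i)) (at x)"
      if "x \<in> S" for x
      using Ck_on_Suc_has_derivative[OF Suc.prems that]
      by (rule bounded_linear.has_derivative[OF bounded_linear_vec_nth])
    show "Ck_on k S (\<lambda>x. frechet_derivative f (at x) v $ i)" for v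
      using Suc.prems by (intro Suc.IH) auto
  qed
qed

text \<open>The chain rule is written along the coordinate axes: the derivative becomes a sum of
  products of real functions, to which the induction hypothesis and the earlier closure rules
  apply.\<close>

lemma Ck_on_compose:
  fixes f :: "real ^ 'n::finite \<Rightarrow> real" and \<phi> :: "'a::real_normed_vector \<Rightarrow> real ^ 'n"
  assumes "open S" "open T" "\<phi> ` T \<subseteq> S"
  shows "Ck_on k S f \<Longrightarrow> Ck_on k T \<phi> \<Longrightarrow> Ck_on k T (\<lambda>x. f (\<phi> x))"
proof (induction k arbitrary: f)
  case 0
  then show ?case using assms(3) continuous_on_compose2[of S f T \<phi>] by simp
next
  case (Suc k)
  have low: "Ck_on k T \<phi>" using Suc.prems Ck_on_Suc_D by blast
  show ?case
  proof (rule Ck_on_SucI[OF assms(2), where f' = "\<lambda>x v. \<Sum>i\<in>UNIV.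
        frechet_derivative f (at (\<phi> x)) (axis i 1) * frechet_derivative \<phi> (at x) v $ i"])
    fix x assume x: "x \<in> T"
    then have "\<phi> x \<in> S" using assms(3) by blast
    then have f: "(f has_derivative frechet_derivative f (at (\<phi> x))) (at (\<phi> x))"
      using Ck_on_Suc_has_derivative[OF Suc.prems(1)] by blast
    then have "f differentiable (at (\<phi> x))" by (auto simp: differentiable_def)
    then have ex: "(\<lambda>v. frechet_derivative f (at (\<phi> x)) (frechet_derivative \<phi> (at x) v)) = (\<lambda>v. \<Sum>i\<in>UNIV.
        frechet_derivative f (at (\<phi> x)) (axis i 1) * frechet_derivative \<phi> (at x) v $ i)"
      by (intro ext frechet_derivative_axis_expand)
    show "((\<lambda>x. f (\<phi> x)) has_derivative (\<lambda>v. \<Sum>i\<in>UNIV.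
        frechet_derivative f (at (\<phi> x)) (axis i 1) * frechet_derivative \<phi> (at x) v $ i)) (at x)"
      using has_derivative_compose[OF Ck_on_Suc_has_derivative[OF Suc.prems(2) x] f]
      unfolding ex .
  next
    fix v
    show "Ck_on k T (\<lambda>x. \<Sum>i\<in>UNIV.
        frechet_derivative f (at (\<phi> x)) (axis i 1) * frechet_derivative \<phi> (at x) v $ i)"
      using Suc.prems low
      by (intro Ck_on_sum[OF assms(2)] Ck_on_mult[OF assms(2)] Suc.IH
          Ck_on_component[OF assms(2)]) auto
  qed
qed

section \<open>Symmetry of second derivatives\<close>

lemma mixed_difference:
  fixes f :: "'a::real_normed_vector \<Rightarrow> real"
  assumes C2: "Ck_on (Suc (Suc 0)) (ball x \<delta>) f" and h: "0 < h" "h * (norm v + norm w) < \<delta>"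
  obtains y where "y \<in> ball x \<delta>"
    "f (x + h *\<^sub>R v + h *\<^sub>R w) - f (x + h *\<^sub>R v) - f (x + h *\<^sub>R w) + f x =
      h * h * frechet_derivative (\<lambda>y. frechet_derivative f (at y) v) (at y) w"
proof -
  \<comment> \<open>The parallelogram at \<open>x\<close> with sides \<open>h v\<close> and
    \<open>h w\<close> lies in the ball, which keeps both mean value arguments inside it.\<close>
  have inb: "x + s *\<^sub>R v + t *\<^sub>R w \<in> ball x \<delta>" if "0 \<le> s" "s \<le> h" "0 \<le> t" "t \<le> h" for s t
  proof -
    have "norm (s *\<^sub>R v + t *\<^sub>R w) \<le> s * norm v + t * norm w"
      using norm_triangle_ineq[of "s *\<^sub>R v" "t *\<^sub>R w"] that by simp
    also have "\<dots> \<le> h * norm v + h * norm w"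
      using that by (intro add_mono mult_right_mono) auto
    also have "\<dots> < \<delta>" using h by (simp add: distrib_left)
    finally have "norm (s *\<^sub>R v + t *\<^sub>R w) < \<delta>" .
    moreover have "dist x (x + s *\<^sub>R v + t *\<^sub>R w) = norm (s *\<^sub>R v + t *\<^sub>R w)"
      by (metis add.assoc add_diff_cancel_left' dist_norm norm_minus_commute)
    ultimately show ?thesis by simp
  qed
  have line: "((\<lambda>s. F (z + s *\<^sub>R u)) has_real_derivative frechet_derivative F (at (z + s *\<^sub>R u)) u) (at s)"
    if "Ck_on (Suc k) (ball x \<delta>) F" "z + s *\<^sub>R u \<in> ball x \<delta>" for F k z u s
  proof -
    have F: "(F has_derivative frechet_derivative F (at (z + s *\<^sub>R u))) (at (z + s *\<^sub>R u))"
      using Ck_on_Suc_has_derivative[OF that] .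
    have "((\<lambda>s. z + s *\<^sub>R u) has_derivative (\<lambda>t. t *\<^sub>R u)) (at s)"
      by (auto intro!: derivative_eq_intros)
    from has_derivative_compose[OF this F]
    have "((\<lambda>s. F (z + s *\<^sub>R u)) has_derivative (\<lambda>t. frechet_derivative F (at (z + s *\<^sub>R u)) (t *\<^sub>R u))) (at s)" .
    moreover have "(\<lambda>t. frechet_derivative F (at (z + s *\<^sub>R u)) (t *\<^sub>R u)) =
        (*) (frechet_derivative F (at (z + s *\<^sub>R u)) u)"
      using linear_scale[OF has_derivative_linear[OF F]] by (auto simp: mult.commute)
    ultimately show ?thesis by (simp add: has_field_derivative_def)
  qed
  \<comment> \<open>The second difference is the increment of \<open>?g\<close> over the interval
    from 0 to \<open>h\<close>. The mean value theorem in direction \<open>v\<close> turns it into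
    an increment of a first derivative along \<open>w\<close>; a second application yields the mixed
    derivative at a single point.\<close>
  let ?g = "\<lambda>s. f (x + h *\<^sub>R w + s *\<^sub>R v) - f (x + s *\<^sub>R v)"
  let ?g' = "\<lambda>s. frechet_derivative f (at (x + h *\<^sub>R w + s *\<^sub>R v)) v - frechet_derivative f (at (x + s *\<^sub>R v)) v"
  have "\<exists>s. 0 < s \<and> s < h \<and> ?g h - ?g 0 = (h - 0) * ?g' s"
  proof (rule MVT2)
    fix s assume s: "0 \<le> s" "s \<le> h"
    have "x + h *\<^sub>R w + s *\<^sub>R v \<in> ball x \<delta>" "x + s *\<^sub>R v \<in> ball x \<delta>"
      using inb[of s h] inb[of s 0] s h by (simp_all add: add_ac)
    then show "(?g has_real_derivative ?g' s) (at s)"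
      by (intro DERIV_diff line[OF C2])
  qed (use h in simp)
  then obtain s where s: "0 < s" "s < h" "?g h - ?g 0 = h * ?g' s" by auto
  let ?k = "\<lambda>t. frechet_derivative f (at (x + s *\<^sub>R v + t *\<^sub>R w)) v"
  let ?k' = "\<lambda>t. frechet_derivative (\<lambda>y. frechet_derivative f (at y) v) (at (x + s *\<^sub>R v + t *\<^sub>R w)) w"
  have C1: "Ck_on (Suc 0) (ball x \<delta>) (\<lambda>y. frechet_derivative f (at y) v)" using C2 by simp
  have "\<exists>t. 0 < t \<and> t < h \<and> ?k h - ?k 0 = (h - 0) * ?k' t"
  proof (rule MVT2)
    show "(?k has_real_derivative ?k' t) (at t)" if "0 \<le> t" "t \<le> h" for t
      using inb s that by (intro line[OF C1]) simp
  qed (use h in simp)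
  then obtain t where t: "0 < t" "t < h" "?k h - ?k 0 = h * ?k' t" by auto
  show ?thesis
  proof
    show "x + s *\<^sub>R v + t *\<^sub>R w \<in> ball x \<delta>" using inb s t by simp
    have "?g' s = ?k h - ?k 0" by (simp add: add_ac)
    then have "?g h - ?g 0 = h * h * ?k' t" using s t by simp
    then show "f (x + h *\<^sub>R v + h *\<^sub>R w) - f (x + h *\<^sub>R v) - f (x + h *\<^sub>R w) + f x = h * h * ?k' t"
      by (simp add: add_ac)
  qed
qed

text \<open>The second difference of \<open>f\<close> is symmetric in \<open>v\<close> and
  \<open>w\<close>, so \<open>mixed_difference\<close> yields points near \<open>x\<close> at which
  the two mixed derivatives take the same value; continuity then excludes a gap at
  \<open>x\<close>.\<close>

lemma frechet_derivative_commute: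
  fixes f :: "'a::real_normed_vector \<Rightarrow> real"
  assumes "open S" "x \<in> S" "Ck_on (Suc (Suc 0)) S f"
  shows "frechet_derivative (\<lambda>y. frechet_derivative f (at y) v) (at x) w =
    frechet_derivative (\<lambda>y. frechet_derivative f (at y) w) (at x) v"
proof (rule ccontr)
  let ?a = "\<lambda>v w y. frechet_derivative (\<lambda>y. frechet_derivative f (at y) v) (at y) w"
  \<comment> \<open>Half the supposed gap: a single number cannot lie within \<open>e\<close> of
    both mixed derivatives at \<open>x\<close>.\<close>
  define e where "e = \<bar>?a v w x - ?a w v x\<bar> / 2"
  assume "?a v w x \<noteq> ?a w v x"
  then have e: "e > 0" by (simp add: e_def)
  obtain d0 where d0: "d0 > 0" "ball x d0 \<subseteq> S" using assms openE by blast
  have "continuous_on S (?a v w)" for v w using assms(3) by simp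
  then have cont: "isCont (?a v w) x" for v w using assms continuous_on_eq_continuous_at by blast
  obtain d1 where d1: "d1 > 0" "\<And>y. dist y x < d1 \<Longrightarrow> dist (?a v w y) (?a v w x) < e"
    using cont[of v w] e unfolding continuous_at_eps_delta by blast
  obtain d2 where d2: "d2 > 0" "\<And>y. dist y x < d2 \<Longrightarrow> dist (?a w v y) (?a w v x) < e"
    using cont[of w v] e unfolding continuous_at_eps_delta by blast
  define \<delta> where "\<delta> = min d0 (min d1 d2)"
  have \<delta>: "\<delta> > 0" using d0 d1 d2 by (simp add: \<delta>_def)
  \<comment> \<open>The summand 1 keeps the denominator positive when \<open>v\<close> and
    \<open>w\<close> vanish and makes the bound on \<open>h\<close> strict.\<close>
  define h where "h = \<delta> / (norm v + norm w + 1)"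
  have pos: "norm v + norm w + 1 > 0" by (simp add: add_nonneg_pos)
  have h: "h > 0" using \<delta> pos by (simp add: h_def)
  have "h * (norm v + norm w) < h * (norm v + norm w + 1)" using h by simp
  also have "\<dots> = \<delta>" using pos by (simp add: h_def)
  finally have h2: "h * (norm v + norm w) < \<delta>" "h * (norm w + norm v) < \<delta>" by (simp_all add: add.commute)
  have C2: "Ck_on (Suc (Suc 0)) (ball x \<delta>) f"
    using assms(3) d0 by (rule_tac Ck_on_subset) (auto simp: \<delta>_def)
  obtain y where y: "y \<in> ball x \<delta>"
    "f (x + h *\<^sub>R v + h *\<^sub>R w) - f (x + h *\<^sub>R v) - f (x + h *\<^sub>R w) + f x = h * h * ?a v w y"
    using mixed_difference[OF C2 h h2(1)] .
  obtain z where z: "z \<in> ball x \<delta>"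
    "f (x + h *\<^sub>R w + h *\<^sub>R v) - f (x + h *\<^sub>R w) - f (x + h *\<^sub>R v) + f x = h * h * ?a w v z"
    using mixed_difference[OF C2 h h2(2)] .
  have "x + h *\<^sub>R w + h *\<^sub>R v = x + h *\<^sub>R v + h *\<^sub>R w" by simp
  then have "h * h * ?a v w y = h * h * ?a w v z"
    by (simp only: y(2)[symmetric] z(2)[symmetric])
  then have "?a v w y = ?a w v z" using h by simp
  moreover have "dist (?a v w y) (?a v w x) < e" "dist (?a w v z) (?a w v x) < e"
    using y(1) z(1) by (auto intro!: d1(2) d2(2) simp: \<delta>_def dist_commute[of x])
  ultimately show False unfolding e_def by (auto simp: dist_real_def abs_if split: if_splits)
qed

section \<open>Calculus in a chart\<close>

lemma chart_inv_snd: "is_chart c \<Longrightarrow> p \<in> fst c \<Longrightarrow> chart_inv c (snd c p) = p"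
  by (auto simp: is_chart_def homeomorphism_def)

lemma open_chart_image:
  assumes "is_chart c" "open W" shows "open (snd c ` (W \<inter> fst c))"
proof -
  have "open ((chart_inv c -` W) \<inter> snd c ` fst c)"
    using assms continuous_on_open_vimage[of "snd c ` fst c" "chart_inv c"]
    by (simp add: is_chart_def homeomorphism_def)
  moreover have "(chart_inv c -` W) \<inter> snd c ` fst c = snd c ` (W \<inter> fst c)"
    using chart_inv_snd[OF assms(1)] by force
  ultimately show ?thesis by simp
qed

lemma smooth_fun_subset: "smooth_fun A W f \<Longrightarrow> W' \<subseteq> W \<Longrightarrow> smooth_fun A W' f"
  unfolding smooth_fun_def smooth_on_def
  by (meson Ck_on_subset Int_mono image_mono order_refl)

section \<open>Smooth functions on a manifold\<close>

locale manifold =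
  fixes A :: "('m::{t2_space, second_countable_topology}, 'n::finite) chart set"
  assumes smooth_manifold: "smooth_manifold A"
begin

lemma is_chart: "c \<in> A \<Longrightarrow> is_chart c"
  using smooth_manifold by (auto simp: smooth_manifold_def)

lemma open_chart: "c \<in> A \<Longrightarrow> open (fst c)"
  using is_chart by (auto simp: is_chart_def)

lemma smooth_funI:
  assumes "\<And>c k. c \<in> A \<Longrightarrow> Ck_on k (snd c ` (W \<inter> fst c)) (f \<circ> chart_inv c)"
  shows "smooth_fun A W f"
  using assms by (auto simp: smooth_fun_def smooth_on_def)

lemma smooth_funD:
  "smooth_fun A W f \<Longrightarrow> c \<in> A \<Longrightarrow> Ck_on k (snd c ` (W \<inter> fst c)) (f \<circ> chart_inv c)"
  by (auto simp: smooth_fun_def smooth_on_def)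

lemma smooth_fun_const: "smooth_fun A W (\<lambda>_. a)"
  by (rule smooth_funI) (simp add: o_def Ck_on_const)

lemma smooth_fun_cong:
  assumes "open W" "\<And>q. q \<in> W \<Longrightarrow> f q = g q" "smooth_fun A W f"
  shows "smooth_fun A W g"
proof (rule smooth_funI)
  fix c k assume c: "c \<in> A"
  show "Ck_on k (snd c ` (W \<inter> fst c)) (g \<circ> chart_inv c)"
    by (rule Ck_on_cong[OF open_chart_image[OF is_chart[OF c] assms(1)] _ smooth_funD[OF assms(3) c]])
      (auto simp: assms(2) chart_inv_snd[OF is_chart[OF c]])
qed

lemma smooth_fun_add:
  assumes "open W" "smooth_fun A W f" "smooth_fun A W g"
  shows "smooth_fun A W (\<lambda>q. f q + g q)"
proof (rule smooth_funI)
  fix c k assume c: "c \<in> A"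
  show "Ck_on k (snd c ` (W \<inter> fst c)) ((\<lambda>q. f q + g q) \<circ> chart_inv c)"
    using Ck_on_add[OF open_chart_image[OF is_chart[OF c] assms(1)]
        smooth_funD[OF assms(2) c] smooth_funD[OF assms(3) c], of k]
    by (simp add: o_def)
qed

lemma smooth_fun_mult:
  assumes "open W" "smooth_fun A W f" "smooth_fun A W g"
  shows "smooth_fun A W (\<lambda>q. f q * g q)"
proof (rule smooth_funI)
  fix c k assume c: "c \<in> A"
  show "Ck_on k (snd c ` (W \<inter> fst c)) ((\<lambda>q. f q * g q) \<circ> chart_inv c)"
    using Ck_on_mult[OF open_chart_image[OF is_chart[OF c] assms(1)]
        smooth_funD[OF assms(2) c, unfolded o_def] smooth_funD[OF assms(3) c, unfolded o_def], of k]
    by (simp add: o_def)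
qed

lemma smooth_fun_exp:
  assumes "open W" "smooth_fun A W f"
  shows "smooth_fun A W (\<lambda>q. exp (f q))"
proof (rule smooth_funI)
  fix c k assume c: "c \<in> A"
  show "Ck_on k (snd c ` (W \<inter> fst c)) ((\<lambda>q. exp (f q)) \<circ> chart_inv c)"
    using Ck_on_exp[OF open_chart_image[OF is_chart[OF c] assms(1)]
        smooth_funD[OF assms(2) c, unfolded o_def], of k]
    by (simp add: o_def)
qed

lemma smooth_fun_inverse:
  assumes "open W" "smooth_fun A W f" "\<And>q. q \<in> W \<Longrightarrow> f q \<noteq> 0"
  shows "smooth_fun A W (\<lambda>q. inverse (f q))"
proof (rule smooth_funI)
  fix c k assume c: "c \<in> A"
  have "f (chart_inv c x) \<noteq> 0" if "x \<in> snd c ` (W \<inter> fst c)" for x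
    using that assms(3) chart_inv_snd[OF is_chart[OF c]] by auto
  from Ck_on_inverse[OF open_chart_image[OF is_chart[OF c] assms(1)] this
      smooth_funD[OF assms(2) c, unfolded o_def], of k]
  show "Ck_on k (snd c ` (W \<inter> fst c)) ((\<lambda>q. inverse (f q)) \<circ> chart_inv c)"
    by (simp add: o_def)
qed

lemma smooth_fun_cmult: "open W \<Longrightarrow> smooth_fun A W f \<Longrightarrow> smooth_fun A W (\<lambda>q. a * f q)"
  by (intro smooth_fun_mult smooth_fun_const)

lemma smooth_fun_diff:
  assumes "open W" "smooth_fun A W f" "smooth_fun A W g"
  shows "smooth_fun A W (\<lambda>q. f q - g q)"
  using smooth_fun_add[OF assms(1,2) smooth_fun_cmult[OF assms(1,3), of "-1"]] by simp

lemma smooth_fun_divide_const: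
  "open W \<Longrightarrow> smooth_fun A W f \<Longrightarrow> smooth_fun A W (\<lambda>q. f q / a)"
  using smooth_fun_cmult[of W f "1 / a"] by simp

lemma smooth_fun_sum:
  assumes "open W" "\<And>i. i \<in> J \<Longrightarrow> smooth_fun A W (f i)"
  shows "smooth_fun A W (\<lambda>q. \<Sum>i\<in>J. f i q)"
  using assms(2) by (induction J rule: infinite_finite_induct)
    (auto intro: smooth_fun_add[OF assms(1)] smooth_fun_const)

lemma smooth_fun_prod:
  assumes "open W" "\<And>i. i \<in> J \<Longrightarrow> smooth_fun A W (f i)"
  shows "smooth_fun A W (\<lambda>q. \<Prod>i\<in>J. f i q)"
  using assms(2) by (induction J rule: infinite_finite_induct)
    (auto intro: smooth_fun_mult[OF assms(1)] smooth_fun_const)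

lemma smooth_fun_det:
  fixes M :: "'m \<Rightarrow> real ^ 'k::finite ^ 'k"
  assumes "open W" "\<And>i j. smooth_fun A W (\<lambda>q. M q $ i $ j)"
  shows "smooth_fun A W (\<lambda>q. det (M q))"
  unfolding det_def using assms by (intro smooth_fun_sum smooth_fun_cmult smooth_fun_prod) auto

text \<open>By Cramer's rule an entry of the inverse is a quotient of determinants; in
  \<open>?B\<close> column \<open>i\<close> is replaced by the \<open>j\<close>-th unit
  vector.\<close>

lemma smooth_fun_matrix_inv:
  fixes M :: "'m \<Rightarrow> real ^ 'k::finite ^ 'k"
  assumes "open W" "\<And>i j. smooth_fun A W (\<lambda>q. M q $ i $ j)" "\<And>q. q \<in> W \<Longrightarrow> invertible (M q)"
  shows "smooth_fun A W (\<lambda>q. matrix_inv (M q) $ i $ j)"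
proof -
  let ?B = "\<lambda>q. (\<chi> a b. if b = i then axis j 1 $ a else M q $ a $ b)"
  have "matrix_inv (M q) $ i $ j = det (?B q) * inverse (det (M q))" if q: "q \<in> W" for q
  proof -
    have d: "det (M q) \<noteq> 0" using assms(3)[OF q] invertible_det_nz by blast
    have "M q ** matrix_inv (M q) = mat 1"
      using someI_ex[OF assms(3)[OF q, unfolded invertible_def]] unfolding matrix_inv_def by blast
    then have "M q *v (matrix_inv (M q) *v axis j 1) = axis j 1"
      by (simp add: matrix_vector_mul_assoc)
    then have "matrix_inv (M q) *v axis j 1 =
        (\<chi> k. det (\<chi> a b. if b = k then axis j 1 $ a else M q $ a $ b) / det (M q))"
      using cramer[OF d] by blast
    moreover have "(matrix_inv (M q) *v axis j 1) $ i = matrix_inv (M q) $ i $ j"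
      by (simp add: matrix_vector_mult_basis column_def)
    ultimately show ?thesis by (simp add: divide_inverse)
  qed
  moreover have "smooth_fun A W (\<lambda>q. det (?B q) * inverse (det (M q)))"
  proof (intro smooth_fun_mult smooth_fun_inverse smooth_fun_det assms)
    fix a b show "smooth_fun A W (\<lambda>q. ?B q $ a $ b)"
      using assms(2) smooth_fun_const by (cases "b = i") auto
  qed (use assms(3) invertible_det_nz in auto)
  ultimately show ?thesis using smooth_fun_cong[OF assms(1)] by force
qed

text \<open>\<open>smooth_fun\<close> quantifies over all charts. Composing with the smooth
  transition maps reduces the check to one chart containing \<open>W\<close>.\<close>

lemma smooth_fun_from_chart:
  assumes c: "c \<in> A" and W: "open W" "W \<subseteq> fst c"
    and sm: "\<And>k. Ck_on k (snd c ` W) (f \<circ> chart_inv c)"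
  shows "smooth_fun A W f"
proof (rule smooth_funI)
  fix c' k assume c': "c' \<in> A"
  let ?T = "snd c' ` (W \<inter> fst c')" and ?\<phi> = "snd c \<circ> chart_inv c'"
  have oT: "open ?T" using open_chart_image[OF is_chart[OF c'] W(1)] .
  have oS: "open (snd c ` W)" using open_chart_image[OF is_chart[OF c] W(1)] W(2)
    by (simp add: Int_absorb2)
  have "smooth_on (snd c' ` (fst c' \<inter> fst c)) ?\<phi>"
    using smooth_manifold c c' by (auto simp: smooth_manifold_def)
  then have "Ck_on k (snd c' ` (fst c' \<inter> fst c)) ?\<phi>" by (simp add: smooth_on_def)
  then have \<phi>: "Ck_on k ?T ?\<phi>" by (rule Ck_on_subset) (use W(2) in blast)
  have inT: "chart_inv c' x \<in> W" "chart_inv c (snd c (chart_inv c' x)) = chart_inv c' x"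
    if "x \<in> ?T" for x
    using that W(2) chart_inv_snd[OF is_chart[OF c']] chart_inv_snd[OF is_chart[OF c]] by auto
  have "Ck_on k ?T (\<lambda>x. (f \<circ> chart_inv c) (?\<phi> x))"
    by (rule Ck_on_compose[OF oS oT _ sm \<phi>]) (use inT in auto)
  then show "Ck_on k ?T (f \<circ> chart_inv c')"
    by (rule Ck_on_cong[OF oT, rotated]) (simp add: inT(2))
qed

section \<open>Coordinate vectors as derivations\<close>

lemma coord_vec_eq:
  assumes "open W" "p \<in> W" "smooth_fun A W f"
  shows "coord_vec A c i p f = frechet_derivative (f \<circ> chart_inv c) (at (snd c p)) (axis i 1)"
  using assms by (auto simp: coord_vec_def smooth_near_def)

lemma has_derivative_chart:
  assumes "open W" "p \<in> W" "smooth_fun A W f" "c \<in> A" "p \<in> fst c"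
  shows "(f \<circ> chart_inv c has_derivative frechet_derivative (f \<circ> chart_inv c) (at (snd c p))) (at (snd c p))"
  using Ck_on_Suc_has_derivative[OF smooth_funD[OF assms(3,4)], of "snd c p"] assms by auto

lemma coord_vec_cong:
  assumes "open W" "p \<in> W" "c \<in> A" "p \<in> fst c" "\<And>q. q \<in> W \<Longrightarrow> f q = g q" "smooth_fun A W f"
  shows "coord_vec A c i p f = coord_vec A c i p g"
proof -
  \<comment> \<open>Smoothness has to be transferred first: on a function that is not smooth near
    \<open>p\<close>, \<open>coord_vec\<close> has the default value 0.\<close>
  have g: "smooth_fun A W g" using smooth_fun_cong assms by blast
  show ?thesis
    unfolding coord_vec_eq[OF assms(1,2,6)] coord_vec_eq[OF assms(1,2) g]
    using assms
    by (intro fun_cong[OF frechet_derivative_cong_open[OF open_chart_image[OF is_chart[OF assms(3)] assms(1)]]])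
      (auto simp: chart_inv_snd[OF is_chart])
qed

lemma coord_vec_const [simp]: "coord_vec A c i p (\<lambda>_. a) = 0"
  using coord_vec_eq[OF open_UNIV UNIV_I smooth_fun_const] by (simp add: o_def)

context
  fixes W :: "'m set" and c :: "('m, 'n) chart" and p :: 'm and i :: 'n
  assumes W: "open W" "p \<in> W" and c: "c \<in> A" "p \<in> fst c"
begin

lemma coord_vec_eqI:
  assumes "smooth_fun A W f" "(f \<circ> chart_inv c has_derivative f') (at (snd c p))"
  shows "coord_vec A c i p f = f' (axis i 1)"
  using coord_vec_eq[OF W assms(1)] has_derivative_frechet[OF assms(2)] by simp

lemma has_derivative_chart':
  assumes "smooth_fun A W f"
  obtains f' where "((\<lambda>x. f (chart_inv c x)) has_derivative f') (at (snd c p))"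
    "coord_vec A c i p f = f' (axis i 1)"
  using has_derivative_chart[OF W assms c] coord_vec_eqI[OF assms] by (auto simp: o_def)

lemma coord_vec_add:
  assumes "smooth_fun A W f" "smooth_fun A W g"
  shows "coord_vec A c i p (\<lambda>q. f q + g q) = coord_vec A c i p f + coord_vec A c i p g"
proof -
  obtain f' g' where *:
    "((\<lambda>x. f (chart_inv c x)) has_derivative f') (at (snd c p))" "coord_vec A c i p f = f' (axis i 1)"
    "((\<lambda>x. g (chart_inv c x)) has_derivative g') (at (snd c p))" "coord_vec A c i p g = g' (axis i 1)"
    using has_derivative_chart' assms by metis
  show ?thesis
    using coord_vec_eqI[OF smooth_fun_add[OF W(1) assms], unfolded o_def,
        OF has_derivative_add[OF *(1) *(3)]] * by simp
qed

lemma coord_vec_mult: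
  assumes "smooth_fun A W f" "smooth_fun A W g"
  shows "coord_vec A c i p (\<lambda>q. f q * g q) = coord_vec A c i p f * g p + f p * coord_vec A c i p g"
proof -
  obtain f' g' where *:
    "((\<lambda>x. f (chart_inv c x)) has_derivative f') (at (snd c p))" "coord_vec A c i p f = f' (axis i 1)"
    "((\<lambda>x. g (chart_inv c x)) has_derivative g') (at (snd c p))" "coord_vec A c i p g = g' (axis i 1)"
    using has_derivative_chart' assms by metis
  show ?thesis
    using coord_vec_eqI[OF smooth_fun_mult[OF W(1) assms], unfolded o_def,
        OF has_derivative_mult[OF *(1) *(3)]] * chart_inv_snd[OF is_chart[OF c(1)] c(2)] by simp
qed

lemma coord_vec_exp:
  assumes "smooth_fun A W f"
  shows "coord_vec A c i p (\<lambda>q. exp (f q)) = exp (f p) * coord_vec A c i p f"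
proof -
  obtain f' where *:
    "((\<lambda>x. f (chart_inv c x)) has_derivative f') (at (snd c p))" "coord_vec A c i p f = f' (axis i 1)"
    using has_derivative_chart' assms by metis
  have "((\<lambda>x. exp (f (chart_inv c x))) has_derivative (\<lambda>v. f' v * exp (f (chart_inv c (snd c p))))) (at (snd c p))"
    using has_derivative_exp[OF *(1)] by simp
  from coord_vec_eqI[OF smooth_fun_exp[OF W(1) assms], unfolded o_def, OF this]
  show ?thesis using * chart_inv_snd[OF is_chart[OF c(1)] c(2)] by simp
qed

lemma coord_vec_cmult:
  assumes "smooth_fun A W f"
  shows "coord_vec A c i p (\<lambda>q. a * f q) = a * coord_vec A c i p f"
  using coord_vec_mult[OF smooth_fun_const assms] by simp

lemma coord_vec_diff:
  assumes "smooth_fun A W f" "smooth_fun A W g"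
  shows "coord_vec A c i p (\<lambda>q. f q - g q) = coord_vec A c i p f - coord_vec A c i p g"
  using coord_vec_add[OF assms(1) smooth_fun_cmult[OF W(1) assms(2), of "-1"]]
    coord_vec_cmult[OF assms(2), of "-1"] by simp

lemma coord_vec_sum:
  assumes "\<And>j. j \<in> J \<Longrightarrow> smooth_fun A W (f j)"
  shows "coord_vec A c i p (\<lambda>q. \<Sum>j\<in>J. f j q) = (\<Sum>j\<in>J. coord_vec A c i p (f j))"
  using assms
proof (induction J rule: infinite_finite_induct)
  case (insert x J)
  then show ?case
    using coord_vec_add[of "f x" "\<lambda>q. \<Sum>j\<in>J. f j q"] smooth_fun_sum[OF W(1), of J f] by simp
qed auto

end

lemma coord_vec_chart_eq:
  assumes "open W" "W \<subseteq> fst c" "c \<in> A" "smooth_fun A W f" "x \<in> snd c ` W"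
  shows "coord_vec A c i (chart_inv c x) f = frechet_derivative (f \<circ> chart_inv c) (at x) (axis i 1)"
proof -
  obtain q where q: "q \<in> W" "x = snd c q" using assms by auto
  have q': "chart_inv c (snd c q) = q" using chart_inv_snd[OF is_chart[OF assms(3)]] q assms(2) by auto
  show ?thesis using coord_vec_eq[OF assms(1) q(1) assms(4), of c i] q' q by simp
qed

lemma smooth_fun_coord_vec:
  assumes "open W" "W \<subseteq> fst c" "c \<in> A" "smooth_fun A W f"
  shows "smooth_fun A W (\<lambda>q. coord_vec A c i q f)"
proof (rule smooth_fun_from_chart[OF assms(3,1,2)])
  fix k
  have o: "open (snd c ` W)" using open_chart_image[OF is_chart[OF assms(3)] assms(1)] assms(2)
    by (simp add: Int_absorb2)
  have "Ck_on (Suc k) (snd c ` W) (f \<circ> chart_inv c)"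
    using smooth_funD[OF assms(4,3), of "Suc k"] assms(2) by (simp add: Int_absorb2)
  then have "Ck_on k (snd c ` W) (\<lambda>x. frechet_derivative (f \<circ> chart_inv c) (at x) (axis i 1))"
    by simp
  then show "Ck_on k (snd c ` W) ((\<lambda>q. coord_vec A c i q f) \<circ> chart_inv c)"
    by (rule Ck_on_cong[OF o, rotated]) (use coord_vec_chart_eq[OF assms] in auto)
qed

lemma coord_vec_commute:
  assumes "open W" "W \<subseteq> fst c" "c \<in> A" "smooth_fun A W f" "p \<in> W"
  shows "coord_vec A c i p (\<lambda>q. coord_vec A c j q f) = coord_vec A c j p (\<lambda>q. coord_vec A c i q f)"
proof -
  let ?f = "f \<circ> chart_inv c"
  have o: "open (snd c ` W)" using open_chart_image[OF is_chart[OF assms(3)] assms(1)] assms(2)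
    by (simp add: Int_absorb2)
  have px: "snd c p \<in> snd c ` W" using assms(5) by simp
  have *: "coord_vec A c i p (\<lambda>q. coord_vec A c j q f) =
      frechet_derivative (\<lambda>x. frechet_derivative ?f (at x) (axis j 1)) (at (snd c p)) (axis i 1)" for i j
    unfolding coord_vec_eq[OF assms(1,5) smooth_fun_coord_vec[OF assms(1-4)]]
    by (intro fun_cong[OF frechet_derivative_cong_open[OF o px]]) (use coord_vec_chart_eq[OF assms(1-4)] in auto)
  have "Ck_on (Suc (Suc 0)) (snd c ` W) ?f"
    using smooth_funD[OF assms(4,3)] assms(2) by (simp only: Int_absorb2)
  from frechet_derivative_commute[OF o px this] show ?thesis unfolding * by simp
qed

section \<open>Coordinate functions, change of charts and tangent spaces\<close>

lemma smooth_fun_coordinate: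
  assumes "c \<in> A" shows "smooth_fun A (fst c) (\<lambda>q. snd c q $ j)"
proof (rule smooth_fun_from_chart[OF assms open_chart[OF assms] order_refl])
  fix k
  have o: "open (snd c ` fst c)" using is_chart[OF assms] by (simp add: is_chart_def)
  have "Ck_on k (snd c ` fst c) (\<lambda>x :: real ^ 'n. x $ j)"
    using Ck_on_bounded_linear[OF o bounded_linear_vec_nth] .
  then show "Ck_on k (snd c ` fst c) ((\<lambda>q. snd c q $ j) \<circ> chart_inv c)"
    by (rule Ck_on_cong[OF o, rotated]) (auto simp: chart_inv_snd[OF is_chart[OF assms]])
qed

text \<open>Duality of coordinate functions and coordinate vectors; it is how
  \<open>G_invertible\<close> reads off the coefficients of a tangent vector that vanishes.\<close>

lemma coord_vec_coordinate:
  assumes "c \<in> A" "p \<in> fst c"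
  shows "coord_vec A c i p (\<lambda>q. snd c q $ j) = (if i = j then 1 else 0)"
proof -
  have o: "open (snd c ` fst c)" using is_chart[OF assms(1)] by (simp add: is_chart_def)
  have "coord_vec A c i p (\<lambda>q. snd c q $ j) =
      frechet_derivative ((\<lambda>q. snd c q $ j) \<circ> chart_inv c) (at (snd c p)) (axis i 1)"
    using coord_vec_eq[OF open_chart[OF assms(1)] assms(2) smooth_fun_coordinate[OF assms(1)]] .
  also have "frechet_derivative ((\<lambda>q. snd c q $ j) \<circ> chart_inv c) (at (snd c p)) =
      frechet_derivative (\<lambda>x. x $ j) (at (snd c p))"
    using assms by (intro frechet_derivative_cong_open[OF o]) (auto simp: chart_inv_snd[OF is_chart])
  also have "\<dots> = (\<lambda>x. x $ j)"
    by (intro has_derivative_frechet bounded_linear_imp_has_derivative bounded_linear_vec_nth)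
  finally show ?thesis by (simp add: axis_def)
qed

text \<open>Chain rule for the transition map from \<open>c'\<close> to \<open>c\<close>; the
  derivatives of the functions \<open>snd c q $ j\<close> are its Jacobian entries.\<close>

lemma coord_vec_change:
  assumes c: "c \<in> A" "p \<in> fst c" and c': "c' \<in> A" "p \<in> fst c'"
  shows "coord_vec A c' i p f =
    (\<Sum>j\<in>UNIV. coord_vec A c' i p (\<lambda>q. snd c q $ j) * coord_vec A c j p f)"
\<comment> \<open>On a function that is not smooth near \<open>p\<close> every coordinate vector is
  0 by default, so the formula persists as 0 = 0.\<close>
proof (cases "smooth_near A p f")
  case False
  then show ?thesis by (simp add: coord_vec_def)
next
  case True
  then obtain W where W: "open W" "p \<in> W" "smooth_fun A W f" by (auto simp: smooth_near_def)
  let ?x = "snd c' p" and ?\<phi> = "snd c \<circ> chart_inv c'" and ?f = "f \<circ> chart_inv c"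
  have x: "?x \<in> snd c' ` (fst c' \<inter> fst c)" using c c' by auto
  have "smooth_on (snd c' ` (fst c' \<inter> fst c)) ?\<phi>"
    using smooth_manifold c c' by (auto simp: smooth_manifold_def)
  then have "Ck_on (Suc 0) (snd c' ` (fst c' \<inter> fst c)) ?\<phi>" by (simp only: smooth_on_def)
  then have \<phi>: "(?\<phi> has_derivative frechet_derivative ?\<phi> (at ?x)) (at ?x)"
    using Ck_on_Suc_has_derivative x by blast
  have p: "chart_inv c' ?x = p" using chart_inv_snd[OF is_chart[OF c'(1)] c'(2)] .
  then have \<phi>x: "?\<phi> ?x = snd c p" by simp
  have df: "(?f has_derivative frechet_derivative ?f (at (snd c p))) (at (?\<phi> ?x))"
    unfolding \<phi>x using has_derivative_chart[OF W(1,2,3) c] .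
  have comp: "(f \<circ> chart_inv c' has_derivative
      (\<lambda>v. frechet_derivative ?f (at (snd c p)) (frechet_derivative ?\<phi> (at ?x) v))) (at ?x)"
  proof (rule has_derivative_transform_within_open[OF has_derivative_compose[OF \<phi> df]])
    show "open (snd c' ` (fst c \<inter> fst c'))"
      using open_chart_image[OF is_chart[OF c'(1)] open_chart[OF c(1)]] .
    show "?x \<in> snd c' ` (fst c \<inter> fst c')" using x by (simp add: Int_commute)
  qed (auto simp: chart_inv_snd[OF is_chart[OF c(1)]] chart_inv_snd[OF is_chart[OF c'(1)]])
  have "?f differentiable (at (snd c p))"
    using has_derivative_chart[OF W(1,2,3) c] by (auto simp: differentiable_def)
  note ex = frechet_derivative_axis_expand[OF this]
  have comp_j: "coord_vec A c' i p (\<lambda>q. snd c q $ j) = frechet_derivative ?\<phi> (at ?x) (axis i 1) $ j" for j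
  proof (rule coord_vec_eqI[OF open_chart[OF c(1)] c(2) c' smooth_fun_coordinate[OF c(1)]])
    show "((\<lambda>q. snd c q $ j) \<circ> chart_inv c' has_derivative (\<lambda>v. frechet_derivative ?\<phi> (at ?x) v $ j)) (at ?x)"
      using bounded_linear.has_derivative[OF bounded_linear_vec_nth \<phi>] by (simp add: o_def)
  qed
  have "coord_vec A c' i p f =
      frechet_derivative ?f (at (snd c p)) (frechet_derivative ?\<phi> (at ?x) (axis i 1))"
    using coord_vec_eqI[OF W(1,2) c' W(3) comp] .
  also have "\<dots> = (\<Sum>j\<in>UNIV. frechet_derivative ?f (at (snd c p)) (axis j 1) *
      frechet_derivative ?\<phi> (at ?x) (axis i 1) $ j)"
    by (rule ex)
  also have "\<dots> = (\<Sum>j\<in>UNIV. coord_vec A c' i p (\<lambda>q. snd c q $ j) * coord_vec A c j p f)"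
    by (intro sum.cong refl) (simp add: comp_j coord_vec_eq[OF W])
  finally show ?thesis .
qed

text \<open>The definition lets each vector choose its own chart; \<open>coord_vec_change\<close>
  rewrites all of them in one chart.\<close>

lemma tangent_space_eq:
  assumes c: "c \<in> A" "p \<in> fst c"
  shows "tangent_space A p = {v. \<exists>a :: real ^ 'n. v = (\<lambda>f. \<Sum>i\<in>UNIV. a $ i * coord_vec A c i p f)}"
proof -
  have "\<exists>b :: real ^ 'n. (\<lambda>f. \<Sum>i\<in>UNIV. a $ i * coord_vec A c' i p f) =
      (\<lambda>f. \<Sum>i\<in>UNIV. b $ i * coord_vec A c i p f)"
    if c': "c' \<in> A" "p \<in> fst c'" for c' and a :: "real ^ 'n"
  proof (intro exI ext)
    let ?J = "\<lambda>i j. coord_vec A c' i p (\<lambda>q. snd c q $ j)"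
    fix f
    have "(\<Sum>i\<in>UNIV. a $ i * coord_vec A c' i p f) =
        (\<Sum>i\<in>UNIV. \<Sum>j\<in>UNIV. a $ i * ?J i j * coord_vec A c j p f)"
      by (subst coord_vec_change[OF c c']) (simp add: sum_distrib_left mult.assoc)
    also have "\<dots> = (\<Sum>j\<in>UNIV. \<Sum>i\<in>UNIV. a $ i * ?J i j * coord_vec A c j p f)"
      by (rule sum.swap)
    finally show "(\<Sum>i\<in>UNIV. a $ i * coord_vec A c' i p f) =
        (\<Sum>j\<in>UNIV. (\<chi> j. \<Sum>i\<in>UNIV. a $ i * ?J i j) $ j * coord_vec A c j p f)"
      by (simp add: sum_distrib_right)
  qed
  then show ?thesis using c unfolding tangent_space_def by blast
qed

lemma coord_vec_tangent: "c \<in> A \<Longrightarrow> p \<in> fst c \<Longrightarrow> coord_vec A c i p \<in> tangent_space A p"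
proof -
  assume "c \<in> A" "p \<in> fst c"
  moreover have "coord_vec A c i p = (\<lambda>f. \<Sum>j\<in>UNIV. axis i 1 $ j * coord_vec A c j p f)"
    by (simp add: axis_def if_distrib[of "\<lambda>x. x * _"] cong: if_cong)
  ultimately show ?thesis unfolding tangent_space_def by blast
qed

end

section \<open>Metrics and Christoffel symbols\<close>

text \<open>\<open>matrix_inv\<close> is a choice of two-sided inverse. For square matrices a right
  inverse is two-sided, and two-sided inverses are unique.\<close>

lemma matrix_inv_eqI:
  fixes M B :: "real ^ 'k::finite ^ 'k"
  assumes "M ** B = mat 1"
  shows "matrix_inv M = B"
proof -
  have "B ** M = mat 1" using assms matrix_left_right_inverse by blast
  then have "\<exists>A'. M ** A' = mat 1 \<and> A' ** M = mat 1" using assms by blast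
  from someI_ex[OF this] have "matrix_inv M ** M = mat 1" unfolding matrix_inv_def by blast
  then have "(matrix_inv M ** M) ** B = B" by simp
  then show ?thesis by (simp add: matrix_mul_assoc[symmetric] assms)
qed

lemma rescale_rescale: "rescale \<upsilon> (rescale \<omega> g) = rescale (\<lambda>p. \<omega> p + \<upsilon> p) g"
  by (simp add: rescale_def distrib_left exp_add mult_ac)

locale metric_chart = manifold A
  for A :: "('m::{t2_space, second_countable_topology}, 'n::finite) chart set" +
  fixes g :: "'m metric" and c :: "('m, 'n) chart"
  assumes metric: "is_metric A g" and chart: "c \<in> A"
begin

abbreviation pd :: "'n \<Rightarrow> ('m \<Rightarrow> real) \<Rightarrow> 'm \<Rightarrow> real" where "pd i f q \<equiv> coord_vec A c i q f"
abbreviation G :: "'n \<Rightarrow> 'n \<Rightarrow> 'm \<Rightarrow> real" where "G i j q \<equiv> metric_mat A g c q $ i $ j"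
abbreviation H :: "'n \<Rightarrow> 'n \<Rightarrow> 'm \<Rightarrow> real" where "H i j q \<equiv> metric_inv A g c q $ i $ j"
abbreviation \<Gamma> :: "'n \<Rightarrow> 'n \<Rightarrow> 'n \<Rightarrow> 'm \<Rightarrow> real" where "\<Gamma> k i j \<equiv> christoffel A g c k i j"

lemma open_dom: "open (fst c)"
  using open_chart[OF chart] .

lemma tangent: "p \<in> fst c \<Longrightarrow> coord_vec A c i p \<in> tangent_space A p"
  using coord_vec_tangent[OF chart] .

lemma metric_sym: "v \<in> tangent_space A p \<Longrightarrow> w \<in> tangent_space A p \<Longrightarrow> g p v w = g p w v"
  using metric unfolding is_metric_def by blast

lemma G_sym: "p \<in> fst c \<Longrightarrow> G i j p = G j i p"
  by (simp add: metric_mat_def metric_sym tangent)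

lemma metric_linear:
  assumes "p \<in> fst c" "w \<in> tangent_space A p"
  shows "g p (\<lambda>f. \<Sum>i\<in>J. a i * coord_vec A c i p f) w = (\<Sum>i\<in>J. a i * g p (coord_vec A c i p) w)"
proof -
  have lin: "g p (\<lambda>f. s * u f + t * v f) w = s * g p u w + t * g p v w"
    if "u \<in> tangent_space A p" "v \<in> tangent_space A p" for u v s t
    using metric assms that unfolding is_metric_def by blast
  show ?thesis
  proof (induction J rule: infinite_finite_induct)
    case (insert i J)
    \<comment> \<open>A partial sum is a tangent vector once its coefficients are extended by zero
      to all indices.\<close>
    have "(\<lambda>f. \<Sum>j\<in>J. a j * coord_vec A c j p f) =
        (\<lambda>f. \<Sum>j\<in>UNIV. (\<chi> j. if j \<in> J then a j else 0) $ j * coord_vec A c j p f)"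
      by (simp add: if_distrib[of "\<lambda>x. x * _"] sum.If_cases)
    then have "(\<lambda>f. \<Sum>j\<in>J. a j * coord_vec A c j p f) \<in> tangent_space A p"
      using assms(1) chart unfolding tangent_space_def by blast
    from lin[OF tangent[OF assms(1), of i] this, of "a i" 1] insert show ?case by simp
  qed (use lin[OF tangent[OF assms(1)] tangent[OF assms(1)], of 0 _ 0] in simp_all)
qed

text \<open>A vector in the kernel of the matrix gives a tangent vector orthogonal to the whole
  tangent space. It is zero by nondegeneracy, and the coordinate functions show that all its
  coefficients vanish.\<close>

lemma G_invertible:
  assumes p: "p \<in> fst c" shows "invertible (metric_mat A g c p)"
proof -
  have "x = 0" if x: "metric_mat A g c p *v x = 0" for x
  proof -
    let ?v = "\<lambda>f. \<Sum>i\<in>UNIV. x $ i * coord_vec A c i p f"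
    have v: "?v \<in> tangent_space A p"
      using p chart unfolding tangent_space_def by blast
    have "g p ?v w = 0" if w: "w \<in> tangent_space A p" for w
    proof -
      obtain b where b: "w = (\<lambda>f. \<Sum>i\<in>UNIV. b $ i * coord_vec A c i p f)"
        using w tangent_space_eq[OF chart p] by blast
      have "g p ?v w = g p w ?v" using metric_sym v w by blast
      also have "\<dots> = (\<Sum>i\<in>UNIV. b $ i * g p (coord_vec A c i p) ?v)"
        unfolding b using metric_linear[OF p v] .
      also have "\<dots> = (\<Sum>i\<in>UNIV. b $ i * g p ?v (coord_vec A c i p))"
        using metric_sym[OF v tangent[OF p]] by simp
      also have "\<dots> = (\<Sum>i\<in>UNIV. b $ i * (\<Sum>j\<in>UNIV. x $ j * g p (coord_vec A c j p) (coord_vec A c i p)))"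
        by (simp only: metric_linear[OF p tangent[OF p]])
      also have "\<dots> = (\<Sum>i\<in>UNIV. b $ i * (\<Sum>j\<in>UNIV. G i j p * x $ j))"
        using metric_sym[OF tangent[OF p] tangent[OF p]] by (simp add: metric_mat_def mult.commute)
      also have "\<dots> = (\<Sum>i\<in>UNIV. b $ i * (metric_mat A g c p *v x) $ i)"
        by (simp add: matrix_vector_mult_def)
      finally show ?thesis by (simp add: x)
    qed
    then have v0: "?v = (\<lambda>_. 0)" using metric v unfolding is_metric_def by blast
    have "x $ j = 0" for j
      using fun_cong[OF v0, of "\<lambda>q. snd c q $ j"]
      by (simp add: coord_vec_coordinate[OF chart p] if_distrib[of "\<lambda>x. _ * x"] cong: if_cong)
    then show ?thesis by (simp add: vec_eq_iff)
  qed
  then show ?thesis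
    using matrix_left_invertible_ker invertible_left_inverse by blast
qed

lemma GH: "p \<in> fst c \<Longrightarrow> (\<Sum>l\<in>UNIV. G i l p * H l j p) = (if i = j then 1 else 0)"
  using metric_inv_left[OF G_invertible] .

lemma HG: "p \<in> fst c \<Longrightarrow> (\<Sum>l\<in>UNIV. H i l p * G l j p) = (if i = j then 1 else 0)"
proof -
  assume p: "p \<in> fst c"
  have "metric_inv A g c p ** metric_mat A g c p = mat 1"
    unfolding metric_inv_def matrix_inv_def
    using someI_ex[OF G_invertible[OF p, unfolded invertible_def]] by blast
  then have "(metric_inv A g c p ** metric_mat A g c p) $ i $ j = mat 1 $ i $ j" by simp
  then show ?thesis by (simp add: matrix_matrix_mult_def mat_def)
qed

lemma H_sym:
  assumes p: "p \<in> fst c" shows "H i j p = H j i p"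
proof -
  have "(\<Sum>k\<in>UNIV. G i k p * H j k p) = (if i = j then 1 else 0)" for i j
    using HG[OF p, of j i] by (simp add: mult.commute eq_commute G_sym[OF p, of i])
  then have "metric_mat A g c p ** transpose (metric_inv A g c p) = mat 1"
    by (simp add: matrix_matrix_mult_def mat_def vec_eq_iff transpose_def)
  from matrix_inv_eqI[OF this] have "metric_inv A g c p = transpose (metric_inv A g c p)"
    by (simp add: metric_inv_def)
  then have "metric_inv A g c p $ i $ j = transpose (metric_inv A g c p) $ i $ j"
    by (rule arg_cong)
  then show ?thesis by (simp add: transpose_def)
qed

text \<open>If all values at \<open>p\<close> were zero, the product with the inverse matrix could
  not have 1 on its diagonal. Needed to recover a conformal factor from a rescaled metric.\<close>

lemma metric_nonzero: "\<exists>v w. p \<in> fst c \<longrightarrow> g p v w \<noteq> 0"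
proof (rule ccontr)
  assume "\<not> ?thesis"
  then have p: "p \<in> fst c" "\<And>v w. g p v w = 0" by auto
  then have "G i j p = 0" for i j by (simp add: metric_mat_def)
  then show False using GH[OF p(1), of undefined undefined] by simp
qed

lemma smooth_G: "smooth_fun A (fst c) (G i j)"
  using metric chart unfolding is_metric_def metric_mat_def by simp

lemma smooth_H: "smooth_fun A (fst c) (H i j)"
  unfolding metric_inv_def
  by (rule smooth_fun_matrix_inv[OF open_dom smooth_G G_invertible])

lemma smooth_d: "smooth_fun A (fst c) f \<Longrightarrow> smooth_fun A (fst c) (pd i f)"
  using smooth_fun_coord_vec[OF open_dom order_refl chart] .

lemma smooth_christoffel: "smooth_fun A (fst c) (\<Gamma> k i j)"
  unfolding christoffel_def
  by (intro smooth_fun_divide_const smooth_fun_sum smooth_fun_mult smooth_fun_add smooth_fun_diff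
      smooth_d smooth_G smooth_H open_dom)

lemma pd_cong:
  assumes "p \<in> fst c" "\<And>q. q \<in> fst c \<Longrightarrow> f q = f' q" "smooth_fun A (fst c) f"
  shows "pd i f p = pd i f' p"
  using coord_vec_cong[OF open_dom assms(1) chart assms] .

lemma pd_G_sym: "p \<in> fst c \<Longrightarrow> pd k (G i j) p = pd k (G j i) p"
  by (rule pd_cong[OF _ _ smooth_G]) (simp_all add: G_sym)

lemma \<Gamma>_sym: "p \<in> fst c \<Longrightarrow> \<Gamma> k i j p = \<Gamma> k j i p"
  unfolding christoffel_def by (simp add: pd_G_sym[of p _ i j] add.commute)

text \<open>\<open>christoffel_metric_compatible\<close> asks for a symmetric matrix at every point,
  but symmetry is available on the chart domain only; locality of the derivatives bridges
  this.\<close>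

lemma metric_compatible:
  assumes p: "p \<in> fst c"
  shows "pd a (G i j) p = (\<Sum>k\<in>UNIV. \<Gamma> k a i p * G k j p + \<Gamma> k a j p * G i k p)"
proof -
  have "(\<Sum>k\<in>UNIV. \<Gamma> k a i p * G k j p + \<Gamma> k a j p * G i k p) =
      (\<Sum>k\<in>UNIV. G j k p * \<Gamma> k a i p) + (\<Sum>k\<in>UNIV. G i k p * \<Gamma> k a j p)"
    by (simp add: sum.distrib G_sym[OF p, of j] mult.commute)
  also have "\<dots> = pd a (G i j) p"
    unfolding christoffel_lower[OF G_invertible[OF p]]
    using pd_G_sym[OF p] by (simp add: field_simps)
  finally show ?thesis ..
qed

end

section \<open>Rescaled metrics and uniqueness of the conformal factor\<close>

context manifold begin

lemma rescale_is_metric: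
  assumes g: "is_metric A g" and \<omega>: "smooth_fun A UNIV \<omega>"
  shows "is_metric A (rescale \<omega> g)"
proof -
  have sm: "smooth_fun A (fst c) (\<lambda>q. exp (2 * \<omega> q) * g q (coord_vec A c i q) (coord_vec A c j q))"
    if "c \<in> A" for c i j
    using g that unfolding is_metric_def
    by (intro smooth_fun_mult smooth_fun_exp smooth_fun_cmult open_chart
        smooth_fun_subset[OF \<omega>]) auto
  have nd: "v = (\<lambda>_. 0)" if "v \<in> tangent_space A p" "\<forall>w\<in>tangent_space A p. g p v w = 0" for p v
    using g that unfolding is_metric_def by blast
  have lin: "g p (\<lambda>f. a * v f + b * w f) z = a * g p v z + b * g p w z"
    and sym: "g p v w = g p w v"
    if "v \<in> tangent_space A p" "w \<in> tangent_space A p" "z \<in> tangent_space A p" for p v w z a b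
    using g that unfolding is_metric_def by blast+
  show ?thesis
    unfolding is_metric_def rescale_def
  proof (intro conjI allI ballI impI)
    fix p v w assume "v \<in> tangent_space A p" "w \<in> tangent_space A p"
    then show "exp (2 * \<omega> p) * g p v w = exp (2 * \<omega> p) * g p w v" using sym by simp
  next
    fix p v w z a b
    assume "v \<in> tangent_space A p" "w \<in> tangent_space A p" "z \<in> tangent_space A p"
    then show "exp (2 * \<omega> p) * g p (\<lambda>f. a * v f + b * w f) z =
        a * (exp (2 * \<omega> p) * g p v z) + b * (exp (2 * \<omega> p) * g p w z)"
      by (simp add: lin algebra_simps)
  next
    fix p v assume "v \<in> tangent_space A p" "\<forall>w\<in>tangent_space A p. exp (2 * \<omega> p) * g p v w = 0"
    then show "v = (\<lambda>_. 0)" using nd by simp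
  qed (use sm in simp)
qed

text \<open>At each point some value of \<open>g\<close> is nonzero, and exp is injective. This
  makes the choice in \<open>log_factor\<close> unambiguous.\<close>

lemma rescale_inject:
  assumes "is_metric A g" "rescale \<upsilon> g = rescale \<upsilon>' g"
  shows "\<upsilon> = \<upsilon>'"
proof
  fix p
  have "\<Union> (fst ` A) = UNIV" using smooth_manifold unfolding smooth_manifold_def by simp
  then obtain c where "c \<in> A" "p \<in> fst c" by blast
  then interpret metric_chart A g c using assms(1) by unfold_locales
  obtain v w where "g p v w \<noteq> 0" using metric_nonzero[of p] \<open>p \<in> fst c\<close> by blast
  moreover have "rescale \<upsilon> g p v w = rescale \<upsilon>' g p v w" using assms(2) by simp
  ultimately show "\<upsilon> p = \<upsilon>' p" by (simp add: rescale_def)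
qed

lemma log_factor_rescale:
  assumes "is_metric A g" shows "log_factor g (rescale \<upsilon> g) = \<upsilon>"
  unfolding log_factor_def using rescale_inject[OF assms] by (metis (mono_tags, lifting) someI_ex)

end

section \<open>Conformal change of the metric and its Christoffel symbols\<close>

locale conformal_chart = metric_chart A g c
  for A :: "('m::{t2_space, second_countable_topology}, 'n::finite) chart set" and g c +
  fixes \<omega> :: "'m \<Rightarrow> real"
  assumes smooth_\<omega>: "smooth_fun A UNIV \<omega>"
begin

sublocale hat: metric_chart A "rescale \<omega> g" c
  using rescale_is_metric[OF metric smooth_\<omega>] chart by unfold_locales

text \<open>\<open>Y\<close> is d\<omega> and \<open>Yu\<close> is its gradient, raised with
  \<open>g\<close> and not with the rescaled metric.\<close>

abbreviation Y :: "'n \<Rightarrow> 'm \<Rightarrow> real" where "Y i \<equiv> pd i \<omega>"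
abbreviation Yu :: "'n \<Rightarrow> 'm \<Rightarrow> real" where "Yu k q \<equiv> (\<Sum>l\<in>UNIV. H k l q * Y l q)"

lemma smooth_\<omega>_chart: "smooth_fun A (fst c) \<omega>"
  using smooth_fun_subset[OF smooth_\<omega>] by simp

lemma smooth_Y: "smooth_fun A (fst c) (Y i)"
  using smooth_d[OF smooth_\<omega>_chart] .

lemma smooth_Yu: "smooth_fun A (fst c) (Yu i)"
  by (intro smooth_fun_sum smooth_fun_mult open_dom smooth_Y smooth_H)

lemma hat_G: "hat.G i j q = exp (2 * \<omega> q) * G i j q"
  by (simp add: metric_mat_def rescale_def)

lemma hat_H:
  assumes p: "p \<in> fst c" shows "hat.H i j p = exp (- 2 * \<omega> p) * H i j p"
proof -
  let ?B = "exp (- 2 * \<omega> p) *\<^sub>R metric_inv A g c p"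
  have e: "exp (2 * \<omega> p) * x * (exp (- (2 * \<omega> p)) * y) = x * y" for x y
    using exp_minus_inverse[of "2 * \<omega> p"] by (simp add: mult_ac)
  have "metric_mat A (rescale \<omega> g) c p ** ?B = mat 1"
    by (simp add: matrix_matrix_mult_def vec_eq_iff hat_G mat_def e GH[OF p])
  from matrix_inv_eqI[OF this] show ?thesis by (simp add: metric_inv_def)
qed

lemma exp_H: "exp (- (2 * \<omega> p)) * (x * (exp (2 * \<omega> p) * y)) = x * y" for x y
  using exp_minus_inverse[of "2 * \<omega> p"] by (simp add: mult_ac)

lemma hat_pd_G:
  assumes p: "p \<in> fst c"
  shows "pd k (hat.G i j) p = exp (2 * \<omega> p) * (pd k (G i j) p + 2 * Y k p * G i j p)"
proof -
  have e: "smooth_fun A (fst c) (\<lambda>q. 2 * \<omega> q)"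
    using smooth_fun_cmult[OF open_dom smooth_\<omega>_chart] .
  have "pd k (hat.G i j) p = pd k (\<lambda>q. exp (2 * \<omega> q) * G i j q) p"
    by (simp add: hat_G)
  also have "\<dots> = exp (2 * \<omega> p) * (2 * Y k p) * G i j p + exp (2 * \<omega> p) * pd k (G i j) p"
    unfolding coord_vec_mult[OF open_dom p chart p smooth_fun_exp[OF open_dom e] smooth_G]
      coord_vec_exp[OF open_dom p chart p e] coord_vec_cmult[OF open_dom p chart p smooth_\<omega>_chart] ..
  finally show ?thesis by (simp add: algebra_simps)
qed

text \<open>The exponentials of the inverse metric and of the differentiated metric cancel. The
  correction comes from differentiating the conformal factor, with \<open>H\<close> contracted
  against \<open>G\<close>.\<close>

lemma hat_\<Gamma>:
  assumes p: "p \<in> fst c"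
  shows "hat.\<Gamma> k i j p = \<Gamma> k i j p +
    ((if k = i then Y j p else 0) + (if k = j then Y i p else 0) - G i j p * Yu k p)"
proof -
  have "hat.\<Gamma> k i j p = (\<Sum>l\<in>UNIV. H k l p *
      (pd i (G j l) p + 2 * Y i p * G j l p + (pd j (G i l) p + 2 * Y j p * G i l p)
       - (pd l (G i j) p + 2 * Y l p * G i j p))) / 2"
    unfolding christoffel_def hat_pd_G[OF p] hat_H[OF p]
    by (simp add: distrib_left[symmetric] right_diff_distrib[symmetric] exp_H mult.assoc)
  also have "\<dots> = (\<Sum>l\<in>UNIV. H k l p * (pd i (G j l) p + pd j (G i l) p - pd l (G i j) p)
      + 2 * (Y i p * (H k l p * G l j p)) + 2 * (Y j p * (H k l p * G l i p))
      - 2 * (G i j p * (H k l p * Y l p))) / 2"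
  proof (intro arg_cong[where f = "\<lambda>x. x / 2"] sum.cong refl)
    fix l
    show "H k l p * (pd i (G j l) p + 2 * Y i p * G j l p + (pd j (G i l) p + 2 * Y j p * G i l p)
         - (pd l (G i j) p + 2 * Y l p * G i j p)) =
       H k l p * (pd i (G j l) p + pd j (G i l) p - pd l (G i j) p)
      + 2 * (Y i p * (H k l p * G l j p)) + 2 * (Y j p * (H k l p * G l i p))
      - 2 * (G i j p * (H k l p * Y l p))"
      unfolding G_sym[OF p, of j l] G_sym[OF p, of i l] by (simp add: algebra_simps)
  qed
  also have "\<dots> = \<Gamma> k i j p + (Y i p * (\<Sum>l\<in>UNIV. H k l p * G l j p)
      + Y j p * (\<Sum>l\<in>UNIV. H k l p * G l i p) - G i j p * Yu k p)"
    unfolding christoffel_def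
    by (simp only: sum.distrib sum_subtractf sum_distrib_left[symmetric]) simp
  finally show ?thesis by (simp add: HG[OF p] cong: if_cong)
qed

end

section \<open>Conformal change of the Ricci tensor, pointwise\<close>

(* Values at one point of a chart: Y is the differential of the conformal factor, Z its gradient,
   and dY, dZ, dG are coordinate derivatives, with the direction as first index.
   S below is the change of the Christoffel symbols and dS its derivative. *)
locale conformal_algebra =
  fixes G H :: "'n::finite \<Rightarrow> 'n \<Rightarrow> real" and \<Gamma> :: "'n \<Rightarrow> 'n \<Rightarrow> 'n \<Rightarrow> real"
    and Y Z :: "'n \<Rightarrow> real" and dY dZ :: "'n \<Rightarrow> 'n \<Rightarrow> real" and dG :: "'n \<Rightarrow> 'n \<Rightarrow> 'n \<Rightarrow> real"
  assumes G_sym: "G i j = G j i" and \<Gamma>_sym: "\<Gamma> k i j = \<Gamma> k j i" and dY_sym: "dY i j = dY j i"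
    and HG: "(\<Sum>l\<in>UNIV. H i l * G l j) = (if i = j then 1 else 0)"
    and GZ: "(\<Sum>m\<in>UNIV. G a m * Z m) = Y a"
    and dGZ: "(\<Sum>m\<in>UNIV. dG l a m * Z m + G a m * dZ l m) = dY l a"
    and dG: "dG l i j = (\<Sum>k\<in>UNIV. \<Gamma> k l i * G k j + \<Gamma> k l j * G i k)"
begin

definition S :: "'n \<Rightarrow> 'n \<Rightarrow> 'n \<Rightarrow> real" where
  "S k i j = (if k = i then Y j else 0) + (if k = j then Y i else 0) - G i j * Z k"

definition dS :: "'n \<Rightarrow> 'n \<Rightarrow> 'n \<Rightarrow> 'n \<Rightarrow> real" where
  "dS l k i j = (if k = i then dY l j else 0) + (if k = j then dY l i else 0)
     - (dG l i j * Z k + G i j * dZ l k)"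

definition norm2 :: real where "norm2 = (\<Sum>m\<in>UNIV. Y m * Z m)"

definition hess :: "'n \<Rightarrow> 'n \<Rightarrow> real" where "hess a b = dY a b - (\<Sum>m\<in>UNIV. \<Gamma> m a b * Y m)"

text \<open>The Laplacian of \<omega> as the divergence of its gradient; \<open>nabla_raise\<close>
  identifies it with the trace of the Hessian.\<close>

definition lap :: real where "lap = (\<Sum>k\<in>UNIV. dZ k k + (\<Sum>m\<in>UNIV. \<Gamma> k k m * Z m))"

lemma S_sym: "S k i j = S k j i"
  by (simp add: S_def G_sym[of i j])

lemma dG_sym: "dG l i j = dG l j i"
  unfolding dG by (intro sum.cong refl) (simp add: G_sym[of j] G_sym[of i])

text \<open>With \<open>sum_S_lower\<close>, this reduces the products of \<open>S\<close> with
  \<open>\<Gamma>\<close> and with itself to single contractions, since \<open>S\<close> is built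
  from Kronecker deltas and the metric.\<close>

lemma sum_S_upper:
  "(\<Sum>m\<in>UNIV. f m * S m a b) = f a * Y b + f b * Y a - G a b * (\<Sum>m\<in>UNIV. f m * Z m)"
proof -
  have "f m * S m a b = (if m = a then f m * Y b else 0) + (if m = b then f m * Y a else 0)
      - G a b * (f m * Z m)" for m
    by (simp add: S_def algebra_simps)
  then show ?thesis by (simp add: sum.distrib sum_subtractf sum_distrib_left)
qed

lemma sum_S_lower:
  "(\<Sum>m\<in>UNIV. f m * S k a m) =
    (if k = a then \<Sum>m\<in>UNIV. f m * Y m else 0) + f k * Y a - Z k * (\<Sum>m\<in>UNIV. G a m * f m)"
proof -
  have "f m * S k a m = (if k = a then f m * Y m else 0) + (if m = k then f m * Y a else 0)
      - Z k * (G a m * f m)" for m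
    by (simp add: S_def algebra_simps)
  then show ?thesis by (cases "k = a") (simp_all add: sum.distrib sum_subtractf sum_distrib_left)
qed

text \<open>One delta contributes n times \<open>Y\<close>, the other adds one \<open>Y\<close>, and
  the metric term removes it again by \<open>GZ\<close>.\<close>

lemma trace_S: "(\<Sum>k\<in>UNIV. S k k m) = real CARD('n) * Y m"
proof -
  have "S k k m = Y m + (if k = m then Y k else 0) - G m k * Z k" for k
    by (simp add: S_def G_sym[of k])
  then show ?thesis by (simp add: sum.distrib sum_subtractf GZ)
qed

lemma trace_dS_first:
  "(\<Sum>k\<in>UNIV. dS k k a b) = 2 * dY a b
    - (\<Sum>k\<in>UNIV. dG k a b * Z k) - G a b * (\<Sum>k\<in>UNIV. dZ k k)"
proof -
  have "dS k k a b = (if k = a then dY k b else 0) + (if k = b then dY k a else 0)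
      - dG k a b * Z k - G a b * dZ k k" for k
    by (simp add: dS_def)
  then show ?thesis by (simp add: sum.distrib sum_subtractf sum_distrib_left dY_sym[of b a])
qed

lemma trace_dS_second: "(\<Sum>k\<in>UNIV. dS a k k b) = real CARD('n) * dY a b"
proof -
  have "dS a k k b = dY a b + (if k = b then dY a k else 0) - (dG a b k * Z k + G b k * dZ a k)" for k
    by (simp add: dS_def G_sym[of k] dG_sym[of a k])
  then show ?thesis using dGZ[of a b] by (simp add: sum.distrib sum_subtractf)
qed

text \<open>The two halves have this shape because they cancel against the last terms of
  \<open>sum_\<Gamma>S'\<close> and \<open>sum_S\<Gamma>'\<close> in the Ricci tensor.\<close>

lemma sum_dG_Z:
  "(\<Sum>k\<in>UNIV. dG k a b * Z k) =
    (\<Sum>k\<in>UNIV. G k b * (\<Sum>m\<in>UNIV. \<Gamma> k a m * Z m)) + (\<Sum>k\<in>UNIV. Z k * (\<Sum>m\<in>UNIV. G a m * \<Gamma> m k b))"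
proof -
  have "dG k a b * Z k = (\<Sum>m\<in>UNIV. G m b * (\<Gamma> m a k * Z k)) + Z k * (\<Sum>m\<in>UNIV. G a m * \<Gamma> m k b)" for k
    unfolding dG by (simp add: sum.distrib sum_distrib_left sum_distrib_right \<Gamma>_sym[of _ k a] algebra_simps)
  then have "(\<Sum>k\<in>UNIV. dG k a b * Z k) =
      (\<Sum>k\<in>UNIV. \<Sum>m\<in>UNIV. G m b * (\<Gamma> m a k * Z k)) + (\<Sum>k\<in>UNIV. Z k * (\<Sum>m\<in>UNIV. G a m * \<Gamma> m k b))"
    by (simp add: sum.distrib)
  also have "(\<Sum>k\<in>UNIV. \<Sum>m\<in>UNIV. G m b * (\<Gamma> m a k * Z k)) = (\<Sum>m\<in>UNIV. \<Sum>k\<in>UNIV. G m b * (\<Gamma> m a k * Z k))"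
    by (rule sum.swap)
  finally show ?thesis by (simp add: sum_distrib_left)
qed

lemma sum_\<Gamma>S:
  "(\<Sum>k\<in>UNIV. \<Sum>m\<in>UNIV. \<Gamma> k k m * S m a b) =
    (\<Sum>k\<in>UNIV. \<Gamma> k k a) * Y b + (\<Sum>k\<in>UNIV. \<Gamma> k k b) * Y a
    - G a b * (\<Sum>k\<in>UNIV. \<Sum>m\<in>UNIV. \<Gamma> k k m * Z m)"
  unfolding sum_S_upper by (simp add: sum.distrib sum_subtractf sum_distrib_left sum_distrib_right)

lemma sum_S\<Gamma>:
  "(\<Sum>k\<in>UNIV. \<Sum>m\<in>UNIV. S k k m * \<Gamma> m a b) = real CARD('n) * (\<Sum>m\<in>UNIV. \<Gamma> m a b * Y m)"
proof -
  have "(\<Sum>k\<in>UNIV. \<Sum>m\<in>UNIV. S k k m * \<Gamma> m a b) = (\<Sum>m\<in>UNIV. \<Sum>k\<in>UNIV. S k k m * \<Gamma> m a b)"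
    by (rule sum.swap)
  also have "\<dots> = (\<Sum>m\<in>UNIV. real CARD('n) * Y m * \<Gamma> m a b)"
    by (simp only: sum_distrib_right[symmetric] trace_S)
  finally show ?thesis by (simp add: sum_distrib_left mult_ac)
qed

lemma sum_\<Gamma>S':
  "(\<Sum>k\<in>UNIV. \<Sum>m\<in>UNIV. \<Gamma> k a m * S m k b) =
    (\<Sum>k\<in>UNIV. \<Gamma> k k a) * Y b + (\<Sum>m\<in>UNIV. \<Gamma> m a b * Y m)
    - (\<Sum>k\<in>UNIV. G k b * (\<Sum>m\<in>UNIV. \<Gamma> k a m * Z m))"
  unfolding sum_S_upper
  by (simp add: sum.distrib sum_subtractf sum_distrib_right \<Gamma>_sym[of _ a])

lemma sum_S\<Gamma>':
  "(\<Sum>k\<in>UNIV. \<Sum>m\<in>UNIV. S k a m * \<Gamma> m k b) =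
    (\<Sum>m\<in>UNIV. \<Gamma> m a b * Y m) + (\<Sum>k\<in>UNIV. \<Gamma> k k b) * Y a
    - (\<Sum>k\<in>UNIV. Z k * (\<Sum>m\<in>UNIV. G a m * \<Gamma> m k b))"
  unfolding mult.commute[of "S _ _ _"] sum_S_lower
  by (simp add: sum.distrib sum_subtractf sum_distrib_right)

lemma sum_SS: "(\<Sum>k\<in>UNIV. \<Sum>m\<in>UNIV. S k k m * S m a b) = real CARD('n) * (2 * Y a * Y b - G a b * norm2)"
proof -
  have "(\<Sum>k\<in>UNIV. \<Sum>m\<in>UNIV. S k k m * S m a b) = (\<Sum>m\<in>UNIV. \<Sum>k\<in>UNIV. S k k m * S m a b)"
    by (rule sum.swap)
  also have "\<dots> = (\<Sum>m\<in>UNIV. real CARD('n) * Y m * S m a b)"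
    by (simp only: sum_distrib_right[symmetric] trace_S)
  also have "\<dots> = real CARD('n) * (\<Sum>m\<in>UNIV. Y m * S m a b)"
    by (simp add: sum_distrib_left mult.assoc)
  finally show ?thesis unfolding sum_S_upper norm2_def by (simp add: mult.commute)
qed

lemma sum_SS':
  "(\<Sum>k\<in>UNIV. \<Sum>m\<in>UNIV. S k a m * S m k b) = (real CARD('n) + 2) * Y a * Y b - 2 * G a b * norm2"
proof -
  \<comment> \<open>The contributions \<open>Z k * Y a\<close> from the second delta and from the
    metric term cancel, leaving a multiple of the identity.\<close>
  have Z: "(\<Sum>m\<in>UNIV. S k a m * Z m) = (if k = a then norm2 else 0)" for k
    using sum_S_lower[of Z k a] unfolding GZ norm2_def mult.commute[of "S _ _ _"] mult.commute[of "Y _"]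
    by simp
  have "(\<Sum>k\<in>UNIV. \<Sum>m\<in>UNIV. S k a m * S m k b) =
      (\<Sum>k\<in>UNIV. S k k a * Y b + Y k * S k a b - (if k = a then G k b * norm2 else 0))"
    unfolding sum_S_upper Z by (intro sum.cong refl) (simp add: S_sym[of _ a] mult.commute)
  also have "\<dots> = (\<Sum>k\<in>UNIV. S k k a) * Y b + (\<Sum>k\<in>UNIV. Y k * S k a b) - G a b * norm2"
    by (simp add: sum.distrib sum_subtractf sum_distrib_right)
  also have "\<dots> = real CARD('n) * Y a * Y b + (2 * Y a * Y b - G a b * norm2) - G a b * norm2"
    unfolding trace_S sum_S_upper norm2_def by (simp add: mult.commute)
  finally show ?thesis by (simp add: algebra_simps)
qed

text \<open>The products of two \<open>\<Gamma>\<close> cancel and six double sums remain. The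
  factor n - 2 arises as n against 2 in the traces of \<open>dS\<close>, and from the quadratic
  terms as 2n - (n + 2) for \<open>Y a * Y b\<close> and as n - 2 for the squared norm.\<close>

lemma ricci_difference:
  "(\<Sum>k\<in>UNIV. dS k k a b - dS a k k b
      + (\<Sum>m\<in>UNIV. (\<Gamma> k k m + S k k m) * (\<Gamma> m a b + S m a b)
          - (\<Gamma> k a m + S k a m) * (\<Gamma> m k b + S m k b))
      - (\<Sum>m\<in>UNIV. \<Gamma> k k m * \<Gamma> m a b - \<Gamma> k a m * \<Gamma> m k b)) =
    - (real CARD('n) - 2) * (hess a b - Y a * Y b) - (lap + (real CARD('n) - 2) * norm2) * G a b" (is "?L = _")
proof -
  have "?L = (\<Sum>k\<in>UNIV. dS k k a b) - (\<Sum>k\<in>UNIV. dS a k k b)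
      + (\<Sum>k\<in>UNIV. \<Sum>m\<in>UNIV. \<Gamma> k k m * S m a b) + (\<Sum>k\<in>UNIV. \<Sum>m\<in>UNIV. S k k m * \<Gamma> m a b)
      + (\<Sum>k\<in>UNIV. \<Sum>m\<in>UNIV. S k k m * S m a b)
      - (\<Sum>k\<in>UNIV. \<Sum>m\<in>UNIV. \<Gamma> k a m * S m k b) - (\<Sum>k\<in>UNIV. \<Sum>m\<in>UNIV. S k a m * \<Gamma> m k b)
      - (\<Sum>k\<in>UNIV. \<Sum>m\<in>UNIV. S k a m * S m k b)"
    unfolding sum.distrib[symmetric] sum_subtractf[symmetric]
    by (intro sum.cong refl) (simp add: sum.distrib sum_subtractf algebra_simps)
  also have "\<dots> = - (real CARD('n) - 2) * (hess a b - Y a * Y b) - (lap + (real CARD('n) - 2) * norm2) * G a b"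
    unfolding trace_dS_first trace_dS_second sum_\<Gamma>S sum_S\<Gamma> sum_SS sum_\<Gamma>S' sum_S\<Gamma>' sum_SS'
      sum_dG_Z hess_def lap_def sum.distrib
    by (simp add: algebra_simps)
  finally show ?thesis .
qed

text \<open>Metric compatibility makes lowering an index commute with covariant differentiation, so
  the Hessian is the lowered derivative of the gradient; \<open>HG\<close> inverts this.\<close>

lemma nabla_raise: "dZ l k + (\<Sum>m\<in>UNIV. \<Gamma> k l m * Z m) = (\<Sum>a\<in>UNIV. H k a * hess l a)"
proof -
  let ?n = "\<lambda>b. dZ l b + (\<Sum>m\<in>UNIV. \<Gamma> b l m * Z m)"
  have hess: "hess l a = (\<Sum>b\<in>UNIV. G a b * ?n b)" for a
  proof -
    have "(\<Sum>b\<in>UNIV. dG l a b * Z b) =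
        (\<Sum>b\<in>UNIV. \<Sum>k\<in>UNIV. \<Gamma> k l a * G k b * Z b) + (\<Sum>b\<in>UNIV. \<Sum>k\<in>UNIV. \<Gamma> k l b * G a k * Z b)"
      unfolding dG by (simp add: sum.distrib sum_distrib_right distrib_right)
    also have "\<dots> = (\<Sum>k\<in>UNIV. \<Sum>b\<in>UNIV. \<Gamma> k l a * G k b * Z b) + (\<Sum>k\<in>UNIV. \<Sum>b\<in>UNIV. \<Gamma> k l b * G a k * Z b)"
      by (intro arg_cong2[where f = "(+)"] sum.swap)
    also have "\<dots> = (\<Sum>k\<in>UNIV. \<Gamma> k l a * Y k) + (\<Sum>k\<in>UNIV. G a k * (\<Sum>b\<in>UNIV. \<Gamma> k l b * Z b))"
      unfolding GZ[symmetric] by (simp add: sum_distrib_left mult_ac)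
    finally show ?thesis
      using dGZ[of l a] by (simp add: hess_def sum.distrib distrib_left)
  qed
  have "(\<Sum>a\<in>UNIV. H k a * hess l a) = (\<Sum>a\<in>UNIV. \<Sum>b\<in>UNIV. H k a * G a b * ?n b)"
    by (simp only: hess sum_distrib_left mult.assoc)
  also have "\<dots> = (\<Sum>b\<in>UNIV. \<Sum>a\<in>UNIV. H k a * G a b * ?n b)" by (rule sum.swap)
  also have "\<dots> = (\<Sum>b\<in>UNIV. (if k = b then 1 else 0) * ?n b)"
    by (simp only: sum_distrib_right[symmetric] HG)
  also have "\<dots> = ?n k" by (simp add: if_distrib[of "\<lambda>x. x * _"] cong: if_cong)
  finally show ?thesis ..
qed

lemma hess_sym: "hess a b = hess b a"
  by (simp add: hess_def dY_sym[of a b] \<Gamma>_sym[of _ a b])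

end

section \<open>Conformal change of the Schouten tensor\<close>

context conformal_chart begin

definition Hess :: "'n \<Rightarrow> 'n \<Rightarrow> 'm \<Rightarrow> real" where
  "Hess a b q = pd a (Y b) q - (\<Sum>m\<in>UNIV. \<Gamma> m a b q * Y m q)"

definition nablaYu :: "'n \<Rightarrow> 'n \<Rightarrow> 'm \<Rightarrow> real" where
  "nablaYu a k q = pd a (Yu k) q + (\<Sum>m\<in>UNIV. \<Gamma> k a m q * Yu m q)"

definition Lap :: "'m \<Rightarrow> real" where "Lap q = (\<Sum>k\<in>UNIV. nablaYu k k q)"

definition Norm2 :: "'m \<Rightarrow> real" where "Norm2 q = (\<Sum>m\<in>UNIV. Y m q * Yu m q)"

lemma lower_Yu:
  assumes p: "p \<in> fst c" shows "(\<Sum>m\<in>UNIV. G a m p * Yu m p) = Y a p"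
proof -
  have "(\<Sum>m\<in>UNIV. G a m p * Yu m p) = (\<Sum>m\<in>UNIV. \<Sum>l\<in>UNIV. G a m p * H m l p * Y l p)"
    by (simp add: sum_distrib_left mult.assoc)
  also have "\<dots> = (\<Sum>l\<in>UNIV. \<Sum>m\<in>UNIV. G a m p * H m l p * Y l p)" by (rule sum.swap)
  also have "\<dots> = (\<Sum>l\<in>UNIV. (if a = l then 1 else 0) * Y l p)"
    by (simp only: sum_distrib_right[symmetric] GH[OF p])
  finally show ?thesis by (simp add: if_distrib[of "\<lambda>x. x * _"] cong: if_cong)
qed

lemma algebra:
  assumes p: "p \<in> fst c"
  shows "conformal_algebra (\<lambda>i j. G i j p) (\<lambda>i j. H i j p) (\<lambda>k i j. \<Gamma> k i j p) (\<lambda>i. Y i p) (\<lambda>k. Yu k p)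
    (\<lambda>l a. pd l (Y a) p) (\<lambda>l k. pd l (Yu k) p) (\<lambda>l i j. pd l (G i j) p)"
proof unfold_locales
  fix i j k a l
  show "G i j p = G j i p" by (rule G_sym[OF p])
  show "\<Gamma> k i j p = \<Gamma> k j i p" by (rule \<Gamma>_sym[OF p])
  show "pd i (Y j) p = pd j (Y i) p"
    by (rule coord_vec_commute[OF open_dom order_refl chart smooth_\<omega>_chart p])
  show "(\<Sum>l\<in>UNIV. H i l p * G l j p) = (if i = j then 1 else 0)" by (rule HG[OF p])
  show "(\<Sum>m\<in>UNIV. G a m p * Yu m p) = Y a p" by (rule lower_Yu[OF p])
  show "pd l (G i j) p = (\<Sum>k\<in>UNIV. \<Gamma> k l i p * G k j p + \<Gamma> k l j p * G i k p)"
    by (rule metric_compatible[OF p])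
  \<comment> \<open>The identity \<open>lower_Yu\<close> holds on the whole chart domain; its
    derivative is the hypothesis \<open>dGZ\<close> of the pointwise algebra.\<close>
  have "pd l (Y a) p = pd l (\<lambda>q. \<Sum>m\<in>UNIV. G a m q * Yu m q) p"
    by (rule pd_cong[OF p _ smooth_Y]) (simp add: lower_Yu)
  also have "\<dots> = (\<Sum>m\<in>UNIV. pd l (\<lambda>q. G a m q * Yu m q) p)"
    by (intro coord_vec_sum[OF open_dom p chart p] smooth_fun_mult open_dom smooth_G smooth_Yu)
  also have "\<dots> = (\<Sum>m\<in>UNIV. pd l (G a m) p * Yu m p + G a m p * pd l (Yu m) p)"
    by (simp only: coord_vec_mult[OF open_dom p chart p smooth_G smooth_Yu])
  finally show "(\<Sum>m\<in>UNIV. pd l (G a m) p * Yu m p + G a m p * pd l (Yu m) p) = pd l (Y a) p" ..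
qed

lemma Hess_sym: "p \<in> fst c \<Longrightarrow> Hess a b p = Hess b a p"
  using conformal_algebra.hess_sym[OF algebra, of p a b]
  by (simp add: Hess_def conformal_algebra.hess_def[OF algebra])

lemma nablaYu_eq: "p \<in> fst c \<Longrightarrow> nablaYu l k p = (\<Sum>a\<in>UNIV. H k a p * Hess l a p)"
  using conformal_algebra.nabla_raise[OF algebra, of p l k]
  by (simp add: Hess_def nablaYu_def conformal_algebra.hess_def[OF algebra])

lemma trace_Hess: "p \<in> fst c \<Longrightarrow> (\<Sum>a\<in>UNIV. \<Sum>b\<in>UNIV. H a b p * Hess a b p) = Lap p"
  by (simp add: Lap_def nablaYu_eq)

lemma pd_hat_\<Gamma>:
  assumes p: "p \<in> fst c"
  shows "pd l (hat.\<Gamma> k i j) p = pd l (\<Gamma> k i j) p +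
    ((if k = i then pd l (Y j) p else 0) + (if k = j then pd l (Y i) p else 0)
      - (pd l (G i j) p * Yu k p + G i j p * pd l (Yu k) p))"
proof -
  note rules = open_dom p chart p
  let ?d = "\<lambda>b i q. if b then Y i q else 0"
  have d: "smooth_fun A (fst c) (?d b i)" "pd l (?d b i) p = (if b then pd l (Y i) p else 0)" for b i
    by (cases b; simp add: smooth_Y smooth_fun_const)+
  note s = smooth_fun_mult[OF open_dom smooth_G smooth_Yu, of i j k]
  note s2 = smooth_fun_add[OF open_dom d(1) d(1), of "k = i" j "k = j" i]
  note s3 = smooth_fun_diff[OF open_dom s2 s]
  have "pd l (hat.\<Gamma> k i j) p =
      pd l (\<lambda>q. \<Gamma> k i j q + (?d (k = i) j q + ?d (k = j) i q - G i j q * Yu k q)) p"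
    by (rule pd_cong[OF p _ hat.smooth_christoffel]) (simp add: hat_\<Gamma>)
  also have "\<dots> = pd l (\<Gamma> k i j) p +
      (pd l (?d (k = i) j) p + pd l (?d (k = j) i) p - pd l (\<lambda>q. G i j q * Yu k q) p)"
    by (simp only: coord_vec_add[OF rules smooth_christoffel s3] coord_vec_diff[OF rules s2 s]
        coord_vec_add[OF rules d(1) d(1)])
  finally show ?thesis
    by (simp only: d(2) coord_vec_mult[OF rules smooth_G smooth_Yu])
qed

lemma hat_ricci:
  assumes p: "p \<in> fst c"
  shows "ricci A (rescale \<omega> g) c p a b = ricci A g c p a b
    - (real CARD('n) - 2) * (Hess a b p - Y a p * Y b p)
    - (Lap p + (real CARD('n) - 2) * Norm2 p) * G a b p"
proof -
  interpret alg: conformal_algebra "\<lambda>i j. G i j p" "\<lambda>i j. H i j p" "\<lambda>k i j. \<Gamma> k i j p" "\<lambda>i. Y i p"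
    "\<lambda>k. Yu k p" "\<lambda>l a. pd l (Y a) p" "\<lambda>l k. pd l (Yu k) p" "\<lambda>l i j. pd l (G i j) p"
    by (rule algebra[OF p])
  have \<Gamma>: "hat.\<Gamma> k i j p = \<Gamma> k i j p + alg.S k i j" for k i j
    by (simp only: hat_\<Gamma>[OF p] alg.S_def)
  have d\<Gamma>: "pd l (hat.\<Gamma> k i j) p = pd l (\<Gamma> k i j) p + alg.dS l k i j" for l k i j
    by (simp only: pd_hat_\<Gamma>[OF p] alg.dS_def)
  have "ricci A (rescale \<omega> g) c p a b - ricci A g c p a b =
     (\<Sum>k\<in>UNIV. alg.dS k k a b - alg.dS a k k b
      + (\<Sum>m\<in>UNIV. (\<Gamma> k k m p + alg.S k k m) * (\<Gamma> m a b p + alg.S m a b)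
          - (\<Gamma> k a m p + alg.S k a m) * (\<Gamma> m k b p + alg.S m k b))
      - (\<Sum>m\<in>UNIV. \<Gamma> k k m p * \<Gamma> m a b p - \<Gamma> k a m p * \<Gamma> m k b p))"
    unfolding ricci_def riemann_def \<Gamma> d\<Gamma> sum_subtractf[symmetric]
    by (intro sum.cong refl) simp
  also have "\<dots> = - (real CARD('n) - 2) * (Hess a b p - Y a p * Y b p)
    - (Lap p + (real CARD('n) - 2) * Norm2 p) * G a b p"
    unfolding alg.ricci_difference alg.lap_def alg.norm2_def alg.hess_def
      Lap_def Norm2_def Hess_def nablaYu_def by simp
  finally show ?thesis by (simp add: algebra_simps)
qed

lemma exp_cancel: "exp (- 2 * \<omega> p) * exp (2 * \<omega> p) = 1"
  by (simp add: exp_minus)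

text \<open>In the trace the Laplacian collects -(n - 2) - n and the squared norm (n - 2) - n(n -
  2).\<close>

lemma hat_scal:
  assumes p: "p \<in> fst c"
  shows "scal A (rescale \<omega> g) c p = exp (- 2 * \<omega> p) * (scal A g c p
    - 2 * (real CARD('n) - 1) * Lap p - (real CARD('n) - 1) * (real CARD('n) - 2) * Norm2 p)"
proof -
  let ?n = "real CARD('n)"
  have HG': "(\<Sum>a\<in>UNIV. \<Sum>b\<in>UNIV. H a b p * G a b p) = ?n"
  proof -
    have "(\<Sum>a\<in>UNIV. \<Sum>b\<in>UNIV. H a b p * G a b p) = (\<Sum>a\<in>UNIV. \<Sum>b\<in>UNIV. H a b p * G b a p)"
      by (intro sum.cong refl arg_cong2[where f = "(*)"] G_sym[OF p])
    then show ?thesis by (simp add: HG[OF p])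
  qed
  have YY: "(\<Sum>a\<in>UNIV. \<Sum>b\<in>UNIV. H a b p * (Y a p * Y b p)) = Norm2 p"
    unfolding Norm2_def by (simp add: sum_distrib_left mult_ac)
  have "scal A (rescale \<omega> g) c p = exp (- 2 * \<omega> p) * (\<Sum>a\<in>UNIV. \<Sum>b\<in>UNIV. H a b p * ricci A g c p a b
     - (?n - 2) * (H a b p * Hess a b p) + (?n - 2) * (H a b p * (Y a p * Y b p))
     - (Lap p + (?n - 2) * Norm2 p) * (H a b p * G a b p))"
    unfolding scal_def sum_distrib_left hat_H[OF p] hat_ricci[OF p]
    by (intro sum.cong refl) (simp add: algebra_simps)
  also have "\<dots> = exp (- 2 * \<omega> p) * (scal A g c p
     - (?n - 2) * Lap p + (?n - 2) * Norm2 p - (Lap p + (?n - 2) * Norm2 p) * ?n)"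
    by (simp only: sum.distrib sum_subtractf sum_distrib_left[symmetric] trace_Hess[OF p] YY HG' scal_def)
  finally show ?thesis by (simp add: algebra_simps)
qed

text \<open>The coefficient n/2 - 1 of the squared norm is the degree of the forms on which Q
  acts.\<close>

lemma hat_J:
  assumes p: "p \<in> fst c" and n: "CARD('n) \<ge> 2"
  shows "schouten_J A (rescale \<omega> g) c p =
    exp (- 2 * \<omega> p) * (schouten_J A g c p - Lap p - (real CARD('n) / 2 - 1) * Norm2 p)"
  using n unfolding schouten_J_def hat_scal[OF p] by (simp add: field_simps)

text \<open>The Laplacian in the Ricci change is cancelled by the one in J. Of the squared norm n/2
  - 1 copies remain, and division by n - 2 leaves the factor 1/2.\<close>

lemma hat_schouten:
  assumes p: "p \<in> fst c" and n: "CARD('n) \<ge> 3"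
  shows "schouten A (rescale \<omega> g) c p a b =
    schouten A g c p a b - Hess a b p + Y a p * Y b p - Norm2 p / 2 * G a b p"
proof -
  let ?n = "real CARD('n)"
  have n2: "?n - 2 \<noteq> 0" using n by simp
  have J: "schouten_J A (rescale \<omega> g) c p * hat.G a b p =
      (schouten_J A g c p - Lap p - (?n / 2 - 1) * Norm2 p) * G a b p"
    using exp_cancel[of p] n by (simp add: hat_J[OF p] hat_G mult_ac)
  show ?thesis
    unfolding schouten_def J hat_ricci[OF p] using n2
    by (simp add: field_simps)
qed

lemma hat_schouten_mixed:
  assumes p: "p \<in> fst c" and n: "CARD('n) \<ge> 3"
  shows "(\<Sum>a\<in>UNIV. schouten A (rescale \<omega> g) c p i a * hat.H a b p) =
    exp (- 2 * \<omega> p) * ((\<Sum>a\<in>UNIV. schouten A g c p i a * H a b p) - nablaYu i b p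
      + Y i p * Yu b p - Norm2 p / 2 * (if i = b then 1 else 0))"
proof -
  have "(\<Sum>a\<in>UNIV. schouten A (rescale \<omega> g) c p i a * hat.H a b p) =
    exp (- 2 * \<omega> p) * (\<Sum>a\<in>UNIV. schouten A g c p i a * H a b p - H b a p * Hess i a p
       + Y i p * (H b a p * Y a p) - Norm2 p / 2 * (G i a p * H a b p))"
    unfolding hat_schouten[OF p n] hat_H[OF p] sum_distrib_left H_sym[OF p, of b]
    by (intro sum.cong refl) (simp add: algebra_simps)
  also have "\<dots> = exp (- 2 * \<omega> p) * ((\<Sum>a\<in>UNIV. schouten A g c p i a * H a b p) - nablaYu i b p
      + Y i p * Yu b p - Norm2 p / 2 * (if i = b then 1 else 0))"
    by (simp only: sum.distrib sum_subtractf sum_distrib_left[symmetric] GH[OF p] nablaYu_eq[OF p])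
  finally show ?thesis .
qed

end

section \<open>Sections, connections and alternating components\<close>

locale bundle_connection = manifold A
  for A :: "('m::{t2_space, second_countable_topology}, 'n::finite) chart set" +
  fixes V :: "'m \<Rightarrow> 'v::real_vector set" and F :: "('m, 'v) frame set" and D :: "('m, 'v) connection"
  assumes vector_bundle: "vector_bundle A V F" and connection: "is_connection A V F D"
begin

lemma frame:
  assumes "(U, r, e) \<in> F"
  shows "open U" "p \<in> U \<Longrightarrow> independent (frame_basis r e p)" "p \<in> U \<Longrightarrow> span (frame_basis r e p) = V p"
  using vector_bundle assms unfolding vector_bundle_def by blast+

lemma subspace_fibre: "subspace (V p)"
proof -
  have "(\<Union>(U, r, e)\<in>F. U) = UNIV" using vector_bundle unfolding vector_bundle_def by blast
  then have "p \<in> (\<Union>(U, r, e)\<in>F. U)" by (simp only: UNIV_I)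
  then obtain U r e where "(U, r, e) \<in> F" "p \<in> U" by fast
  from frame(3)[OF this] show ?thesis by (metis subspace_span)
qed

lemma connection_laws:
  assumes "open W" "smooth_section A V F W s"
  shows "c \<in> A \<Longrightarrow> smooth_section A V F (W \<inter> fst c) (\<lambda>q. D s q (coord_vec A c i q))"
    and "smooth_section A V F W t \<Longrightarrow> p \<in> W \<Longrightarrow> v \<in> tangent_space A p \<Longrightarrow>
      D (\<lambda>q. s q + t q) p v = D s p v + D t p v"
    and "smooth_fun A W f \<Longrightarrow> p \<in> W \<Longrightarrow> v \<in> tangent_space A p \<Longrightarrow>
      D (\<lambda>q. f q *\<^sub>R s q) p v = v f *\<^sub>R s p + f p *\<^sub>R D s p v"
proof -
  note laws = connection[unfolded is_connection_def, THEN spec, THEN spec, THEN mp, OF conjI[OF assms],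
      THEN conjunct2, THEN conjunct2]
  show "c \<in> A \<Longrightarrow> smooth_section A V F (W \<inter> fst c) (\<lambda>q. D s q (coord_vec A c i q))"
    using laws[THEN conjunct1] by simp
  show "smooth_section A V F W t \<Longrightarrow> p \<in> W \<Longrightarrow> v \<in> tangent_space A p \<Longrightarrow>
      D (\<lambda>q. s q + t q) p v = D s p v + D t p v"
    using laws[THEN conjunct2, THEN conjunct1] by simp
  show "smooth_fun A W f \<Longrightarrow> p \<in> W \<Longrightarrow> v \<in> tangent_space A p \<Longrightarrow>
      D (\<lambda>q. f q *\<^sub>R s q) p v = v f *\<^sub>R s p + f p *\<^sub>R D s p v"
    using laws[THEN conjunct2, THEN conjunct2] by simp
qed

lemma section_in: "smooth_section A V F W s \<Longrightarrow> p \<in> W \<Longrightarrow> s p \<in> V p"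
  unfolding smooth_section_def by blast

lemma section_coefficient:
  "smooth_section A V F W s \<Longrightarrow> (U, r, e) \<in> F \<Longrightarrow> j < r \<Longrightarrow>
    smooth_fun A (W \<inter> U) (\<lambda>p. representation (frame_basis r e p) (s p) (e j p))"
  unfolding smooth_section_def by blast

lemma sectionI:
  assumes "\<And>p. p \<in> W \<Longrightarrow> s p \<in> V p"
    and "\<And>U r e j. (U, r, e) \<in> F \<Longrightarrow> j < r \<Longrightarrow>
      smooth_fun A (W \<inter> U) (\<lambda>p. representation (frame_basis r e p) (s p) (e j p))"
  shows "smooth_section A V F W s"
  using assms unfolding smooth_section_def by blast

section \<open>Sections over an open set and locality of the connection\<close>

context
  fixes W :: "'m set"
  assumes W: "open W"
begin

lemma open_frame_dom: "(U, r, e) \<in> F \<Longrightarrow> open (W \<inter> U)"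
  using W frame(1) by blast

lemma section_cong:
  assumes "\<And>q. q \<in> W \<Longrightarrow> s q = t q" "smooth_section A V F W s"
  shows "smooth_section A V F W t"
proof (rule sectionI)
  show "t p \<in> V p" if "p \<in> W" for p using assms section_in that by metis
  show "smooth_fun A (W \<inter> U) (\<lambda>p. representation (frame_basis r e p) (t p) (e j p))"
    if "(U, r, e) \<in> F" "j < r" for U r e j
    by (rule smooth_fun_cong[OF open_frame_dom[OF that(1)] _ section_coefficient[OF assms(2) that]])
      (simp add: assms(1))
qed

lemma section_add:
  assumes "smooth_section A V F W s" "smooth_section A V F W t"
  shows "smooth_section A V F W (\<lambda>q. s q + t q)"
proof (rule sectionI)
  show "s p + t p \<in> V p" if "p \<in> W" for p
    using subspace_add[OF subspace_fibre] assms section_in that by blast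
  show "smooth_fun A (W \<inter> U) (\<lambda>p. representation (frame_basis r e p) (s p + t p) (e j p))"
    if f: "(U, r, e) \<in> F" "j < r" for U r e j
  proof (rule smooth_fun_cong[OF open_frame_dom[OF f(1)] _
        smooth_fun_add[OF open_frame_dom[OF f(1)] section_coefficient[OF assms(1) f] section_coefficient[OF assms(2) f]]])
    fix q assume q: "q \<in> W \<inter> U"
    then have "s q \<in> span (frame_basis r e q)" "t q \<in> span (frame_basis r e q)"
      using frame(3)[OF f(1)] section_in assms by blast+
    then show "representation (frame_basis r e q) (s q) (e j q) + representation (frame_basis r e q) (t q) (e j q) =
        representation (frame_basis r e q) (s q + t q) (e j q)"
      using representation_add frame(2)[OF f(1)] q by (metis IntD2)
  qed
qed

lemma section_scale:
  assumes "smooth_fun A W f" "smooth_section A V F W s"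
  shows "smooth_section A V F W (\<lambda>q. f q *\<^sub>R s q)"
proof (rule sectionI)
  show "f p *\<^sub>R s p \<in> V p" if "p \<in> W" for p
    using subspace_scale[OF subspace_fibre] assms section_in that by blast
  show "smooth_fun A (W \<inter> U) (\<lambda>p. representation (frame_basis r e p) (f p *\<^sub>R s p) (e j p))"
    if f: "(U, r, e) \<in> F" "j < r" for U r e j
  proof (rule smooth_fun_cong[OF open_frame_dom[OF f(1)] _
        smooth_fun_mult[OF open_frame_dom[OF f(1)] smooth_fun_subset[OF assms(1)] section_coefficient[OF assms(2) f]]])
    fix q assume q: "q \<in> W \<inter> U"
    then have "s q \<in> span (frame_basis r e q)"
      using frame(3)[OF f(1)] section_in assms by blast
    then show "f q * representation (frame_basis r e q) (s q) (e j q) =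
        representation (frame_basis r e q) (f q *\<^sub>R s q) (e j q)"
      using representation_scale frame(2)[OF f(1)] q by (metis IntD2)
  qed simp
qed

lemma section_zero: "smooth_section A V F W (\<lambda>q. 0)"
  by (rule sectionI) (simp_all add: subspace_0[OF subspace_fibre] representation_zero smooth_fun_const)

lemma section_cscale: "smooth_section A V F W s \<Longrightarrow> smooth_section A V F W (\<lambda>q. a *\<^sub>R s q)"
  by (intro section_scale smooth_fun_const)

lemma section_minus: "smooth_section A V F W s \<Longrightarrow> smooth_section A V F W (\<lambda>q. - s q)"
  using section_cscale[of s "-1"] by simp

lemma section_diff:
  assumes "smooth_section A V F W s" "smooth_section A V F W t"
  shows "smooth_section A V F W (\<lambda>q. s q - t q)"
  using section_add[OF assms(1) section_minus[OF assms(2)]] by simp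

lemma section_sum:
  assumes "\<And>j. j \<in> J \<Longrightarrow> smooth_section A V F W (s j)"
  shows "smooth_section A V F W (\<lambda>q. \<Sum>j\<in>J. s j q)"
  using assms by (induction J rule: infinite_finite_induct) (auto intro: section_add section_zero)

lemma section_D:
  assumes "W \<subseteq> fst c" "c \<in> A" "smooth_section A V F W s"
  shows "smooth_section A V F W (\<lambda>q. D s q (coord_vec A c i q))"
proof -
  have "smooth_section A V F (W \<inter> fst c) (\<lambda>q. D s q (coord_vec A c i q))"
    using connection_laws(1)[OF W assms(3,2)] .
  then show ?thesis using assms(1) by (simp add: Int_absorb2)
qed

context
  fixes p v
  assumes p: "p \<in> W" and v: "v \<in> tangent_space A p"
begin

lemma D_add:
  assumes "smooth_section A V F W s" "smooth_section A V F W t"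
  shows "D (\<lambda>q. s q + t q) p v = D s p v + D t p v"
  using connection_laws(2)[OF W assms p v] .

lemma D_scale:
  assumes "smooth_fun A W f" "smooth_section A V F W s"
  shows "D (\<lambda>q. f q *\<^sub>R s q) p v = v f *\<^sub>R s p + f p *\<^sub>R D s p v"
  using connection_laws(3)[OF W assms(2,1) p v] .

lemma tangent_const: "v (\<lambda>_. a) = 0"
  using v unfolding tangent_space_def by auto

lemma D_cscale: "smooth_section A V F W s \<Longrightarrow> D (\<lambda>q. a *\<^sub>R s q) p v = a *\<^sub>R D s p v"
  using D_scale[OF smooth_fun_const] tangent_const by simp

(* A section z vanishing on W equals f z for a function f that is 0 on W and 1 elsewhere. *)
lemma D_vanishing:
  assumes "\<And>q. q \<in> W \<Longrightarrow> z q = 0" shows "D z p v = 0"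
proof -
  let ?f = "\<lambda>q. if q \<in> W then 0 else 1 :: real"
  have z: "smooth_section A V F W z"
    by (rule section_cong[OF _ section_zero]) (simp add: assms)
  have f: "smooth_fun A W ?f"
    by (rule smooth_fun_cong[OF W _ smooth_fun_const]) simp
  have "(\<lambda>q. ?f q *\<^sub>R z q) = z" using assms by auto
  then show ?thesis using D_scale[OF f z] assms[OF p] p by simp
qed

text \<open>Locality is derived from the connection laws: \<open>t\<close> is \<open>s\<close> plus
  a section that vanishes on \<open>W\<close>, and additivity reduces the claim to
  \<open>D_vanishing\<close>.\<close>

lemma D_cong:
  assumes "\<And>q. q \<in> W \<Longrightarrow> s q = t q" "smooth_section A V F W s"
  shows "D s p v = D t p v"
proof -
  let ?z = "\<lambda>q. t q - s q"
  have z: "smooth_section A V F W ?z"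
    by (rule section_cong[OF _ section_zero]) (simp add: assms)
  have "D (\<lambda>q. s q + ?z q) p v = D s p v + D ?z p v" using D_add assms(2) z by blast
  then show ?thesis using D_vanishing[of ?z] assms(1) by simp
qed

lemma D_minus: "smooth_section A V F W s \<Longrightarrow> D (\<lambda>q. - s q) p v = - D s p v"
  using D_cscale[of s "-1"] by simp

lemma D_diff:
  assumes "smooth_section A V F W s" "smooth_section A V F W t"
  shows "D (\<lambda>q. s q - t q) p v = D s p v - D t p v"
  using D_add[OF assms(1) section_minus[OF assms(2)]] D_minus[OF assms(2)] by simp

lemma D_sum:
  assumes "\<And>j. j \<in> J \<Longrightarrow> smooth_section A V F W (s j)"
  shows "D (\<lambda>q. \<Sum>j\<in>J. s j q) p v = (\<Sum>j\<in>J. D (s j) p v)"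
  using assms
proof (induction J rule: infinite_finite_induct)
  case (insert x J)
  then show ?case
    using D_add[of "s x" "\<lambda>q. \<Sum>j\<in>J. s j q"] section_sum[of J s] by simp
qed (simp_all add: D_vanishing)

end
end
end

text \<open>Stated as a sign under exchange of entries, the form used in index calculations;
  overwriting both slots leaves \<open>I\<close> an arbitrary list of the right length.\<close>

definition alternating :: "nat \<Rightarrow> ('n list \<Rightarrow> 'v::real_vector) \<Rightarrow> bool" where
  "alternating k u \<longleftrightarrow> (\<forall>I i j a b. length I = k \<longrightarrow> i < k \<longrightarrow> j < k \<longrightarrow> i \<noteq> j \<longrightarrow>
     u (I[i := a, j := b]) = - u (I[i := b, j := a]))"

lemma alternatingD:
  "alternating k u \<Longrightarrow> length I = k \<Longrightarrow> i < k \<Longrightarrow> j < k \<Longrightarrow> i \<noteq> j \<Longrightarrow>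
    u (I[i := a, j := b]) = - u (I[i := b, j := a])"
  unfolding alternating_def by blast

lemma alternating_Cons:
  assumes "alternating (Suc k) u" shows "alternating k (\<lambda>L. u (x # L))"
  unfolding alternating_def
proof (intro allI impI)
  fix I :: "'a list" and i j a b
  assume "length I = k" "i < k" "j < k" "i \<noteq> j"
  then show "u (x # I[i := a, j := b]) = - u (x # I[i := b, j := a])"
    using alternatingD[OF assms, of "x # I" "Suc i" "Suc j" a b] by simp
qed

lemma alternating_head:
  assumes "alternating (Suc k) u" "length I = k" "j < k"
  shows "u (a # I[j := b]) = - u (b # I[j := a])"
  using alternatingD[OF assms(1), of "x # I" 0 "Suc j" a b for x] assms by simp

text \<open>The entry at position \<open>j\<close> passes \<open>j\<close> others on its way to the
  front. This translates lists with an omitted index, as in \<open>ext_cov\<close>, into lists with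
  one replaced index.\<close>

lemma alternating_move:
  assumes "alternating k u" "length I = k" "j < k"
  shows "u (b # take j I @ drop (Suc j) I) = (-1) ^ j *\<^sub>R u (I[j := b])"
  using assms
proof (induction j arbitrary: k u I)
  case 0
  then show ?case by (cases I) auto
next
  case (Suc j)
  then obtain x I' k' where I: "I = x # I'" "k = Suc k'" "length I' = k'" "j < k'"
    by (cases I) auto
  have alt: "alternating (Suc k') u" using Suc.prems I by simp
  have "k' > 0" using I by simp
  then have "u (b # x # take j I' @ drop (Suc j) I') = - u (x # b # take j I' @ drop (Suc j) I')"
    using alternating_head[OF alt, of "b # take j I' @ drop (Suc j) I'" 0 b x] I by simp
  also have "u (x # b # take j I' @ drop (Suc j) I') = (-1) ^ j *\<^sub>R u (x # I'[j := b])"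
    using Suc.IH[OF alternating_Cons[OF alt] I(3,4)] .
  finally show ?case by (simp add: I)
qed

context manifold begin

lemma tangent_space_add:
  assumes c: "c \<in> A" "p \<in> fst c" and vw: "v \<in> tangent_space A p" "w \<in> tangent_space A p"
  shows "(\<lambda>f. v f + w f) \<in> tangent_space A p"
proof -
  obtain a b :: "real ^ 'n" where "v = (\<lambda>f. \<Sum>i\<in>UNIV. a $ i * coord_vec A c i p f)"
    "w = (\<lambda>f. \<Sum>i\<in>UNIV. b $ i * coord_vec A c i p f)"
    using vw unfolding tangent_space_eq[OF c] by blast
  then have "(\<lambda>f. v f + w f) = (\<lambda>f. \<Sum>i\<in>UNIV. (a + b) $ i * coord_vec A c i p f)"
    by (simp add: sum.distrib distrib_right)
  then show ?thesis unfolding tangent_space_eq[OF c] by blast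
qed

text \<open>Polarisation: \<open>vforms\<close> demands vanishing on equal arguments. Inserting the
  sum of two coordinate vectors into both slots and expanding gives the exchange sign.\<close>

lemma alternating_vforms:
  assumes \<kappa>: "\<kappa> \<in> vforms A V F k" and c: "c \<in> A" "p \<in> fst c"
  shows "alternating k (components A \<kappa> c p)"
  unfolding alternating_def
proof (intro allI impI)
  fix I :: "'n list" and i j a b
  assume *: "length I = k" "i < k" "j < k" "i \<noteq> j"
  let ?T = "tangent_space A p" and ?e = "\<lambda>i. coord_vec A c i p"
  let ?vs = "map ?e I"
  let ?B = "\<lambda>x y. \<kappa> p (?vs[i := x, j := y])"
  have alt: "\<kappa> p vs = 0" if "length vs = k" "set vs \<subseteq> ?T" "vs ! i = vs ! j" for vs
  proof -
    have "\<And>i j. i < j \<Longrightarrow> j < k \<Longrightarrow> vs ! i = vs ! j \<Longrightarrow> \<kappa> p vs = 0"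
      using \<kappa> that(1,2) unfolding vforms_def by blast
    then show ?thesis using * that(3) by (metis linorder_neqE_nat)
  qed
  have lin: "\<kappa> p (vs[l := (\<lambda>f. v f + w f)]) = \<kappa> p (vs[l := v]) + \<kappa> p (vs[l := w])"
    if "length vs = k" "set vs \<subseteq> ?T" "l < k" "v \<in> ?T" "w \<in> ?T" for vs l v w
  proof -
    have "\<kappa> p (vs[l := (\<lambda>f. s * v f + t * w f)]) = s *\<^sub>R \<kappa> p (vs[l := v]) + t *\<^sub>R \<kappa> p (vs[l := w])" for s t
      using \<kappa> that unfolding vforms_def by blast
    from this[of 1 1] show ?thesis by simp
  qed
  have upd: "set (vs[l := x]) \<subseteq> ?T" if "set vs \<subseteq> ?T" "x \<in> ?T" for vs l x
    using set_update_subset_insert[of vs l x] that by blast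
  have vs: "length ?vs = k" "set ?vs \<subseteq> ?T" using * coord_vec_tangent[OF c] by auto
  have e: "?e a \<in> ?T" "?e b \<in> ?T" using coord_vec_tangent[OF c] by auto
  let ?s = "\<lambda>f. ?e a f + ?e b f"
  have s: "?s \<in> ?T" using tangent_space_add[OF c e] .
  have B0: "?B x x = 0" if "x \<in> ?T" for x
  proof (rule alt)
    show "set (?vs[i := x, j := x]) \<subseteq> ?T" using upd[OF upd[OF vs(2) that] that] .
    show "?vs[i := x, j := x] ! i = ?vs[i := x, j := x] ! j"
      using * by (simp add: nth_list_update)
  qed (simp add: *)
  have right: "?B x ?s = ?B x (?e a) + ?B x (?e b)" if "x \<in> ?T" for x
    by (rule lin[OF _ upd[OF vs(2) that] *(3) e]) (simp add: *)
  have "?B ?s y = ?B (?e a) y + ?B (?e b) y" if "y \<in> ?T" for y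
    unfolding list_update_swap[OF \<open>i \<noteq> j\<close>]
    by (rule lin[OF _ upd[OF vs(2) that] *(2) e]) (simp add: *)
  from this[OF s] have "?B (?e a) (?e b) + ?B (?e b) (?e a) = 0"
    using B0[OF s] B0[OF e(1)] B0[OF e(2)] right[OF e(1)] right[OF e(2)] by simp
  then show "components A \<kappa> c p (I[i := a, j := b]) = - components A \<kappa> c p (I[i := b, j := a])"
    by (simp add: components_def map_update eq_neg_iff_add_eq_0)
qed

end

section \<open>The coderivative under conformal change\<close>

context metric_chart begin

lemma contract_GH:
  fixes f :: "'n \<Rightarrow> 'v::real_vector"
  assumes p: "p \<in> fst c"
  shows "(\<Sum>a\<in>UNIV. \<Sum>b\<in>UNIV. H a b p *\<^sub>R G a e p *\<^sub>R f b) = f e"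
proof -
  have "(\<Sum>a\<in>UNIV. \<Sum>b\<in>UNIV. H a b p *\<^sub>R G a e p *\<^sub>R f b) =
      (\<Sum>b\<in>UNIV. \<Sum>a\<in>UNIV. H a b p *\<^sub>R G a e p *\<^sub>R f b)"
    by (rule sum.swap)
  also have "\<dots> = (\<Sum>b\<in>UNIV. (\<Sum>a\<in>UNIV. H b a p * G a e p) *\<^sub>R f b)"
    by (simp add: scaleR_sum_left H_sym[OF p])
  also have "\<dots> = f e"
    by (simp add: HG[OF p] if_distrib[of "\<lambda>x. x *\<^sub>R _"] cong: if_cong)
  finally show ?thesis .
qed

lemma contract_GH_dim:
  fixes x :: "'v::real_vector"
  assumes p: "p \<in> fst c"
  shows "(\<Sum>a\<in>UNIV. \<Sum>b\<in>UNIV. H a b p *\<^sub>R G a b p *\<^sub>R x) = real CARD('n) *\<^sub>R x"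
proof -
  have "(\<Sum>a\<in>UNIV. \<Sum>b\<in>UNIV. H a b p *\<^sub>R G a b p *\<^sub>R x) =
      (\<Sum>a\<in>UNIV. (\<Sum>b\<in>UNIV. H a b p * G b a p) *\<^sub>R x)"
    unfolding scaleR_sum_left by (intro sum.cong refl) (simp add: G_sym[OF p])
  also have "\<dots> = real CARD('n) *\<^sub>R x"
    by (simp only: HG[OF p]) (simp add: sum_constant_scaleR)
  finally show ?thesis .
qed

lemma contract_skew:
  fixes f :: "'n \<Rightarrow> 'n \<Rightarrow> 'v::real_vector"
  assumes p: "p \<in> fst c" and skew: "\<And>a b. f a b = - f b a"
  shows "(\<Sum>a\<in>UNIV. \<Sum>b\<in>UNIV. H a b p *\<^sub>R f a b) = 0"
proof -
  have "(\<Sum>a\<in>UNIV. \<Sum>b\<in>UNIV. H a b p *\<^sub>R f a b) = (\<Sum>b\<in>UNIV. \<Sum>a\<in>UNIV. H a b p *\<^sub>R f a b)"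
    by (rule sum.swap)
  also have "\<dots> = (\<Sum>b\<in>UNIV. \<Sum>a\<in>UNIV. - (H b a p *\<^sub>R f b a))"
    using skew by (intro sum.cong refl) (metis H_sym[OF p] scaleR_minus_right)
  also have "\<dots> = - (\<Sum>a\<in>UNIV. \<Sum>b\<in>UNIV. H a b p *\<^sub>R f a b)"
    by (simp add: sum_negf)
  finally have "(2::real) *\<^sub>R (\<Sum>a\<in>UNIV. \<Sum>b\<in>UNIV. H a b p *\<^sub>R f a b) = 0"
    unfolding scaleR_2 by (simp only: eq_neg_iff_add_eq_0)
  then show ?thesis by simp
qed

end

context conformal_chart begin

lemma contract_Y_right:
  fixes f :: "'n \<Rightarrow> 'v::real_vector"
  shows "(\<Sum>a\<in>UNIV. \<Sum>b\<in>UNIV. H a b p *\<^sub>R Y b p *\<^sub>R f a) = (\<Sum>a\<in>UNIV. Yu a p *\<^sub>R f a)"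
  by (simp add: scaleR_sum_left)

lemma contract_Y_left:
  fixes f :: "'n \<Rightarrow> 'v::real_vector"
  assumes p: "p \<in> fst c"
  shows "(\<Sum>a\<in>UNIV. \<Sum>b\<in>UNIV. H a b p *\<^sub>R Y a p *\<^sub>R f b) = (\<Sum>b\<in>UNIV. Yu b p *\<^sub>R f b)"
proof -
  have "(\<Sum>a\<in>UNIV. \<Sum>b\<in>UNIV. H a b p *\<^sub>R Y a p *\<^sub>R f b) = (\<Sum>b\<in>UNIV. \<Sum>a\<in>UNIV. H a b p *\<^sub>R Y a p *\<^sub>R f b)"
    by (rule sum.swap)
  also have "\<dots> = (\<Sum>b\<in>UNIV. \<Sum>a\<in>UNIV. H b a p *\<^sub>R Y a p *\<^sub>R f b)"
    by (intro sum.cong refl) (simp add: H_sym[OF p])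
  finally show ?thesis by (simp only: contract_Y_right)
qed

lemma contract_hat_\<Gamma>:
  fixes f :: "'n \<Rightarrow> 'v::real_vector"
  assumes p: "p \<in> fst c"
  shows "(\<Sum>m\<in>UNIV. hat.\<Gamma> m a e p *\<^sub>R f m) = (\<Sum>m\<in>UNIV. \<Gamma> m a e p *\<^sub>R f m) +
    (Y e p *\<^sub>R f a + Y a p *\<^sub>R f e - G a e p *\<^sub>R (\<Sum>m\<in>UNIV. Yu m p *\<^sub>R f m))"
proof -
  have "hat.\<Gamma> m a e p *\<^sub>R f m = \<Gamma> m a e p *\<^sub>R f m + ((if m = a then Y e p *\<^sub>R f m else 0)
      + (if m = e then Y a p *\<^sub>R f m else 0) - G a e p *\<^sub>R Yu m p *\<^sub>R f m)" for m
    unfolding hat_\<Gamma>[OF p] by (simp add: algebra_simps)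
  then show ?thesis
    by (simp only: sum.distrib sum_subtractf scaleR_sum_right sum.delta finite) simp
qed

text \<open>The first slot contributes 2 - n and each of the \<open>k\<close> others contributes 2.
  Skewness is assumed only between the first slot and another one, so the lemma covers
  \<open>\<kappa>\<close> as well as the derivative of \<open>\<omega>\<kappa>\<close>, where
  \<open>wedge_skew\<close> supplies just this.\<close>

lemma codiff_rescale:
  fixes D :: "('m, 'v::real_vector) connection" and u :: "('m, 'n, 'v) comps"
  assumes p: "p \<in> fst c" and I: "length I = k"
    and skew: "\<And>j a b. j < k \<Longrightarrow> u c p (a # I[j := b]) = - u c p (b # I[j := a])"
  shows "codiff A D (rescale \<omega> g) u c p I = exp (- 2 * \<omega> p) *\<^sub>R
    (codiff A D g u c p I + (2 * (real k + 1) - real CARD('n)) *\<^sub>R (\<Sum>m\<in>UNIV. Yu m p *\<^sub>R u c p (m # I)))"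
proof -
  let ?X = "\<Sum>m\<in>UNIV. Yu m p *\<^sub>R u c p (m # I)"
  let ?H = "\<lambda>f. \<Sum>a\<in>UNIV. \<Sum>b\<in>UNIV. H a b p *\<^sub>R f a b"
  let ?s = "\<lambda>a b. Y b p *\<^sub>R u c p (a # I) + Y a p *\<^sub>R u c p (b # I) - G a b p *\<^sub>R ?X"
  let ?t = "\<lambda>j a b. Y (I ! j) p *\<^sub>R u c p (b # I[j := a]) + Y a p *\<^sub>R u c p (b # I)
      - G a (I ! j) p *\<^sub>R (\<Sum>m\<in>UNIV. Yu m p *\<^sub>R u c p (b # I[j := m]))"
  have nab: "nabla A D (rescale \<omega> g) u a c p (b # I) =
      nabla A D g u a c p (b # I) - ?s a b - (\<Sum>j<k. ?t j a b)" for a b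
  proof -
    have id: "u c p (b # I[j := I ! j]) = u c p (b # I)" for j by simp
    show ?thesis
      unfolding nabla_def contract_hat_\<Gamma>[OF p]
      by (simp only: length_Cons I sum.lessThan_Suc_shift nth_Cons_0 nth_Cons_Suc list_update.simps
          nat.case sum.distrib sum_subtractf id) (simp add: algebra_simps)
  qed
  have "codiff A D (rescale \<omega> g) u c p I =
      exp (- 2 * \<omega> p) *\<^sub>R - ?H (\<lambda>a b. nabla A D g u a c p (b # I) - ?s a b - (\<Sum>j<k. ?t j a b))"
    unfolding codiff_def nab hat_H[OF p]
    by (simp only: scaleR_scaleR[symmetric] scaleR_sum_right[symmetric] scaleR_minus_right)
  also have "?H (\<lambda>a b. nabla A D g u a c p (b # I) - ?s a b - (\<Sum>j<k. ?t j a b)) =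
      ?H (\<lambda>a b. nabla A D g u a c p (b # I)) - ?H ?s - ?H (\<lambda>a b. \<Sum>j<k. ?t j a b)"
    by (simp only: scaleR_diff_right sum_subtractf)
  also have "?H ?s = ?X + ?X - real CARD('n) *\<^sub>R ?X"
    by (simp only: scaleR_diff_right scaleR_add_right sum_subtractf sum.distrib
        contract_Y_right contract_Y_left[OF p] contract_GH_dim[OF p])
  also have "?H (\<lambda>a b. \<Sum>j<k. ?t j a b) = (\<Sum>j<k. ?H (?t j))"
  proof -
    have "?H (\<lambda>a b. \<Sum>j<k. ?t j a b) = (\<Sum>a\<in>UNIV. \<Sum>b\<in>UNIV. \<Sum>j<k. H a b p *\<^sub>R ?t j a b)"
      by (simp only: scaleR_sum_right)
    also have "\<dots> = (\<Sum>a\<in>UNIV. \<Sum>j<k. \<Sum>b\<in>UNIV. H a b p *\<^sub>R ?t j a b)"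
      by (rule sum.cong[OF refl]) (rule sum.swap)
    also have "\<dots> = (\<Sum>j<k. ?H (?t j))" by (rule sum.swap)
    finally show ?thesis .
  qed
  also have "(\<Sum>j<k. ?H (?t j)) = (\<Sum>j<k. ?X + ?X)"
  proof (rule sum.cong[OF refl])
    fix j assume "j \<in> {..<k}"
    then have j: "j < k" by simp
    \<comment> \<open>In a further slot the first term is skew and traces to zero, the second gives
      \<open>?X\<close>, and the metric term gives another \<open>?X\<close> by skewness.\<close>
    have "?H (\<lambda>a b. Y (I ! j) p *\<^sub>R u c p (b # I[j := a])) = 0"
      by (rule contract_skew[OF p]) (metis skew[OF j] scaleR_minus_right)
    moreover have "?H (\<lambda>a b. G a (I ! j) p *\<^sub>R (\<Sum>m\<in>UNIV. Yu m p *\<^sub>R u c p (b # I[j := m]))) = - ?X"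
      unfolding contract_GH[OF p] skew[OF j, of "I ! j"] by (simp add: sum_negf)
    ultimately show "?H (?t j) = ?X + ?X"
      by (simp only: scaleR_diff_right scaleR_add_right sum_subtractf sum.distrib contract_Y_left[OF p]) simp
  qed
  finally show ?thesis
    unfolding codiff_def
    by (simp add: algebra_simps scaleR_2[symmetric] sum_constant_scaleR)
qed

end

section \<open>Exterior derivative and coderivative on components in one chart\<close>

locale bundle_chart = metric_chart A g c + bundle_connection A V F D
  for A :: "('m::{t2_space, second_countable_topology}, 'n::finite) chart set" and g c
    and V :: "'m \<Rightarrow> 'v::real_vector set" and F D
begin

text \<open>What a single chart sees of a form. It can be checked directly for components obtained
  by a formula, such as those of \<omega> times \<open>\<kappa>\<close>.\<close>

definition local_form :: "nat \<Rightarrow> ('m \<Rightarrow> 'n list \<Rightarrow> 'v) \<Rightarrow> bool" where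
  "local_form k u \<longleftrightarrow> (\<forall>q\<in>fst c. alternating k (u q)) \<and>
    (\<forall>I. length I = k \<longrightarrow> smooth_section A V F (fst c) (\<lambda>q. u q I))"

abbreviation Dc :: "'n \<Rightarrow> ('m \<Rightarrow> 'v) \<Rightarrow> 'm \<Rightarrow> 'v" where "Dc a s q \<equiv> D s q (coord_vec A c a q)"

lemmas Dc_cong = D_cong[OF open_dom _ tangent]
lemmas Dc_diff = D_diff[OF open_dom _ tangent]
lemmas Dc_scale = D_scale[OF open_dom _ tangent]
lemmas Dc_cscale = D_cscale[OF open_dom _ tangent]
lemmas Dc_minus = D_minus[OF open_dom _ tangent]
lemmas Dc_sum = D_sum[OF open_dom _ tangent]
lemmas Dc_smooth = section_D[OF open_dom order_refl chart]

lemma form_alt: "local_form k u \<Longrightarrow> q \<in> fst c \<Longrightarrow> alternating k (u q)"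
  by (simp add: local_form_def)

lemma form_smooth: "local_form k u \<Longrightarrow> length I = k \<Longrightarrow> smooth_section A V F (fst c) (\<lambda>q. u q I)"
  by (simp add: local_form_def)

text \<open>The sign (-1)^(j+1) of the exterior derivative and the sign (-1)^j of
  \<open>alternating_move\<close> multiply to -1 for every \<open>j\<close>.\<close>

lemma ext_cov_Cons:
  assumes p: "p \<in> fst c" and u: "local_form k (u c)" and I: "length I = k"
  shows "ext_cov A D u c p (b # I) = Dc b (\<lambda>q. u c q I) p
    - (\<Sum>j<k. Dc (I ! j) (\<lambda>q. u c q (I[j := b])) p)"
proof -
  have sq: "(-1 :: real) ^ j * (-1) ^ j = 1" for j
    by (simp flip: power_mult_distrib)
  have *: "(-1) ^ Suc j *\<^sub>R Dc (I ! j) (\<lambda>q. u c q (b # take j I @ drop (Suc j) I)) p =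
      - Dc (I ! j) (\<lambda>q. u c q (I[j := b])) p" if j: "j < k" for j
  proof -
    have sm: "smooth_section A V F (fst c) (\<lambda>q. u c q (I[j := b]))"
      by (rule form_smooth[OF u]) (simp add: I)
    have "Dc (I ! j) (\<lambda>q. (-1) ^ j *\<^sub>R u c q (I[j := b])) p =
        Dc (I ! j) (\<lambda>q. u c q (b # take j I @ drop (Suc j) I)) p"
      by (rule Dc_cong[OF p p _ section_cscale[OF open_dom sm]])
        (simp add: alternating_move[OF form_alt[OF u] I j])
    then have "(-1) ^ Suc j *\<^sub>R Dc (I ! j) (\<lambda>q. u c q (b # take j I @ drop (Suc j) I)) p =
        (-1) ^ Suc j *\<^sub>R (-1) ^ j *\<^sub>R Dc (I ! j) (\<lambda>q. u c q (I[j := b])) p"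
      by (simp only: Dc_cscale[OF p p sm])
    then show ?thesis by (simp add: sq)
  qed
  have "(\<Sum>j<k. (-1) ^ Suc j *\<^sub>R Dc (I ! j) (\<lambda>q. u c q (b # take j I @ drop (Suc j) I)) p) =
      - (\<Sum>j<k. Dc (I ! j) (\<lambda>q. u c q (I[j := b])) p)"
    unfolding sum_negf[symmetric] by (rule sum.cong[OF refl], rule *) simp
  then show ?thesis
    unfolding ext_cov_def length_Cons I sum.lessThan_Suc_shift
    by (simp only: nth_Cons_0 nth_Cons_Suc take_Suc_Cons drop_Suc_Cons append_Cons) simp
qed

text \<open>Exchanging entries \<open>i\<close> and \<open>j\<close> exchanges the Christoffel
  corrections of these two slots; every other correction changes sign by itself.\<close>

lemma nabla_alternating:
  assumes p: "p \<in> fst c" and u: "local_form k (u c)"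
  shows "alternating k (nabla A D g u a c p)"
  unfolding alternating_def
proof (intro allI impI)
  fix I :: "'n list" and i j x y
  assume I: "length I = k" and ij: "i < k" "j < k" "i \<noteq> j"
  let ?t = "\<lambda>L l. \<Sum>m\<in>UNIV. \<Gamma> m a (L ! l) p *\<^sub>R u c p (L[l := m])"
  have alt: "u c p (L[i := x, j := y]) = - u c p (L[i := y, j := x])" if "length L = k" for L x y
    using alternatingD[OF form_alt[OF u p] that ij] .
  have split: "sum f {..<k} = f i + (f j + sum f ({..<k} - {i} - {j}))" for f :: "nat \<Rightarrow> 'v"
    using ij by (simp add: sum.remove)
  have ti: "?t (I[i := x, j := y]) i = - ?t (I[i := y, j := x]) j" for x y
    unfolding sum_negf[symmetric]
  proof (rule sum.cong[OF refl])
    fix m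
    have "I[i := x, j := y, i := m] = I[i := m, j := y]"
      using list_update_swap[OF ij(3), of "I[i := x]" m y] by simp
    then show "\<Gamma> m a (I[i := x, j := y] ! i) p *\<^sub>R u c p (I[i := x, j := y, i := m]) =
        - (\<Gamma> m a (I[i := y, j := x] ! j) p *\<^sub>R u c p (I[i := y, j := x, j := m]))"
      using alt[OF I, of m y] ij I by simp
  qed
  have tl: "?t (I[i := x, j := y]) l = - ?t (I[i := y, j := x]) l" if l: "l \<in> {..<k} - {i} - {j}" for l
    unfolding sum_negf[symmetric]
  proof (rule sum.cong[OF refl])
    fix m
    have "I[i := x, j := y, l := m] = I[l := m, i := x, j := y]" for x y
      using l list_update_swap[of j l "I[i := x]" y m] list_update_swap[of i l I x m] by simp
    then show "\<Gamma> m a (I[i := x, j := y] ! l) p *\<^sub>R u c p (I[i := x, j := y, l := m]) =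
        - (\<Gamma> m a (I[i := y, j := x] ! l) p *\<^sub>R u c p (I[i := y, j := x, l := m]))"
      using l alt[of "I[l := m]" x y] I by simp
  qed
  have "sum (?t (I[i := x, j := y])) {..<k} = - sum (?t (I[i := y, j := x])) {..<k}"
  proof -
    have "sum (?t (I[i := x, j := y])) ({..<k} - {i} - {j}) = - sum (?t (I[i := y, j := x])) ({..<k} - {i} - {j})"
      by (rule trans[OF sum.cong[OF refl tl] sum_negf])
    moreover have "?t (I[i := x, j := y]) j = - ?t (I[i := y, j := x]) i"
      by (simp only: ti[of y x] minus_minus)
    ultimately show ?thesis unfolding split by (simp only: ti[of x y]) simp
  qed
  moreover have "Dc a (\<lambda>q. u c q (I[i := x, j := y])) p = - Dc a (\<lambda>q. u c q (I[i := y, j := x])) p"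
  proof -
    have sm: "smooth_section A V F (fst c) (\<lambda>q. u c q (I[i := y, j := x]))"
      by (rule form_smooth[OF u]) (simp add: I)
    have "Dc a (\<lambda>q. - u c q (I[i := y, j := x])) p = Dc a (\<lambda>q. u c q (I[i := x, j := y])) p"
      by (rule Dc_cong[OF p p _ section_minus[OF open_dom sm]])
        (metis alternatingD[OF form_alt[OF u] I ij])
    then show ?thesis by (simp add: Dc_minus[OF p p sm])
  qed
  ultimately show "nabla A D g u a c p (I[i := x, j := y]) = - nabla A D g u a c p (I[i := y, j := x])"
    unfolding nabla_def by (simp add: I)
qed

text \<open>The contracted index returns to the gap at position \<open>j\<close>, which absorbs the
  sign of the exterior derivative.\<close>

lemma codiff_move:
  assumes p: "p \<in> fst c" and u: "local_form k (u c)" and I: "length I = k" and j: "j < k"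
  shows "(-1) ^ j *\<^sub>R codiff A D g u c p (take j I @ drop (Suc j) I) =
    - (\<Sum>a\<in>UNIV. \<Sum>b\<in>UNIV. H a b p *\<^sub>R nabla A D g u a c p (I[j := b]))"
proof -
  have sq: "(-1 :: real) ^ j * (-1) ^ j = 1"
    by (simp flip: power_mult_distrib)
  have "(-1) ^ j *\<^sub>R r *\<^sub>R (-1) ^ j *\<^sub>R x = r *\<^sub>R x" for r :: real and x :: 'v
    using sq by (metis mult.left_commute mult.right_neutral scaleR_scaleR)
  then show ?thesis
    unfolding codiff_def alternating_move[OF nabla_alternating[where u = u, OF p u] I j]
    by (simp only: scaleR_minus_right scaleR_sum_right)
qed

lemma codiff_smooth:
  assumes u: "local_form (Suc k) (u c)" and I: "length I = k"
  shows "smooth_section A V F (fst c) (\<lambda>q. codiff A D g u c q I)"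
  unfolding codiff_def nabla_def
  by (intro section_minus section_sum section_scale section_diff open_dom Dc_smooth
      smooth_H smooth_christoffel form_smooth[OF u]) (simp_all add: I split: nat.split)

end

section \<open>The wedge product with the gradient\<close>

lemma sum_swap3: "(\<Sum>a\<in>A. \<Sum>b\<in>B. \<Sum>j\<in>J. f a b j) = (\<Sum>j\<in>J. \<Sum>a\<in>A. \<Sum>b\<in>B. f a b j)"
proof -
  have "(\<Sum>a\<in>A. \<Sum>b\<in>B. \<Sum>j\<in>J. f a b j) = (\<Sum>a\<in>A. \<Sum>j\<in>J. \<Sum>b\<in>B. f a b j)"
    by (rule sum.cong[OF refl]) (rule sum.swap)
  also have "\<dots> = (\<Sum>j\<in>J. \<Sum>a\<in>A. \<Sum>b\<in>B. f a b j)" by (rule sum.swap)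
  finally show ?thesis .
qed

text \<open>Serves to match, in the Leibniz rule for the wedge product, corrections in which two
  different slots have interchanged roles.\<close>

lemma sum_off_diagonal_swap:
  fixes f :: "nat \<Rightarrow> nat \<Rightarrow> 'v::real_vector"
  shows "(\<Sum>j<k. \<Sum>i\<in>{..<k} - {j}. f j i) = (\<Sum>j<k. \<Sum>i\<in>{..<k} - {j}. f i j)"
proof -
  have *: "(\<Sum>i\<in>{..<k} - {j}. g i) = (\<Sum>i<k. if i = j then 0 else g i)" for g :: "nat \<Rightarrow> 'v" and j
    by (rule sum.mono_neutral_cong_left) auto
  have "(\<Sum>j<k. \<Sum>i<k. if i = j then 0 else f j i) = (\<Sum>i<k. \<Sum>j<k. if i = j then 0 else f j i)"
    by (rule sum.swap)
  then show ?thesis unfolding * by (simp add: eq_commute)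
qed

locale closed_form_chart = conformal_chart A g c \<omega> + bundle_chart A g c V F D
  for A :: "('m::{t2_space, second_countable_topology}, 'n::finite) chart set" and g c \<omega>
    and V :: "'m \<Rightarrow> 'v::real_vector set" and F D +
  fixes \<kappa> :: "('m, 'v) vform" and k :: nat
  assumes closed: "\<kappa> \<in> closed_vforms A V F D k"
begin

abbreviation \<kappa>c :: "('m, 'n, 'v) comps" where "\<kappa>c \<equiv> components A \<kappa>"
abbreviation K :: "'m \<Rightarrow> 'n list \<Rightarrow> 'v" where "K \<equiv> \<kappa>c c"

abbreviation \<omega>\<kappa> :: "('m, 'n, 'v) comps" where
  "\<omega>\<kappa> \<equiv> components A (\<lambda>q vs. \<omega> q *\<^sub>R \<kappa> q vs)"

lemma K_form: "local_form k K"
proof -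
  have \<kappa>: "\<kappa> \<in> vforms A V F k" using closed by (simp add: closed_vforms_def)
  have "smooth_section A V F (fst c) (\<lambda>q. K q I)" if "length I = k" for I
  proof -
    have "\<forall>c\<in>A. \<forall>I :: 'n list. length I = k \<longrightarrow>
       smooth_section A V F (fst c) (\<lambda>q. \<kappa> q (map (\<lambda>i. coord_vec A c i q) I))"
      using \<kappa> unfolding vforms_def mem_Collect_eq by (rule conjunct2)
    then show ?thesis using chart that unfolding components_def by blast
  qed
  then show ?thesis
    using alternating_vforms[OF \<kappa> chart] unfolding local_form_def by blast
qed

lemma K_smooth: "length I = k \<Longrightarrow> smooth_section A V F (fst c) (\<lambda>q. K q I)"
  using form_smooth[OF K_form] .

lemma K_alt: "q \<in> fst c \<Longrightarrow> alternating k (K q)"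
  using form_alt[OF K_form] .

text \<open>Closedness in its working form. It removes \<omega> times the derivative of
  \<open>\<kappa>\<close> in \<open>ext_cov_\<omega>\<kappa>\<close> and produces the Lie derivative
  in \<open>ext_cov_hat_codiff\<close>.\<close>

lemma sum_D_K:
  assumes p: "p \<in> fst c" and I: "length I = k"
  shows "(\<Sum>j<k. Dc (I ! j) (\<lambda>q. K q (I[j := b])) p) = Dc b (\<lambda>q. K q I) p"
proof -
  have "ext_cov A D \<kappa>c c p (b # I) = 0"
    using closed chart p I by (simp add: closed_vforms_def)
  then show ?thesis using ext_cov_Cons[where u = \<kappa>c, OF p K_form I, of b] by simp
qed

lemma \<omega>\<kappa>_eq: "\<omega>\<kappa> c q I = \<omega> q *\<^sub>R K q I"
  by (simp add: components_def)

lemma \<omega>\<kappa>_form: "local_form k (\<omega>\<kappa> c)"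
  unfolding local_form_def
proof (intro conjI ballI allI impI)
  show "alternating k (\<omega>\<kappa> c q)" if "q \<in> fst c" for q
    using alternatingD[OF K_alt[OF that]] unfolding alternating_def \<omega>\<kappa>_eq by (metis scaleR_minus_right)
  show "smooth_section A V F (fst c) (\<lambda>q. \<omega>\<kappa> c q I)" if "length I = k" for I
    unfolding \<omega>\<kappa>_eq by (rule section_scale[OF open_dom smooth_\<omega>_chart K_smooth[OF that]])
qed

text \<open>The component of d\<omega> wedge \<open>\<kappa>\<close> with first index
  \<open>b\<close> kept apart, ready for contraction by the coderivative.\<close>

definition wedge :: "'m \<Rightarrow> 'n \<Rightarrow> 'n list \<Rightarrow> 'v" where
  "wedge q b I = Y b q *\<^sub>R K q I - (\<Sum>j<k. Y (I ! j) q *\<^sub>R K q (I[j := b]))"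

lemma ext_cov_\<omega>\<kappa>:
  assumes p: "p \<in> fst c" and I: "length I = k"
  shows "ext_cov A D \<omega>\<kappa> c p (b # I) = wedge p b I"
proof -
  have D: "Dc a (\<lambda>q. \<omega>\<kappa> c q L) p = Y a p *\<^sub>R K p L + \<omega> p *\<^sub>R Dc a (\<lambda>q. K q L) p"
    if "length L = k" for a L
    unfolding \<omega>\<kappa>_eq using Dc_scale[OF p p smooth_\<omega>_chart K_smooth[OF that]] .
  have "ext_cov A D \<omega>\<kappa> c p (b # I) = Y b p *\<^sub>R K p I + \<omega> p *\<^sub>R Dc b (\<lambda>q. K q I) p
      - (\<Sum>j<k. Y (I ! j) p *\<^sub>R K p (I[j := b]) + \<omega> p *\<^sub>R Dc (I ! j) (\<lambda>q. K q (I[j := b])) p)"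
    unfolding ext_cov_Cons[where u = \<omega>\<kappa>, OF p \<omega>\<kappa>_form I] D[OF I]
    by (intro arg_cong2[where f = minus] refl sum.cong D) (simp add: I)
  then show ?thesis
    unfolding sum.distrib scaleR_sum_right[symmetric] sum_D_K[OF p I] wedge_def by simp
qed

lemma sum_remove_index: "j < k \<Longrightarrow> (\<Sum>i<k. f i) = f j + (\<Sum>i\<in>{..<k} - {j}. f i)"
  for f :: "nat \<Rightarrow> 'v"
  by (simp add: sum.remove)

text \<open>Slot \<open>j\<close> is split off because there the second update overwrites the
  first.\<close>

lemma wedge_update:
  assumes I: "length I = k" and j: "j < k"
  shows "wedge q a (I[j := b]) = Y a q *\<^sub>R K q (I[j := b]) - Y b q *\<^sub>R K q (I[j := a])
    - (\<Sum>i\<in>{..<k} - {j}. Y (I ! i) q *\<^sub>R K q (I[j := b, i := a]))"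
  unfolding wedge_def sum_remove_index[OF j] using I j by simp

lemma wedge_skew:
  assumes q: "q \<in> fst c" and I: "length I = k" and j: "j < k"
  shows "wedge q a (I[j := b]) = - wedge q b (I[j := a])"
proof -
  have "(\<Sum>i\<in>{..<k} - {j}. Y (I ! i) q *\<^sub>R K q (I[j := b, i := a])) =
      (\<Sum>i\<in>{..<k} - {j}. - (Y (I ! i) q *\<^sub>R K q (I[j := a, i := b])))"
  proof (rule sum.cong[OF refl])
    fix i assume "i \<in> {..<k} - {j}"
    then show "Y (I ! i) q *\<^sub>R K q (I[j := b, i := a]) = - (Y (I ! i) q *\<^sub>R K q (I[j := a, i := b]))"
      using alternatingD[OF K_alt[OF q] I j, of i b a] by simp
  qed
  then show ?thesis unfolding wedge_update[OF I j] by (simp add: sum_negf)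
qed

lemma wedge_smooth: "length I = k \<Longrightarrow> smooth_section A V F (fst c) (\<lambda>q. wedge q b I)"
  unfolding wedge_def
  by (intro section_diff section_sum section_scale open_dom smooth_Y K_smooth) simp_all

lemma D_wedge:
  assumes p: "p \<in> fst c" and I: "length I = k"
  shows "Dc a (\<lambda>q. wedge q b I) p = pd a (Y b) p *\<^sub>R K p I + Y b p *\<^sub>R Dc a (\<lambda>q. K q I) p
    - (\<Sum>j<k. pd a (Y (I ! j)) p *\<^sub>R K p (I[j := b]) + Y (I ! j) p *\<^sub>R Dc a (\<lambda>q. K q (I[j := b])) p)"
proof -
  have I': "length (I[j := b]) = k" for j using I by simp
  note YK = section_scale[OF open_dom smooth_Y K_smooth[OF I]]
  note YK' = section_scale[OF open_dom smooth_Y K_smooth[OF I']]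
  have "Dc a (\<lambda>q. wedge q b I) p = Dc a (\<lambda>q. Y b q *\<^sub>R K q I) p
      - Dc a (\<lambda>q. \<Sum>j<k. Y (I ! j) q *\<^sub>R K q (I[j := b])) p"
    unfolding wedge_def by (rule Dc_diff[OF p p YK section_sum[OF open_dom YK']])
  also have "Dc a (\<lambda>q. \<Sum>j<k. Y (I ! j) q *\<^sub>R K q (I[j := b])) p =
      (\<Sum>j<k. Dc a (\<lambda>q. Y (I ! j) q *\<^sub>R K q (I[j := b])) p)"
    by (rule Dc_sum[OF p p YK'])
  finally show ?thesis
    by (simp only: Dc_scale[OF p p smooth_Y K_smooth[OF I]] Dc_scale[OF p p smooth_Y K_smooth[OF I']])
qed

text \<open>Leibniz rule for d\<omega> wedge \<open>\<kappa>\<close>. The derivatives obey it by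
  \<open>D_wedge\<close>; the work lies in matching the Christoffel corrections of the product slot
  by slot with those of the factors.\<close>

lemma nabla_wedge:
  assumes p: "p \<in> fst c" and I: "length I = k"
  shows "nabla A D g (ext_cov A D \<omega>\<kappa>) a c p (b # I) =
    Hess a b p *\<^sub>R K p I + Y b p *\<^sub>R nabla A D g \<kappa>c a c p I
    - (\<Sum>j<k. Hess a (I ! j) p *\<^sub>R K p (I[j := b]))
    - (\<Sum>j<k. Y (I ! j) p *\<^sub>R nabla A D g \<kappa>c a c p (I[j := b]))"
proof -
  let ?C = "\<lambda>e f. \<Sum>m\<in>UNIV. \<Gamma> m a e p *\<^sub>R f m"
  \<comment> \<open>Correction of slot \<open>j\<close> in the summand where \<open>Y\<close>
    carries index \<open>I ! i\<close> and \<open>b\<close> fills slot \<open>i\<close>, with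
    \<open>i\<close> and \<open>j\<close> distinct.\<close>
  let ?B = "\<lambda>j i. ?C (I ! j) (\<lambda>m. Y (I ! i) p *\<^sub>R K p (I[j := m, i := b]))"
  have I': "length (I[j := m]) = k" for j m using I by simp
  have lhs: "nabla A D g (ext_cov A D \<omega>\<kappa>) a c p (b # I) = Dc a (\<lambda>q. wedge q b I) p
      - (?C b (\<lambda>m. wedge p m I) + (\<Sum>j<k. ?C (I ! j) (\<lambda>m. wedge p b (I[j := m]))))"
  proof -
    have "Dc a (\<lambda>q. wedge q b I) p = Dc a (\<lambda>q. ext_cov A D \<omega>\<kappa> c q (b # I)) p"
      by (rule Dc_cong[OF p p _ wedge_smooth[OF I]]) (simp add: ext_cov_\<omega>\<kappa>[OF _ I])
    then show ?thesis
      unfolding nabla_def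
      by (simp only: length_Cons I sum.lessThan_Suc_shift nth_Cons_0 nth_Cons_Suc list_update.simps
          nat.case ext_cov_\<omega>\<kappa>[OF p I] ext_cov_\<omega>\<kappa>[OF p I'])
  qed
  have w0: "?C b (\<lambda>m. wedge p m I) = (\<Sum>m\<in>UNIV. \<Gamma> m a b p * Y m p) *\<^sub>R K p I
      - (\<Sum>j<k. Y (I ! j) p *\<^sub>R ?C b (\<lambda>m. K p (I[j := m])))"
  proof -
    have "?C b (\<lambda>m. wedge p m I) = (\<Sum>m\<in>UNIV. \<Gamma> m a b p * Y m p) *\<^sub>R K p I
        - (\<Sum>m\<in>UNIV. \<Sum>j<k. Y (I ! j) p *\<^sub>R \<Gamma> m a b p *\<^sub>R K p (I[j := m]))"
      unfolding wedge_def
      by (simp add: scaleR_diff_right sum_subtractf scaleR_sum_left scaleR_sum_right mult.commute)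
    also have "(\<Sum>m\<in>UNIV. \<Sum>j<k. Y (I ! j) p *\<^sub>R \<Gamma> m a b p *\<^sub>R K p (I[j := m])) =
        (\<Sum>j<k. \<Sum>m\<in>UNIV. Y (I ! j) p *\<^sub>R \<Gamma> m a b p *\<^sub>R K p (I[j := m]))"
      by (rule sum.swap)
    finally show ?thesis by (simp only: scaleR_sum_right)
  qed
  have wj: "?C (I ! j) (\<lambda>m. wedge p b (I[j := m])) = Y b p *\<^sub>R ?C (I ! j) (\<lambda>m. K p (I[j := m]))
      - (\<Sum>m\<in>UNIV. \<Gamma> m a (I ! j) p * Y m p) *\<^sub>R K p (I[j := b]) - (\<Sum>i\<in>{..<k} - {j}. ?B j i)"
    if j: "j < k" for j
  proof -
    have "?C (I ! j) (\<lambda>m. wedge p b (I[j := m])) = Y b p *\<^sub>R ?C (I ! j) (\<lambda>m. K p (I[j := m]))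
      - (\<Sum>m\<in>UNIV. \<Gamma> m a (I ! j) p * Y m p) *\<^sub>R K p (I[j := b])
      - (\<Sum>m\<in>UNIV. \<Sum>i\<in>{..<k} - {j}. \<Gamma> m a (I ! j) p *\<^sub>R Y (I ! i) p *\<^sub>R K p (I[j := m, i := b]))"
      unfolding wedge_update[OF I j]
      by (simp add: scaleR_diff_right sum_subtractf scaleR_sum_left scaleR_sum_right mult.commute)
    also have "(\<Sum>m\<in>UNIV. \<Sum>i\<in>{..<k} - {j}. \<Gamma> m a (I ! j) p *\<^sub>R Y (I ! i) p *\<^sub>R K p (I[j := m, i := b])) =
        (\<Sum>i\<in>{..<k} - {j}. ?B j i)"
      by (rule sum.swap)
    finally show ?thesis .
  qed
  have nK: "nabla A D g \<kappa>c a c p L = Dc a (\<lambda>q. K q L) p - (\<Sum>j<k. ?C (L ! j) (\<lambda>m. K p (L[j := m])))"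
    if "length L = k" for L
    by (simp add: nabla_def that)
  \<comment> \<open>In \<open>I[j := b]\<close> slot \<open>j\<close> holds \<open>b\<close>, and
    its correction matches the one in \<open>w0\<close>; the other slots give \<open>?B\<close> with
    its arguments interchanged.\<close>
  have nj: "Y (I ! j) p *\<^sub>R nabla A D g \<kappa>c a c p (I[j := b]) = Y (I ! j) p *\<^sub>R Dc a (\<lambda>q. K q (I[j := b])) p
      - Y (I ! j) p *\<^sub>R ?C b (\<lambda>m. K p (I[j := m])) - (\<Sum>i\<in>{..<k} - {j}. ?B i j)"
    if j: "j < k" for j
  proof -
    have "(\<Sum>i\<in>{..<k} - {j}. ?C (I[j := b] ! i) (\<lambda>m. Y (I ! j) p *\<^sub>R K p (I[j := b, i := m]))) =
        (\<Sum>i\<in>{..<k} - {j}. ?B i j)"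
    proof (rule sum.cong[OF refl])
      fix i assume "i \<in> {..<k} - {j}"
      then have "I[j := b] ! i = I ! i" "I[j := b, i := m] = I[i := m, j := b]" for m
        using list_update_swap[of i j I m b] by auto
      then show "?C (I[j := b] ! i) (\<lambda>m. Y (I ! j) p *\<^sub>R K p (I[j := b, i := m])) = ?B i j"
        by simp
    qed
    moreover have "Y (I ! j) p *\<^sub>R ?C e f = ?C e (\<lambda>m. Y (I ! j) p *\<^sub>R f m)" for e and f :: "'n \<Rightarrow> 'v"
      by (simp add: scaleR_sum_right mult.commute)
    ultimately show ?thesis
      unfolding nK[OF I'] sum_remove_index[OF j] scaleR_diff_right scaleR_add_right scaleR_sum_right
      using I j by simp
  qed
  have e1: "(\<Sum>j<k. ?C (I ! j) (\<lambda>m. wedge p b (I[j := m]))) =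
      Y b p *\<^sub>R (\<Sum>j<k. ?C (I ! j) (\<lambda>m. K p (I[j := m])))
      - (\<Sum>j<k. (\<Sum>m\<in>UNIV. \<Gamma> m a (I ! j) p * Y m p) *\<^sub>R K p (I[j := b]))
      - (\<Sum>j<k. \<Sum>i\<in>{..<k} - {j}. ?B j i)"
    unfolding scaleR_sum_right[of "Y b p"] sum_subtractf[symmetric]
    by (rule sum.cong[OF refl]) (simp only: wj lessThan_iff scaleR_sum_right)
  have e2: "(\<Sum>j<k. Y (I ! j) p *\<^sub>R nabla A D g \<kappa>c a c p (I[j := b])) =
      (\<Sum>j<k. Y (I ! j) p *\<^sub>R Dc a (\<lambda>q. K q (I[j := b])) p)
      - (\<Sum>j<k. Y (I ! j) p *\<^sub>R ?C b (\<lambda>m. K p (I[j := m]))) - (\<Sum>j<k. \<Sum>i\<in>{..<k} - {j}. ?B i j)"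
    unfolding sum_subtractf[symmetric]
    by (rule sum.cong[OF refl]) (simp only: nj lessThan_iff)
  have e3: "(\<Sum>j<k. Hess a (I ! j) p *\<^sub>R K p (I[j := b])) =
      (\<Sum>j<k. pd a (Y (I ! j)) p *\<^sub>R K p (I[j := b]))
      - (\<Sum>j<k. (\<Sum>m\<in>UNIV. \<Gamma> m a (I ! j) p * Y m p) *\<^sub>R K p (I[j := b]))"
    unfolding Hess_def by (simp only: scaleR_diff_left sum_subtractf)
  show ?thesis
    unfolding lhs w0 D_wedge[OF p I] nK[OF I] e1 e2 e3 Hess_def[of a b] sum_off_diagonal_swap[of ?B]
      sum.distrib
    by (simp only: scaleR_diff_left scaleR_diff_right) simp
qed

end

section \<open>The transformation law\<close>

context closed_form_chart begin

text \<open>Only the derivative part of the covariant derivative along the gradient; it depends on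
  the chart, and its \<Gamma> part is separated in \<open>sum_Yu_nabla\<close>.\<close>

definition D_gradient :: "'m \<Rightarrow> 'n list \<Rightarrow> 'v" where
  "D_gradient p I = (\<Sum>b\<in>UNIV. Yu b p *\<^sub>R Dc b (\<lambda>q. K q I) p)"

definition wedge_codiff :: "'m \<Rightarrow> 'n list \<Rightarrow> 'v" where
  "wedge_codiff p I = (\<Sum>j<k. Y (I ! j) p *\<^sub>R (-1) ^ j *\<^sub>R codiff A D g \<kappa>c c p (take j I @ drop (Suc j) I))"

text \<open>The derivation action of an endomorphism field on \<open>\<kappa>\<close>. For the
  rank-one field \<open>YYu\<close> it is d\<omega> wedge the contraction of \<open>\<kappa>\<close>
  with the gradient.\<close>

definition deriv_action :: "('n \<Rightarrow> 'n \<Rightarrow> 'm \<Rightarrow> real) \<Rightarrow> 'm \<Rightarrow> 'n list \<Rightarrow> 'v" where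
  "deriv_action B p I = (\<Sum>j<k. \<Sum>b\<in>UNIV. B (I ! j) b p *\<^sub>R K p (I[j := b]))"

abbreviation dYu :: "'n \<Rightarrow> 'n \<Rightarrow> 'm \<Rightarrow> real" where "dYu a b \<equiv> pd a (Yu b)"
abbreviation \<Gamma>Yu :: "'n \<Rightarrow> 'n \<Rightarrow> 'm \<Rightarrow> real" where
  "\<Gamma>Yu a b p \<equiv> \<Sum>m\<in>UNIV. \<Gamma> b a m p * Yu m p"
abbreviation YYu :: "'n \<Rightarrow> 'n \<Rightarrow> 'm \<Rightarrow> real" where "YYu a b p \<equiv> Y a p * Yu b p"

lemma deriv_action_nablaYu: "deriv_action nablaYu p I = deriv_action dYu p I + deriv_action \<Gamma>Yu p I"
  unfolding deriv_action_def nablaYu_def scaleR_add_left sum.distrib ..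

lemma sum_Yu_nabla:
  assumes p: "p \<in> fst c" and I: "length I = k"
  shows "(\<Sum>a\<in>UNIV. Yu a p *\<^sub>R nabla A D g \<kappa>c a c p I) = D_gradient p I - deriv_action \<Gamma>Yu p I"
proof -
  have "(\<Sum>a\<in>UNIV. Yu a p *\<^sub>R (\<Sum>j<k. \<Sum>m\<in>UNIV. \<Gamma> m a (I ! j) p *\<^sub>R K p (I[j := m]))) =
      (\<Sum>a\<in>UNIV. \<Sum>j<k. \<Sum>m\<in>UNIV. (\<Gamma> m (I ! j) a p * Yu a p) *\<^sub>R K p (I[j := m]))"
    unfolding scaleR_sum_right scaleR_scaleR
    by (intro sum.cong refl) (simp only: \<Gamma>_sym[OF p] mult.commute)
  also have "\<dots> = (\<Sum>j<k. \<Sum>a\<in>UNIV. \<Sum>m\<in>UNIV. (\<Gamma> m (I ! j) a p * Yu a p) *\<^sub>R K p (I[j := m]))"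
    by (rule sum.swap)
  also have "\<dots> = deriv_action \<Gamma>Yu p I"
    unfolding deriv_action_def scaleR_sum_left
    by (rule sum.cong[OF refl]) (rule sum.swap)
  finally show ?thesis
    unfolding nabla_def I scaleR_diff_right sum_subtractf D_gradient_def by simp
qed

text \<open>Tracing \<open>nabla_wedge\<close> gives the Laplacian, the gradient derivative, the
  Hessian action and the wedge with the coderivative. The extra \<open>\<Gamma>Yu\<close> term
  appears because the gradient derivative is expressed by \<open>D_gradient\<close>.\<close>

lemma codiff_ext_cov_\<omega>\<kappa>:
  assumes p: "p \<in> fst c" and I: "length I = k"
  shows "codiff A D g (ext_cov A D \<omega>\<kappa>) c p I =
    deriv_action nablaYu p I + deriv_action \<Gamma>Yu p I - D_gradient p I - wedge_codiff p I - Lap p *\<^sub>R K p I"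
proof -
  let ?H = "\<lambda>f. \<Sum>a\<in>UNIV. \<Sum>b\<in>UNIV. H a b p *\<^sub>R f a b"
  have h1: "?H (\<lambda>a b. Hess a b p *\<^sub>R K p I) = Lap p *\<^sub>R K p I"
    unfolding scaleR_scaleR scaleR_sum_left[symmetric] trace_Hess[OF p] ..
  have h2: "?H (\<lambda>a b. \<Sum>j<k. Hess a (I ! j) p *\<^sub>R K p (I[j := b])) = deriv_action nablaYu p I"
  proof -
    have "?H (\<lambda>a b. \<Sum>j<k. Hess a (I ! j) p *\<^sub>R K p (I[j := b])) =
        (\<Sum>j<k. \<Sum>a\<in>UNIV. \<Sum>b\<in>UNIV. (H a b p * Hess a (I ! j) p) *\<^sub>R K p (I[j := b]))"
      unfolding scaleR_sum_right scaleR_scaleR by (rule sum_swap3)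
    also have "\<dots> = (\<Sum>j<k. \<Sum>b\<in>UNIV. \<Sum>a\<in>UNIV. (H b a p * Hess (I ! j) a p) *\<^sub>R K p (I[j := b]))"
      by (rule sum.cong[OF refl], subst sum.swap)
        (simp only: H_sym[OF p] Hess_sym[OF p])
    finally show ?thesis
      unfolding deriv_action_def nablaYu_eq[OF p] scaleR_sum_left .
  qed
  have h3: "?H (\<lambda>a b. \<Sum>j<k. Y (I ! j) p *\<^sub>R nabla A D g \<kappa>c a c p (I[j := b])) = - wedge_codiff p I"
  proof -
    have "?H (\<lambda>a b. \<Sum>j<k. Y (I ! j) p *\<^sub>R nabla A D g \<kappa>c a c p (I[j := b])) =
        (\<Sum>j<k. \<Sum>a\<in>UNIV. \<Sum>b\<in>UNIV. H a b p *\<^sub>R Y (I ! j) p *\<^sub>R nabla A D g \<kappa>c a c p (I[j := b]))"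
      unfolding scaleR_sum_right by (rule sum_swap3)
    also have "\<dots> = (\<Sum>j<k. - (Y (I ! j) p *\<^sub>R (-1) ^ j *\<^sub>R
        codiff A D g \<kappa>c c p (take j I @ drop (Suc j) I)))"
    proof (rule sum.cong[OF refl])
      fix j assume "j \<in> {..<k}"
      then have j: "j < k" by simp
      show "(\<Sum>a\<in>UNIV. \<Sum>b\<in>UNIV. H a b p *\<^sub>R Y (I ! j) p *\<^sub>R nabla A D g \<kappa>c a c p (I[j := b])) =
          - (Y (I ! j) p *\<^sub>R (-1) ^ j *\<^sub>R codiff A D g \<kappa>c c p (take j I @ drop (Suc j) I))"
        unfolding codiff_move[where u = \<kappa>c, OF p K_form I j]
        by (simp add: scaleR_sum_right mult.commute)
    qed
    finally show ?thesis unfolding wedge_codiff_def sum_negf .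
  qed
  have "codiff A D g (ext_cov A D \<omega>\<kappa>) c p I =
    - (?H (\<lambda>a b. Hess a b p *\<^sub>R K p I) + ?H (\<lambda>a b. Y b p *\<^sub>R nabla A D g \<kappa>c a c p I)
      - ?H (\<lambda>a b. \<Sum>j<k. Hess a (I ! j) p *\<^sub>R K p (I[j := b]))
      - ?H (\<lambda>a b. \<Sum>j<k. Y (I ! j) p *\<^sub>R nabla A D g \<kappa>c a c p (I[j := b])))"
    unfolding codiff_def nabla_wedge[OF p I] scaleR_diff_right scaleR_add_right sum_subtractf sum.distrib ..
  then show ?thesis
    unfolding h1 h2 h3 contract_Y_right sum_Yu_nabla[OF p I] by simp
qed

text \<open>The multiple of the identity in \<open>hat_schouten_mixed\<close> reproduces
  \<open>\<kappa>\<close> once per slot, whence the factor \<open>k\<close>.\<close>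

lemma hat_schouten_sharp:
  assumes p: "p \<in> fst c" and I: "length I = k" and n: "CARD('n) \<ge> 3"
  shows "schouten_sharp A (rescale \<omega> g) \<kappa>c c p I = exp (- 2 * \<omega> p) *\<^sub>R
    (schouten_sharp A g \<kappa>c c p I - deriv_action nablaYu p I + deriv_action YYu p I
      - (real k * Norm2 p / 2) *\<^sub>R K p I)"
proof -
  let ?S = "\<lambda>i b. \<Sum>a\<in>UNIV. schouten A g c p i a * H a b p"
  let ?\<delta> = "\<lambda>i b. Norm2 p / 2 * (if i = b then 1 else 0)"
  have \<delta>: "(\<Sum>j<k. \<Sum>b\<in>UNIV. ?\<delta> (I ! j) b *\<^sub>R K p (I[j := b])) = (real k * Norm2 p / 2) *\<^sub>R K p I"
  proof -
    have "?\<delta> i b *\<^sub>R K p (I[j := b]) = (if i = b then (Norm2 p / 2) *\<^sub>R K p (I[j := b]) else 0)" for i j b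
      by simp
    then show ?thesis by (simp add: sum_constant_scaleR)
  qed
  have "schouten_sharp A (rescale \<omega> g) \<kappa>c c p I = (\<Sum>j<k. \<Sum>b\<in>UNIV. exp (- 2 * \<omega> p) *\<^sub>R
      (?S (I ! j) b *\<^sub>R K p (I[j := b]) - nablaYu (I ! j) b p *\<^sub>R K p (I[j := b])
      + YYu (I ! j) b p *\<^sub>R K p (I[j := b]) - ?\<delta> (I ! j) b *\<^sub>R K p (I[j := b])))"
    unfolding schouten_sharp_def hat_schouten_mixed[OF p n] I
    by (simp only: scaleR_scaleR[symmetric] scaleR_diff_left scaleR_add_left)
  then show ?thesis
    unfolding scaleR_sum_right[symmetric] sum.distrib sum_subtractf \<delta>
    unfolding schouten_sharp_def deriv_action_def I .
qed

text \<open>Here 2(l + 1) - n = 2k - (2k + 2) = -2.\<close>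

lemma hat_codiff:
  assumes q: "q \<in> fst c" and k: "k = Suc l" and L: "length L = l" and n: "CARD('n) = 2 * k + 2"
  shows "codiff A D (rescale \<omega> g) \<kappa>c c q L = exp (- 2 * \<omega> q) *\<^sub>R
    (codiff A D g \<kappa>c c q L - 2 *\<^sub>R (\<Sum>b\<in>UNIV. Yu b q *\<^sub>R K q (b # L)))"
proof -
  have "codiff A D (rescale \<omega> g) \<kappa>c c q L = exp (- 2 * \<omega> q) *\<^sub>R
    (codiff A D g \<kappa>c c q L + (2 * (real l + 1) - real CARD('n)) *\<^sub>R (\<Sum>b\<in>UNIV. Yu b q *\<^sub>R K q (b # L)))"
    by (rule codiff_rescale[OF q L]) (rule alternating_head[OF K_alt[OF q, unfolded k] L])
  then show ?thesis using n k by simp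
qed

text \<open>Product rule for the exponential times the coderivative minus twice the contraction. The
  coefficient 4 is (-2) times (-2), and Cartan's formula leaves coordinate derivatives only.\<close>

lemma ext_cov_hat_codiff:
  assumes p: "p \<in> fst c" and I: "length I = k" and k: "k = Suc l" and n: "CARD('n) = 2 * k + 2"
  shows "ext_cov A D (codiff A D (rescale \<omega> g) \<kappa>c) c p I = exp (- 2 * \<omega> p) *\<^sub>R
    (ext_cov A D (codiff A D g \<kappa>c) c p I - 2 *\<^sub>R (deriv_action dYu p I + D_gradient p I)
      - 2 *\<^sub>R wedge_codiff p I + 4 *\<^sub>R deriv_action YYu p I)"
proof -
  let ?L = "\<lambda>j. take j I @ drop (Suc j) I"
  let ?\<delta> = "\<lambda>j q. codiff A D g \<kappa>c c q (?L j)"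
  \<comment> \<open>Up to the sign (-1)^j this is the contraction of \<open>\<kappa>\<close> with
    the gradient, evaluated with index \<open>j\<close> omitted.\<close>
  let ?X = "\<lambda>j q. \<Sum>b\<in>UNIV. Yu b q *\<^sub>R K q (I[j := b])"
  let ?dX = "\<lambda>j. \<Sum>b\<in>UNIV. dYu (I ! j) b p *\<^sub>R K p (I[j := b])"
  let ?DX = "\<lambda>j. \<Sum>b\<in>UNIV. Yu b p *\<^sub>R Dc (I ! j) (\<lambda>q. K q (I[j := b])) p"
  have I': "length (I[j := b]) = k" for j b using I by simp
  have X: "smooth_section A V F (fst c) (?X j)" for j
    by (intro section_sum section_scale open_dom smooth_Yu K_smooth I')
  have DX: "Dc (I ! j) (?X j) p = ?dX j + ?DX j" for j
  proof -
    have "Dc (I ! j) (?X j) p = (\<Sum>b\<in>UNIV. Dc (I ! j) (\<lambda>q. Yu b q *\<^sub>R K q (I[j := b])) p)"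
      by (rule Dc_sum[OF p p section_scale[OF open_dom smooth_Yu K_smooth[OF I']]])
    then show ?thesis
      by (simp only: Dc_scale[OF p p smooth_Yu K_smooth[OF I']] sum.distrib)
  qed
  have w: "smooth_fun A (fst c) (\<lambda>q. - 2 * \<omega> q)"
    by (rule smooth_fun_cmult[OF open_dom smooth_\<omega>_chart])
  have e: "smooth_fun A (fst c) (\<lambda>q. exp (- 2 * \<omega> q))"
    by (rule smooth_fun_exp[OF open_dom w])
  have de: "pd i (\<lambda>q. exp (- 2 * \<omega> q)) p = exp (- 2 * \<omega> p) * (- 2 * Y i p)" for i
    unfolding coord_vec_exp[OF open_dom p chart p w] coord_vec_cmult[OF open_dom p chart p smooth_\<omega>_chart] ..
  have main: "(-1) ^ j *\<^sub>R Dc (I ! j) (\<lambda>q. codiff A D (rescale \<omega> g) \<kappa>c c q (?L j)) p =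
      exp (- 2 * \<omega> p) *\<^sub>R ((-1) ^ j *\<^sub>R Dc (I ! j) (?\<delta> j) p - 2 *\<^sub>R (?dX j + ?DX j)
        - 2 *\<^sub>R Y (I ! j) p *\<^sub>R (-1) ^ j *\<^sub>R ?\<delta> j p + 4 *\<^sub>R Y (I ! j) p *\<^sub>R ?X j p)"
    if j: "j < k" for j
  proof -
    have L: "length (?L j) = l" using I j k by simp
    have sq: "(-1 :: real) ^ j * (-1) ^ j = 1" by (simp flip: power_mult_distrib)
    have XL: "(\<Sum>b\<in>UNIV. Yu b q *\<^sub>R K q (b # ?L j)) = (-1) ^ j *\<^sub>R ?X j q" if "q \<in> fst c" for q
      unfolding alternating_move[OF K_alt[OF that] I j] by (simp add: scaleR_sum_right mult.commute)
    have \<delta>: "smooth_section A V F (fst c) (?\<delta> j)"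
      by (rule codiff_smooth[where u = \<kappa>c, OF K_form[unfolded k] L])
    note X2 = section_cscale[OF open_dom X[of j], of "2 * (-1) ^ j"]
    note s = section_diff[OF open_dom \<delta> X2]
    have "Dc (I ! j) (\<lambda>q. exp (- 2 * \<omega> q) *\<^sub>R (?\<delta> j q - (2 * (-1) ^ j) *\<^sub>R ?X j q)) p =
        Dc (I ! j) (\<lambda>q. codiff A D (rescale \<omega> g) \<kappa>c c q (?L j)) p"
      by (rule Dc_cong[OF p p _ section_scale[OF open_dom e s]])
        (simp only: hat_codiff[OF _ k L n] XL scaleR_scaleR)
    moreover have "Dc (I ! j) (\<lambda>q. exp (- 2 * \<omega> q) *\<^sub>R (?\<delta> j q - (2 * (-1) ^ j) *\<^sub>R ?X j q)) p =
        (exp (- 2 * \<omega> p) * (- 2 * Y (I ! j) p)) *\<^sub>R (?\<delta> j p - (2 * (-1) ^ j) *\<^sub>R ?X j p)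
        + exp (- 2 * \<omega> p) *\<^sub>R (Dc (I ! j) (?\<delta> j) p - (2 * (-1) ^ j) *\<^sub>R (?dX j + ?DX j))"
      unfolding Dc_scale[OF p p e s] Dc_diff[OF p p \<delta> X2] Dc_cscale[OF p p X] DX de ..
    ultimately have "(-1) ^ j *\<^sub>R Dc (I ! j) (\<lambda>q. codiff A D (rescale \<omega> g) \<kappa>c c q (?L j)) p =
        (-1) ^ j *\<^sub>R ((exp (- 2 * \<omega> p) * (- 2 * Y (I ! j) p)) *\<^sub>R (?\<delta> j p - (2 * (-1) ^ j) *\<^sub>R ?X j p)
        + exp (- 2 * \<omega> p) *\<^sub>R (Dc (I ! j) (?\<delta> j) p - (2 * (-1) ^ j) *\<^sub>R (?dX j + ?DX j)))"
      by simp
    also have "\<dots> = exp (- 2 * \<omega> p) *\<^sub>R ((-1) ^ j *\<^sub>R Dc (I ! j) (?\<delta> j) p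
        - (2 * ((-1) ^ j * (-1) ^ j)) *\<^sub>R (?dX j + ?DX j)
        - 2 *\<^sub>R Y (I ! j) p *\<^sub>R (-1) ^ j *\<^sub>R ?\<delta> j p + (4 * ((-1) ^ j * (-1) ^ j)) *\<^sub>R Y (I ! j) p *\<^sub>R ?X j p)"
      by (simp add: scaleR_diff_right scaleR_add_right mult_ac)
    finally show ?thesis unfolding sq by simp
  qed
  \<comment> \<open>After exchanging the sums, closedness turns the inner one into the derivative in
    direction \<open>b\<close>.\<close>
  have "(\<Sum>j<k. ?DX j) = (\<Sum>b\<in>UNIV. \<Sum>j<k. Yu b p *\<^sub>R Dc (I ! j) (\<lambda>q. K q (I[j := b])) p)"
    by (rule sum.swap)
  also have "\<dots> = D_gradient p I"
    unfolding D_gradient_def scaleR_sum_right[symmetric] sum_D_K[OF p I] ..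
  finally have E: "(\<Sum>j<k. ?DX j) = D_gradient p I" .
  have "ext_cov A D (codiff A D (rescale \<omega> g) \<kappa>c) c p I =
      (\<Sum>j<k. exp (- 2 * \<omega> p) *\<^sub>R ((-1) ^ j *\<^sub>R Dc (I ! j) (?\<delta> j) p - 2 *\<^sub>R (?dX j + ?DX j)
        - 2 *\<^sub>R Y (I ! j) p *\<^sub>R (-1) ^ j *\<^sub>R ?\<delta> j p + 4 *\<^sub>R Y (I ! j) p *\<^sub>R ?X j p))"
    unfolding ext_cov_def I by (rule sum.cong[OF refl]) (simp only: main lessThan_iff)
  also have "\<dots> = exp (- 2 * \<omega> p) *\<^sub>R ((\<Sum>j<k. (-1) ^ j *\<^sub>R Dc (I ! j) (?\<delta> j) p)
      - 2 *\<^sub>R ((\<Sum>j<k. ?dX j) + (\<Sum>j<k. ?DX j))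
      - 2 *\<^sub>R wedge_codiff p I + 4 *\<^sub>R (\<Sum>j<k. Y (I ! j) p *\<^sub>R ?X j p))"
    unfolding wedge_codiff_def scaleR_sum_right[symmetric] sum.distrib sum_subtractf ..
  also have "(\<Sum>j<k. Y (I ! j) p *\<^sub>R ?X j p) = deriv_action YYu p I"
    unfolding deriv_action_def scaleR_sum_right scaleR_scaleR ..
  finally show ?thesis
    unfolding E ext_cov_def I deriv_action_def .
qed

text \<open>The terms in \<open>YYu\<close> cancel as 4 - 4 and the squared norms as 2k - 2k. In the
  rest \<open>nablaYu\<close> is split so that -2 \<open>dYu\<close> from the Lie derivative meets 4
  \<open>nablaYu\<close> from the Schouten term.\<close>

lemma hat_Q:
  assumes p: "p \<in> fst c" and I: "length I = k" and k: "k \<ge> 1" and n: "CARD('n) = 2 * k + 2"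
  shows "Q_in_scale A D (rescale \<omega> g) \<kappa>c c p I = exp (- 2 * \<omega> p) *\<^sub>R
    (Q_in_scale A D g \<kappa>c c p I + 2 *\<^sub>R codiff A D g (ext_cov A D \<omega>\<kappa>) c p I)"
proof -
  obtain l where l: "k = Suc l" using k by (cases k) auto
  have n3: "CARD('n) \<ge> 3" and n2: "CARD('n) \<ge> 2" using n k by simp_all
  \<comment> \<open>Here the degree is tied to the dimension: the squared-norm coefficient of
    \<open>hat_J\<close> becomes \<open>k\<close>.\<close>
  have nk: "real CARD('n) / 2 - 1 = real k" using n by (simp add: field_simps)
  \<comment> \<open>One half of the Schouten coefficient cancels the Lie derivative, the other half
    belongs to the coderivative term.\<close>
  have four: "(4 * r) *\<^sub>R x = (2 * r) *\<^sub>R x + (2 * r) *\<^sub>R x" for r :: real and x :: 'v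
    by (simp flip: scaleR_add_left)
  show ?thesis
    unfolding Q_in_scale_def ext_cov_hat_codiff[OF p I l n] hat_schouten_sharp[OF p I n3]
      hat_J[OF p n2] nk codiff_ext_cov_\<omega>\<kappa>[OF p I] deriv_action_nablaYu
    by (simp add: algebra_simps four)
qed

text \<open>In the scale exp(2\<upsilon>) g the density over the rescaled metric carries
  exp(-2(\<upsilon> - \<omega>)), which with the exp(-2\<omega>) of \<open>hat_Q\<close> gives
  exp(-2\<upsilon>), the factor of the other two terms.\<close>

lemma Q_op_rescale:
  assumes p: "p \<in> fst c" and I: "length I = k" and k: "k \<ge> 1" and n: "CARD('n) = 2 * k + 2"
    and \<upsilon>: "smooth_fun A UNIV \<upsilon>"
  shows "Q_op A D (rescale \<omega> g) \<kappa>c (rescale \<upsilon> g) c p I = Q_op A D g \<kappa>c (rescale \<upsilon> g) c p I +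
    2 *\<^sub>R codiff_density A D (weight_zero (ext_cov A D \<omega>\<kappa>)) (rescale \<upsilon> g) c p I"
proof -
  let ?U = "ext_cov A D \<omega>\<kappa>"
  have lf: "log_factor g (rescale \<upsilon> g) = \<upsilon>" by (rule log_factor_rescale[OF metric])
  \<comment> \<open>The same scale seen from the rescaled metric, which determines the logarithmic
    factor relative to it.\<close>
  have "rescale \<upsilon> g = rescale (\<lambda>q. \<upsilon> q - \<omega> q) (rescale \<omega> g)" unfolding rescale_rescale by simp
  then have lf': "log_factor (rescale \<omega> g) (rescale \<upsilon> g) = (\<lambda>q. \<upsilon> q - \<omega> q)"
    using log_factor_rescale[OF hat.metric] by metis
  have \<upsilon>_chart: "conformal_chart A g c \<upsilon>"
    by (intro conformal_chart.intro conformal_chart_axioms.intro metric_chart_axioms \<upsilon>)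
  have skew: "?U c p (a # I[j := b]) = - ?U c p (b # I[j := a])" if "j < k" for j a b
    by (simp only: ext_cov_\<omega>\<kappa>[OF p] length_list_update I) (rule wedge_skew[OF p I that])
  have "2 * (real k + 1) - real CARD('n) = 0" using n by simp
  then have U: "codiff A D (rescale \<upsilon> g) ?U c p I = exp (- 2 * \<upsilon> p) *\<^sub>R codiff A D g ?U c p I"
    using conformal_chart.codiff_rescale[OF \<upsilon>_chart, where u = ?U, OF p I skew] by simp
  have e: "exp (- 2 * (\<upsilon> p - \<omega> p)) * exp (- 2 * \<omega> p) = exp (- 2 * \<upsilon> p)"
    by (simp flip: exp_add)
  show ?thesis
    unfolding Q_op_def density_from_scale_def codiff_density_def weight_zero_def lf lf' U
      hat_Q[OF p I k n] scaleR_scaleR e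
    by (simp add: scaleR_add_right mult.commute)
qed

end

theorem theorem5p3:
  fixes A :: "('m::{t2_space, second_countable_topology}, 'n::finite) chart set"
    and C :: "'m metric set"
    and V :: "'m \<Rightarrow> 'v::real_vector set" and F :: "('m, 'v) frame set"
    and D :: "('m, 'v) connection"
    and g :: "'m metric" and \<omega> :: "'m \<Rightarrow> real" and \<kappa> :: "('m, 'v) vform"
  assumes "even CARD('n)" and "CARD('n) \<ge> 4"
    and "smooth_manifold A" and "conformal_class A C"
    and "vector_bundle A V F" and "is_connection A V F D"
    and "g \<in> C" and "smooth_fun A UNIV \<omega>"
    and "\<kappa> \<in> closed_vforms A V F D (CARD('n) div 2 - 1)"
  shows "\<forall>h\<in>C. \<forall>c\<in>A. \<forall>p\<in>fst c. \<forall>I. length I = CARD('n) div 2 - 1 \<longrightarrow>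
    Q_op A D (rescale \<omega> g) (components A \<kappa>) h c p I =
    Q_op A D g (components A \<kappa>) h c p I +
    2 *\<^sub>R codiff_density A D
          (weight_zero (ext_cov A D (components A (\<lambda>q vs. \<omega> q *\<^sub>R \<kappa> q vs)))) h c p I"
proof (intro ballI allI impI)
  fix h c p and I :: "'n list"
  assume h: "h \<in> C" and c: "c \<in> A" and p: "p \<in> fst c"
  let ?k = "CARD('n) div 2 - 1"
  assume I: "length I = ?k"
  \<comment> \<open>Evenness makes the division exact, and dimension at least 4 keeps the truncated
    subtraction exact and the degree positive.\<close>
  have n: "CARD('n) = 2 * ?k + 2" and k: "?k \<ge> 1" using assms(1,2) by auto
  interpret manifold A using assms(3) by unfold_locales
  obtain g0 where g0: "is_metric A g0" "C = {rescale \<omega> g0 |\<omega>. smooth_fun A UNIV \<omega>}"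
    using assms(4) unfolding conformal_class_def by blast
  obtain \<phi> where \<phi>: "g = rescale \<phi> g0" "smooth_fun A UNIV \<phi>" using assms(7) g0(2) by blast
  obtain \<psi> where \<psi>: "h = rescale \<psi> g0" "smooth_fun A UNIV \<psi>" using h g0(2) by blast
  have g: "is_metric A g" using rescale_is_metric[OF g0(1) \<phi>(2)] \<phi>(1) by simp
  \<comment> \<open>Both metrics are given relative to the base metric \<open>g0\<close> of the
    class; the quotient of their factors expresses \<open>h\<close> relative to
    \<open>g\<close>.\<close>
  have h': "h = rescale (\<lambda>q. \<psi> q - \<phi> q) g" unfolding \<phi> \<psi> rescale_rescale by simp
  have chart: "closed_form_chart A g c \<omega> V F D \<kappa> ?k"
    by (intro closed_form_chart.intro conformal_chart.intro conformal_chart_axioms.intro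
        closed_form_chart_axioms.intro bundle_chart.intro metric_chart.intro metric_chart_axioms.intro
        bundle_connection.intro bundle_connection_axioms.intro manifold_axioms g c assms)
  show "Q_op A D (rescale \<omega> g) (components A \<kappa>) h c p I =
    Q_op A D g (components A \<kappa>) h c p I +
    2 *\<^sub>R codiff_density A D
          (weight_zero (ext_cov A D (components A (\<lambda>q vs. \<omega> q *\<^sub>R \<kappa> q vs)))) h c p I"
    unfolding h'
    by (rule closed_form_chart.Q_op_rescale[OF chart p I k n smooth_fun_diff[OF open_UNIV \<psi>(2) \<phi>(2)]])
qed

end
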